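(* Let $d\in\mathbb{N}$ and $0<\eta<1/d$. If $d=1$ then $\mathcal{D}(\eta)^c=K_1^c=\mathbb{Q}$. If $d\ge 2$ then \[\dim_H(\mathcal{D}(\eta)^c\setminus K_d^c)\ge \frac{d}{1+1/\eta}\] and \[\dim_H(\mathcal{D}(\eta)^c\setminus K_d^c)\le d-2+\frac{2(d+1)((1+\eta)d-1)}{(1+\eta)d^2}.\]
   Context: For $\boldsymbol{\alpha}\in\mathbb{R}^d$ and $\eta\in\mathbb{R}$, let $\mathrm{NA}_\eta(\boldsymbol{\alpha})=\{|q|^{\eta}(q\boldsymbol{\alpha}-\boldsymbol{p}):q\in\mathbb{Z}\setminus\{0\},\ \boldsymbol{p}\in\mathbb{Z}^d\}$ and let $\mathcal{A}_\eta(\boldsymbol{\alpha})$ be the set of accumulation points of $\mathrm{NA}_\eta(\boldsymbol{\alpha})$. Define $\mathcal{D}(\eta)=\{\boldsymbol{\alpha}\in\mathbb{R}^d:\mathcal{A}_\eta(\boldsymbol{\alpha})=\mathbb{R}^d\}$ with complement $\mathcal{D}(\eta)^c$ in $\mathbb{R}^d$. $K_d$ denotes the set of $\boldsymbol{\alpha}=(\alpha_1,\dots,\alpha_d)\in\mathbb{R}^d$ such that $1,\alpha_1,\ldots,\alpha_d$ are linearly independent over $\mathbb{Q}$, and $K_d^c=\mathbb{R}^d\setminus K_d$. $\dim_H$ denotes Hausdorff dimension. *)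

theory Defs
  imports "HOL-Analysis.Analysis"
begin

definition hausdorff_content :: "real \<Rightarrow> real \<Rightarrow> 'a::metric_space set \<Rightarrow> ennreal" where
  "hausdorff_content s \<delta> A =
     (INF U \<in> {U :: nat \<Rightarrow> 'a set. A \<subseteq> (\<Union>i. U i) \<and> (\<forall>i. bounded (U i) \<and> diameter (U i) \<le> \<delta>)}.
        (\<Sum>i. ennreal (diameter (U i) powr s)))"

definition hausdorff_measure :: "real \<Rightarrow> 'a::metric_space set \<Rightarrow> ennreal" where
  "hausdorff_measure s A = (SUP \<delta> \<in> {0<..}. hausdorff_content s \<delta> A)"

definition hausdorff_dim :: "'a::metric_space set \<Rightarrow> ereal" where
  "hausdorff_dim A = Inf (ereal ` {s. 0 < s \<and> hausdorff_measure s A = 0})"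

definition NA :: "real \<Rightarrow> real ^ 'n \<Rightarrow> (real ^ 'n) set" where
  "NA \<eta> \<alpha> = {(\<bar>real_of_int q\<bar> powr \<eta>) *\<^sub>R (of_int q *\<^sub>R \<alpha> - p) | q p.
                  q \<noteq> 0 \<and> (\<forall>i. p $ i \<in> \<int>)}"

definition accA :: "real \<Rightarrow> real ^ 'n \<Rightarrow> (real ^ 'n) set" where
  "accA \<eta> \<alpha> = {x. x islimpt NA \<eta> \<alpha>}"

definition Dset :: "real \<Rightarrow> (real ^ 'n) set" where
  "Dset \<eta> = {\<alpha>. accA \<eta> \<alpha> = UNIV}"

definition Kset :: "(real ^ 'n) set" where
  "Kset = {\<alpha>. \<forall>(c0::real) (c::'n \<Rightarrow> real). c0 \<in> \<rat> \<and> (\<forall>i. c i \<in> \<rat>) \<and>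
               c0 + (\<Sum>i\<in>UNIV. c i * \<alpha> $ i) = 0 \<longrightarrow> c0 = 0 \<and> (\<forall>i. c i = 0)}"

end

theory Submission
  imports Defs "HOL-Probability.Probability" "HOL-Real_Asymp.Real_Asymp"
begin

text \<open>
  Upper bound. If \<open>|q|\<^sup>\<eta>(q\<alpha> - p)\<close> misses a ball, then an effective form of Kronecker's theorem,
  obtained from almost orthogonality of the characters \<open>q \<mapsto> e(q c\<cdot>\<alpha>)\<close>, yields for every large \<open>T\<close> a
  nonzero integer vector \<open>c\<close> with \<open>|c| \<lesssim> T\<^sup>\<eta>\<close> and \<open>c\<cdot>\<alpha>\<close> within \<open>O(1/T)\<close> of an integer. For \<open>\<alpha>\<close> in \<open>K\<^sub>d\<close>
  these vectors are unbounded, so \<open>\<alpha>\<close> lies in infinitely many slabs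
  \<open>|c\<cdot>\<alpha> - p| \<lesssim> |c|\<^bsup>-1/\<eta>\<^esup>\<close>. Covering the slabs by cubes bounds the dimension by
  \<open>d - 1 + (d + 1)\<eta>/(1 + \<eta>)\<close>, which is at most the stated bound because their difference has the sign
  of \<open>(d\<^sup>2 - 2)(1 - \<eta>d)\<close>.

  Lower bound. The set is not dense as soon as, at every scale, one of two fixed coordinates of \<open>\<alpha>\<close> is
  extremely close to a rational. For \<open>d = 2\<close> the two coordinates take this role in turns, with rapidly
  increasing denominators; at each step there are about \<open>X\<^sup>2\<close> reduced fractions with denominators at
  most \<open>X\<close> to choose from, and the mass distribution principle for the uniform measure on these
  choices gives dimension at least \<open>2/(1 + 1/\<eta>)\<close>. For \<open>d \<ge> 3\<close> one such pair may be fixed while another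
  coordinate moves freely, and the resulting dimension 1 exceeds \<open>d/(1 + 1/\<eta>)\<close>.
\<close>

subsection \<open>Hausdorff measure\<close>

text \<open>The factor |q|^\<eta> is not constant, so Kronecker's theorem is applied on a window Q
  \<le> q < Q + 2M with Q a large multiple of M, where the factor varies little and x / Q^\<eta> can
  serve as target. M may grow like N^(1/\<eta>), which becomes the exponent of the slabs.

  In the lower bound one irrational coordinate cannot serve all scales: for large consecutive q its
  approximations would have denominators of order at most q^\<eta> and errors of order
  q^(-1-\<eta>), hence coincide as \<eta> < 1. Such a tolerance \<rho> = X^(-1-1/\<eta>) is the
  worst scale for the mass: about X^2 choices of fractions with denominators up to X leave mass
  X^(-2) = \<rho>^(2/(1+1/\<eta>)), and the losses from earlier levels are negligible because X
  grows fast.\<close>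

lemma hausdorff_measure_eq_0I:
  fixes A :: "'a::metric_space set"
  assumes "\<And>\<delta> \<epsilon>. 0 < \<delta> \<Longrightarrow> 0 < \<epsilon> \<Longrightarrow> \<exists>U :: nat \<Rightarrow> 'a set. A \<subseteq> (\<Union>i. U i) \<and>
     (\<forall>i. bounded (U i) \<and> diameter (U i) \<le> \<delta>) \<and> (\<Sum>i. ennreal (diameter (U i) powr s)) \<le> ennreal \<epsilon>"
  shows "hausdorff_measure s A = 0"
proof -
  have "hausdorff_content s \<delta> A \<le> 0" if "0 < \<delta>" for \<delta>
  proof (rule ennreal_le_epsilon)
    fix \<epsilon> :: real assume "0 < \<epsilon>"
    then obtain U :: "nat \<Rightarrow> 'a set" where U: "A \<subseteq> (\<Union>i. U i)"
      "\<forall>i. bounded (U i) \<and> diameter (U i) \<le> \<delta>"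
      "(\<Sum>i. ennreal (diameter (U i) powr s)) \<le> ennreal \<epsilon>"
      using assms[OF \<open>0 < \<delta>\<close>] by blast
    have "hausdorff_content s \<delta> A \<le> (\<Sum>i. ennreal (diameter (U i) powr s))"
      unfolding hausdorff_content_def by (rule INF_lower) (use U in auto)
    with U(3) show "hausdorff_content s \<delta> A \<le> 0 + ennreal \<epsilon>" by simp
  qed
  then show ?thesis
    unfolding hausdorff_measure_def by (auto intro!: SUP_eq_const antisym)
qed

lemma hausdorff_measure_eq_0D:
  fixes A :: "'a::metric_space set"
  assumes "hausdorff_measure s A = 0" "0 < \<delta>" "0 < \<epsilon>"
  obtains U :: "nat \<Rightarrow> 'a set" where "A \<subseteq> (\<Union>i. U i)"
     "\<And>i. bounded (U i)" "\<And>i. diameter (U i) \<le> \<delta>"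
     "(\<Sum>i. ennreal (diameter (U i) powr s)) < ennreal \<epsilon>"
proof -
  have "hausdorff_content s \<delta> A \<le> hausdorff_measure s A"
    unfolding hausdorff_measure_def by (rule SUP_upper) (use assms in auto)
  then have "hausdorff_content s \<delta> A < ennreal \<epsilon>"
    using assms by (simp add: ennreal_less_zero_iff)
  then show ?thesis
    unfolding hausdorff_content_def INF_less_iff using that by blast
qed

lemma hausdorff_measure_UN_eq_0:
  fixes A :: "nat \<Rightarrow> 'a::metric_space set"
  assumes "\<And>n. hausdorff_measure s (A n) = 0"
  shows "hausdorff_measure s (\<Union>n. A n) = 0"
proof (rule hausdorff_measure_eq_0I)
  fix \<delta> \<epsilon> :: real assume pos: "0 < \<delta>" "0 < \<epsilon>"
  have "\<exists>U :: nat \<Rightarrow> 'a set. A n \<subseteq> (\<Union>i. U i) \<and>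
     (\<forall>i. bounded (U i) \<and> diameter (U i) \<le> \<delta>) \<and>
     (\<Sum>i. ennreal (diameter (U i) powr s)) \<le> ennreal (\<epsilon> * (1/2) ^ Suc n)" for n
  proof -
    have "0 < \<epsilon> * (1/2) ^ Suc n" using pos by simp
    then obtain U :: "nat \<Rightarrow> 'a set" where "A n \<subseteq> (\<Union>i. U i)"
     "\<And>i. bounded (U i)" "\<And>i. diameter (U i) \<le> \<delta>"
     "(\<Sum>i. ennreal (diameter (U i) powr s)) < ennreal (\<epsilon> * (1/2) ^ Suc n)"
      using hausdorff_measure_eq_0D[OF assms[of n] pos(1)] by blast
    then show ?thesis by (intro exI[of _ U]) auto
  qed
  then obtain U :: "nat \<Rightarrow> nat \<Rightarrow> 'a set" where U: "\<And>n. A n \<subseteq> (\<Union>i. U n i)"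
     "\<And>n i. bounded (U n i)" "\<And>n i. diameter (U n i) \<le> \<delta>"
     "\<And>n. (\<Sum>i. ennreal (diameter (U n i) powr s)) \<le> ennreal (\<epsilon> * (1/2) ^ Suc n)"
    by metis
  define V where "V k = (case prod_decode k of (n, i) \<Rightarrow> U n i)" for k
  have "(\<Sum>k. ennreal (diameter (V k) powr s)) =
        (\<Sum>k. (\<lambda>(n,i). ennreal (diameter (U n i) powr s)) (prod_decode k))"
    by (intro suminf_cong) (auto simp: V_def split: prod.splits)
  also have "\<dots> = (\<Sum>n. \<Sum>i. ennreal (diameter (U n i) powr s))"
    by (subst suminf_ennreal_2dimen[symmetric, where f = "\<lambda>(n,i). ennreal (diameter (U n i) powr s)"]) (auto simp: comp_def)
  also have "\<dots> \<le> (\<Sum>n. ennreal (\<epsilon> * (1/2) ^ Suc n))"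
    by (intro suminf_le U) auto
  also have "\<dots> = ennreal (\<Sum>n. \<epsilon> * (1/2) ^ Suc n)"
    using pos sums_mult[OF power_half_series, of \<epsilon>]
    by (intro suminf_ennreal2) (auto dest: sums_summable)
  also have "\<dots> = ennreal \<epsilon>"
    using sums_unique[OF sums_mult[OF power_half_series, of \<epsilon>]] by simp
  finally have "(\<Sum>k. ennreal (diameter (V k) powr s)) \<le> ennreal \<epsilon>" .
  moreover have "(\<Union>n. A n) \<subseteq> (\<Union>k. V k)"
  proof
    fix x assume "x \<in> (\<Union>n. A n)"
    then obtain n i where "x \<in> U n i" using U(1) by blast
    then have "x \<in> V (prod_encode (n, i))" by (simp add: V_def)
    then show "x \<in> (\<Union>k. V k)" by blast
  qed
  ultimately show "\<exists>U. (\<Union>n. A n) \<subseteq> (\<Union>i. U i) \<and>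
     (\<forall>i. bounded (U i) \<and> diameter (U i) \<le> \<delta>) \<and> (\<Sum>i. ennreal (diameter (U i) powr s)) \<le> ennreal \<epsilon>"
    by (intro exI[of _ V]) (auto simp: V_def U split: prod.splits)
qed

lemma hausdorff_measure_mono_0:
  fixes A B :: "'a::metric_space set"
  assumes "hausdorff_measure s B = 0" "A \<subseteq> B"
  shows "hausdorff_measure s A = 0"
proof (rule hausdorff_measure_eq_0I)
  fix \<delta> \<epsilon> :: real assume pos: "0 < \<delta>" "0 < \<epsilon>"
  obtain U :: "nat \<Rightarrow> 'a set" where "B \<subseteq> (\<Union>i. U i)"
     "\<And>i. bounded (U i)" "\<And>i. diameter (U i) \<le> \<delta>"
     "(\<Sum>i. ennreal (diameter (U i) powr s)) < ennreal \<epsilon>"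
    using hausdorff_measure_eq_0D[OF assms(1) pos] by blast
  then show "\<exists>U. A \<subseteq> (\<Union>i. U i) \<and>
     (\<forall>i. bounded (U i) \<and> diameter (U i) \<le> \<delta>) \<and> (\<Sum>i. ennreal (diameter (U i) powr s)) \<le> ennreal \<epsilon>"
    using assms(2) by (intro exI[of _ U]) auto
qed

text \<open>A Borel-Cantelli argument: every point of \<open>A\<close> is covered at arbitrarily
  late levels, so the levels from \<open>m0\<close> on still cover \<open>A\<close>, and their total
  cost is the tail of a convergent series.\<close>

lemma hausdorff_measure_limsup_eq_0:
  fixes A :: "'a::metric_space set" and I :: "nat \<Rightarrow> 'i set" and U :: "nat \<Rightarrow> 'i \<Rightarrow> 'a set"
  assumes s: "0 < s"
    and fin: "\<And>m. finite (I m)"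
    and bdd: "\<And>m j. j \<in> I m \<Longrightarrow> bounded (U m j)"
    and diam: "\<And>m j. j \<in> I m \<Longrightarrow> diameter (U m j) \<le> r m"
    and r: "\<And>m. 0 \<le> r m" "r \<longlonglongrightarrow> 0"
    and cost: "\<And>m. real (card (I m)) * r m powr s \<le> a m" "summable a"
    and cover: "\<And>x m0. x \<in> A \<Longrightarrow> \<exists>m\<ge>m0. \<exists>j\<in>I m. x \<in> U m j"
  shows "hausdorff_measure s A = 0"
proof (rule hausdorff_measure_eq_0I)
  fix \<delta> \<epsilon> :: real assume pos: "0 < \<delta>" "0 < \<epsilon>"
  have a0: "0 \<le> a m" for m
    by (rule order_trans[OF _ cost(1)]) auto
  obtain m1 where m1: "\<And>m. m \<ge> m1 \<Longrightarrow> r m < \<delta>"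
    using order_tendstoD(2)[OF r(2) pos(1)] by (auto simp: eventually_sequentially)
  obtain m2 where m2: "\<And>n. n \<ge> m2 \<Longrightarrow> norm (\<Sum>i. a (i + n)) < \<epsilon>"
    using suminf_exist_split[OF pos(2) cost(2)] by blast
  define m0 where "m0 = max m1 m2"
  \<comment> \<open>Each finite level is padded to a sequence by the empty set, whose diameter 0
    costs 0 powr s = 0.\<close>
  define W where "W n i = (if i < card (I (n + m0)) then U (n + m0) (from_nat_into (I (n + m0)) i) else {})" for n i
  define V where "V k = (case prod_decode k of (n, i) \<Rightarrow> W n i)" for k
  have mem: "from_nat_into (I n) i \<in> I n" if "i < card (I n)" for n i
    using that by (intro from_nat_into) auto
  have Wd: "diameter (W n i) \<le> r (n + m0)" "bounded (W n i)" for n i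
    using mem diam bdd r by (auto simp: W_def)
  have "(\<Sum>k. ennreal (diameter (V k) powr s)) =
        (\<Sum>k. (\<lambda>(n,i). ennreal (diameter (W n i) powr s)) (prod_decode k))"
    by (intro suminf_cong) (auto simp: V_def split: prod.splits)
  also have "\<dots> = (\<Sum>n. \<Sum>i. ennreal (diameter (W n i) powr s))"
    by (subst suminf_ennreal_2dimen[symmetric, where f = "\<lambda>(n,i). ennreal (diameter (W n i) powr s)"]) (auto simp: comp_def)
  also have "\<dots> \<le> (\<Sum>n. ennreal (a (n + m0)))"
  proof (intro suminf_le)
    fix n
    have "(\<Sum>i. ennreal (diameter (W n i) powr s)) = (\<Sum>i<card (I (n + m0)). ennreal (diameter (W n i) powr s))"
      by (intro suminf_finite) (auto simp: W_def)
    also have "\<dots> \<le> (\<Sum>i<card (I (n + m0)). ennreal (r (n + m0) powr s))"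
      using s Wd by (intro sum_mono ennreal_leI powr_mono2) (auto intro: diameter_ge_0)
    also have "\<dots> = ennreal (real (card (I (n + m0))) * r (n + m0) powr s)"
      by (simp add: ennreal_mult ennreal_of_nat_eq_real_of_nat)
    also have "\<dots> \<le> ennreal (a (n + m0))"
      by (intro ennreal_leI cost)
    finally show "(\<Sum>i. ennreal (diameter (W n i) powr s)) \<le> ennreal (a (n + m0))" .
  qed auto
  also have "\<dots> = ennreal (\<Sum>n. a (n + m0))"
    using a0 cost(2) by (intro suminf_ennreal2) (auto simp: summable_iff_shift)
  also have "\<dots> \<le> ennreal \<epsilon>"
    using m2[of m0] by (intro ennreal_leI) (auto simp: m0_def)
  finally have "(\<Sum>k. ennreal (diameter (V k) powr s)) \<le> ennreal \<epsilon>" .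
  moreover have "A \<subseteq> (\<Union>k. V k)"
  proof
    fix x assume "x \<in> A"
    then obtain m j where mj: "m \<ge> m0" "j \<in> I m" "x \<in> U m j" using cover by blast
    then obtain i where i: "i < card (I m)" "from_nat_into (I m) i = j"
      using bij_betw_from_nat_into_finite[OF fin[of m]] by (metis bij_betw_iff_bijections lessThan_iff)
    have "x \<in> W (m - m0) i" using mj i by (simp add: W_def)
    then have "x \<in> V (prod_encode (m - m0, i))" by (simp add: V_def)
    then show "x \<in> (\<Union>k. V k)" by blast
  qed
  moreover have "bounded (V k) \<and> diameter (V k) \<le> \<delta>" for k
    using Wd order_trans[OF Wd(1) less_imp_le[OF m1]] by (auto simp: V_def m0_def split: prod.splits)
  ultimately show "\<exists>U. A \<subseteq> (\<Union>i. U i) \<and>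
     (\<forall>i. bounded (U i) \<and> diameter (U i) \<le> \<delta>) \<and> (\<Sum>i. ennreal (diameter (U i) powr s)) \<le> ennreal \<epsilon>"
    by blast
qed

text \<open>The infimum runs over positive exponents, so \<open>t\<close> has to be nonnegative for
  t + e to be admissible.\<close>

lemma hausdorff_dim_le:
  assumes "0 \<le> t" "\<And>s. t < s \<Longrightarrow> hausdorff_measure s A = 0"
  shows "hausdorff_dim A \<le> ereal t"
proof (rule ereal_le_epsilon2)
  fix e :: real assume "0 < e"
  then show "hausdorff_dim A \<le> ereal t + ereal e"
    unfolding hausdorff_dim_def using assms by (intro Inf_lower) auto
qed

lemma hausdorff_dim_ge:
  assumes "\<And>s. 0 < s \<Longrightarrow> s < t \<Longrightarrow> hausdorff_measure s A \<noteq> 0"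
  shows "ereal t \<le> hausdorff_dim A"
  unfolding hausdorff_dim_def using assms by (intro Inf_greatest) force

text \<open>The covering set \<open>C\<close> spares any measurability of \<open>f\<close>.\<close>

lemma mass_distribution_principle:
  fixes f :: "'b \<Rightarrow> 'a::metric_space"
  assumes M: "prob_space M" and AE: "AE \<omega> in M. f \<omega> \<in> A"
    and s: "0 < s" and radius: "0 < radius" and c: "0 < c"
    and bound: "\<And>U \<rho>. 0 < \<rho> \<Longrightarrow> \<rho> < radius \<Longrightarrow> (\<And>x y. x \<in> U \<Longrightarrow> y \<in> U \<Longrightarrow> dist x y \<le> \<rho>) \<Longrightarrow>
       \<exists>C\<in>sets M. {\<omega>\<in>space M. f \<omega> \<in> U} \<subseteq> C \<and> measure M C \<le> c * \<rho> powr s"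
  shows "hausdorff_measure s A \<noteq> 0"
proof
  assume "hausdorff_measure s A = 0"
  interpret prob_space M by (rule M)
  \<comment> \<open>The first bound makes the total mass less than 2 c \<epsilon> \<le> 1/2; the
    second keeps every \<rho> i below \<open>radius\<close>, since \<rho> i powr s < 2
    \<epsilon>.\<close>
  define \<epsilon> where "\<epsilon> = min (1 / (4 * c)) ((radius/2) powr s / 2)"
  have \<epsilon>: "0 < \<epsilon>" "\<epsilon> \<le> 1 / (4 * c)" "\<epsilon> \<le> (radius/2) powr s / 2"
    using radius c unfolding \<epsilon>_def by auto
  obtain U :: "nat \<Rightarrow> 'a set" where U: "A \<subseteq> (\<Union>i. U i)"
     "\<And>i. bounded (U i)" "\<And>i. diameter (U i) \<le> radius" "(\<Sum>i. ennreal (diameter (U i) powr s)) < ennreal \<epsilon>"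
    using hausdorff_measure_eq_0D[OF \<open>hausdorff_measure s A = 0\<close> radius \<epsilon>(1)] by blast
  \<comment> \<open>A covering set may have diameter 0, while \<open>bound\<close> speaks of
    positive \<rho>. The summable excess makes every radius positive and adds only \<epsilon> to the
    total cost.\<close>
  define t where "t i = diameter (U i) powr s + \<epsilon> * (1/2) ^ Suc i" for i
  define \<rho> where "\<rho> i = t i powr (1/s)" for i
  have t0: "0 < t i" for i using \<epsilon> by (auto simp: t_def intro!: add_nonneg_pos)
  have d0: "0 \<le> diameter (U i)" for i by (rule diameter_ge_0) (rule U)
  have \<rho>s: "\<rho> i powr s = t i" for i using s t0[of i] by (simp add: \<rho>_def powr_powr)
  have \<rho>pos: "0 < \<rho> i" for i using t0[of i] by (simp add: \<rho>_def)
  have "diameter (U i) powr s \<le> \<rho> i powr s" for i using \<epsilon> by (simp add: \<rho>s t_def)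
  then have d\<rho>: "diameter (U i) \<le> \<rho> i" for i
    using powr_less_mono2[OF s less_imp_le[OF \<rho>pos[of i]], of "diameter (U i)"] by (meson not_le)
  have sm: "summable (\<lambda>i. diameter (U i) powr s)"
    using U(4) by (intro summable_suminf_not_top) (auto simp: top_unique)
  have sumd: "(\<Sum>i. diameter (U i) powr s) < \<epsilon>"
  proof -
    have "ennreal (\<Sum>i. diameter (U i) powr s) < ennreal \<epsilon>"
      by (rule le_less_trans[OF eq_refl U(4)], rule suminf_ennreal2[symmetric, OF _ sm]) simp
    then show ?thesis by (rule ennreal_less_iff[THEN iffD1, rotated]) (intro suminf_nonneg[OF sm], simp)
  qed
  have half: "(\<lambda>i. \<epsilon> * (1/2) ^ Suc i) sums \<epsilon>" using sums_mult[OF power_half_series, of \<epsilon>] by simp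
  have tsums: "t sums ((\<Sum>i. diameter (U i) powr s) + \<epsilon>)"
    unfolding t_def by (intro sums_add half summable_sums sm)
  have tsm: "summable t" using tsums by (rule sums_summable)
  have tsum: "suminf t < 2 * \<epsilon>" using sums_unique[OF tsums] sumd by simp
  have tle: "t i \<le> suminf t" for i
    using sum_le_suminf[OF tsm, of "{i}"] t0 by (simp add: less_imp_le)
  have tradius: "\<rho> i powr s < (radius/2) powr s" for i
    using tle[of i] tsum \<epsilon>(3) unfolding \<rho>s by simp
  have \<rho>less: "\<rho> i < radius" for i
  proof (rule ccontr)
    assume "\<not> \<rho> i < radius"
    then have "(radius/2) powr s \<le> \<rho> i powr s" using radius s by (intro powr_mono2) auto
    with tradius[of i] show False by simp
  qed
  have "\<exists>C\<in>sets M. {\<omega>\<in>space M. f \<omega> \<in> U i} \<subseteq> C \<and> measure M C \<le> c * \<rho> i powr s" for i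
  proof (rule bound[OF \<rho>pos \<rho>less])
    fix x y assume "x \<in> U i" "y \<in> U i"
    then show "dist x y \<le> \<rho> i"
      by (rule order_trans[OF diameter_bounded_bound[OF U(2)] d\<rho>])
  qed
  then have "\<forall>i. \<exists>C. C \<in> sets M \<and> {\<omega>\<in>space M. f \<omega> \<in> U i} \<subseteq> C \<and> measure M C \<le> c * t i"
    unfolding \<rho>s by blast
  from choice[OF this] obtain C where C: "\<And>i. C i \<in> sets M"
     "\<And>i. {\<omega>\<in>space M. f \<omega> \<in> U i} \<subseteq> C i" "\<And>i. measure M (C i) \<le> c * t i" by blast
  have "AE \<omega> in M. \<omega> \<in> (\<Union>i. C i)"
    using AE AE_space
  proof eventually_elim
    case (elim \<omega>)
    then obtain i where "f \<omega> \<in> U i" using U(1) by auto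
    with elim C(2)[of i] show ?case by auto
  qed
  then have "measure M (\<Union>i. C i) = 1"
    using C(1) by (subst prob_eq_1) auto
  then have "1 = measure M (\<Union>i. C i)" by simp
  also have "\<dots> \<le> (\<Sum>i. measure M (C i))"
    using C tsm c less_imp_le[OF t0] by (intro finite_measure_subadditive_countably summable_comparison_test'[OF summable_mult[OF tsm, of c], of 0]) auto
  also have "\<dots> \<le> (\<Sum>i. c * t i)"
    using C tsm c less_imp_le[OF t0] by (intro suminf_le summable_comparison_test'[OF summable_mult[OF tsm, of c], of 0] summable_mult) auto
  also have "\<dots> = c * suminf t" by (rule suminf_mult[OF tsm])
  also have "\<dots> < c * (2 * \<epsilon>)" using tsum c by simp
  also have "\<dots> \<le> c * (2 * (1 / (4 * c)))" using \<epsilon> c by (intro mult_left_mono) auto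
  also have "\<dots> = 1 / 2" using c by simp
  finally show False by simp
qed

subsection \<open>Effective Kronecker theorem\<close>

text \<open>A crude form of Jordan's inequality. The Taylor remainder settles x \<le> 1; beyond 1 >
  pi/6 monotonicity gives sin x \<ge> 1/2, while x/4 \<le> pi/8 < 1/2.\<close>

lemma sin_ge_quarter:
  fixes x :: real
  assumes "0 \<le> x" "x \<le> pi / 2"
  shows "x / 4 \<le> sin x"
proof (cases "x \<le> 1")
  case True
  have "\<bar>sin x - (\<Sum>k<3. sin_coeff k * x ^ k)\<bar> \<le> inverse (fact 3) * \<bar>x\<bar> ^ 3"
    by (rule Maclaurin_sin_bound)
  then have "\<bar>sin x - x\<bar> * 6 \<le> x ^ 3"
    using assms by (simp add: sin_coeff_def numeral_eq_Suc)
  moreover have "x ^ 3 \<le> x" using power_decreasing[of 1 3 x] True assms by simp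
  ultimately have "\<bar>sin x - x\<bar> \<le> x / 6" by simp
  then have "- (sin x - x) \<le> x / 6" by (rule abs_le_D2)
  then have "x \<le> x / 6 + sin x" by (simp only: minus_diff_eq diff_le_eq)
  then show ?thesis using assms by simp
next
  case False
  have "sin (pi/6) \<le> sin x"
    using assms False pi_less_4 by (intro sin_monotone_2pi_le) auto
  moreover have "x / 4 < 1/2" using assms pi_less_4 by simp
  ultimately show ?thesis using sin_30 by simp
qed

lemma abs_le_norm_one_minus_cis:
  fixes t :: real
  assumes "\<bar>t\<bar> \<le> 1/2"
  shows "\<bar>t\<bar> \<le> norm (1 - cis (2 * pi * t))"
proof -
  have "norm (1 - cis (2 * pi * t)) = norm (cis (pi * (-t)) * (1 - cis (2 * pi * t)))"
    by (simp add: norm_mult)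
  also have "\<dots> = norm (cis (pi * (-t)) - cis (pi * t))"
    by (simp add: algebra_simps cis_mult)
  also have "cis (pi * (-t)) - cis (pi * t) = Complex 0 (- 2 * sin (pi * t))"
    by (simp add: complex_eq_iff)
  also have "norm \<dots> = 2 * \<bar>sin (pi * t)\<bar>"
    by (simp add: cmod_def abs_mult real_sqrt_mult)
  also have "\<bar>sin (pi * t)\<bar> = sin (pi * \<bar>t\<bar>)"
  proof -
    have "0 \<le> sin (pi * \<bar>t\<bar>)" using assms by (intro sin_ge_zero) (auto simp: mult_le_cancel_left1)
    then show ?thesis by (cases "t \<ge> 0") auto
  qed
  finally have *: "norm (1 - cis (2 * pi * t)) = 2 * sin (pi * \<bar>t\<bar>)" .
  have "pi * \<bar>t\<bar> / 4 \<le> sin (pi * \<bar>t\<bar>)"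
    using assms by (intro sin_ge_quarter) auto
  moreover have "2 * \<bar>t\<bar> \<le> pi * \<bar>t\<bar>" using pi_gt3 by (intro mult_right_mono) auto
  ultimately show ?thesis unfolding * by simp
qed

lemma cis_add_int: "cis (2 * pi * (t + of_int p)) = cis (2 * pi * t)"
proof -
  have "cis (2 * pi * (t + of_int p)) = cis (2 * pi * t) * cis (2 * pi * of_int p)"
    by (simp add: cis_mult algebra_simps)
  then show ?thesis by (simp add: cis_multiple_2pi)
qed

text \<open>Signed distance to the nearest integer. The sign is kept because two residues have to
  stay separated when their inverse squares are summed.\<close>

definition near :: "real \<Rightarrow> real" where "near t = t - of_int (round t)"

lemma abs_near_le: "\<bar>near t\<bar> \<le> 1/2"
  using of_int_round_abs_le[of t] by (simp add: near_def abs_minus_commute)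

lemma near_le_norm_one_minus_cis: "\<bar>near t\<bar> \<le> norm (1 - cis (2 * pi * t))"
  using abs_le_norm_one_minus_cis[OF abs_near_le[of t]] cis_add_int[of "near t" "round t"]
  by (simp add: near_def)

lemma norm_sum_cis_le:
  assumes "near t \<noteq> 0"
  shows "norm (\<Sum>m<M. cis (2 * pi * (real m * t))) \<le> 2 / \<bar>near t\<bar>"
proof -
  let ?z = "cis (2 * pi * t)"
  have ne: "0 < norm (1 - ?z)"
    by (rule less_le_trans[OF _ near_le_norm_one_minus_cis]) (use assms in simp)
  have "(\<Sum>m<M. cis (2 * pi * (real m * t))) = (\<Sum>m<M. ?z ^ m)"
    by (intro sum.cong refl) (simp add: Complex.DeMoivre mult_ac)
  also have "\<dots> = (1 - ?z ^ M) / (1 - ?z)"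
  proof -
    have "?z \<noteq> 1" using ne by force
    then show ?thesis by (simp add: sum_gp_strict)
  qed
  finally have "norm (\<Sum>m<M. cis (2 * pi * (real m * t))) = norm (1 - ?z ^ M) / norm (1 - ?z)"
    by (simp add: norm_divide)
  also have "\<dots> \<le> 2 / norm (1 - ?z)"
  proof (intro divide_right_mono)
    show "norm (1 - ?z ^ M) \<le> 2"
      using norm_triangle_ineq4[of 1 "?z ^ M"] by (simp add: norm_power)
  qed auto
  also have "\<dots> \<le> 2 / \<bar>near t\<bar>"
    using assms near_le_norm_one_minus_cis[of t] ne by (intro divide_left_mono) auto
  finally show ?thesis .
qed

section \<open>Mean squares of character sums with separated frequencies\<close>

lemma sum_inverse_squares_le:
  fixes J :: "nat set"
  assumes "finite J" "0 \<notin> J"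
  shows "(\<Sum>j\<in>J. 1 / real j ^ 2) \<le> 2"
proof -
  \<comment> \<open>The term - 1/n makes the induction telescope, as 1/(n+1)^2 \<le> 1/n -
    1/(n+1).\<close>
  have *: "(\<Sum>j=1..n. 1 / real j ^ 2) \<le> 2 - 1 / real n" if "n \<ge> 1" for n
    using that
  proof (induction n rule: nat_induct_at_least)
    case (Suc n)
    have "1 / real (Suc n) ^ 2 \<le> 1 / real n - 1 / real (Suc n)"
    proof -
      have "1 / real (Suc n) ^ 2 \<le> 1 / (real n * real (Suc n))"
        using Suc.hyps by (intro divide_left_mono) (auto simp: power2_eq_square)
      also have "\<dots> = 1 / real n - 1 / real (Suc n)" using Suc.hyps by (simp add: field_simps)
      finally show ?thesis .
    qed
    with Suc show ?case by simp
  qed simp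
  obtain n where n: "J \<subseteq> {..n}" using assms by (meson finite_nat_iff_bounded_le)
  have "(\<Sum>j\<in>J. 1 / real j ^ 2) \<le> (\<Sum>j=1..max n 1. 1 / real j ^ 2)"
    using n assms by (intro sum_mono2) (auto simp: Suc_le_eq intro!: gr0I, force)
  also have "\<dots> \<le> 2"
    by (rule order_trans[OF *]) auto
  finally show ?thesis .
qed

text \<open>Separated points fall into different cells [j \<delta>, (j+1) \<delta>) with j \<ge> 1,
  so the sum is dominated by that of 1/(j \<delta>)^2.\<close>

lemma sum_inverse_squares_separated_pos:
  fixes z :: "'a \<Rightarrow> real"
  assumes "finite B" "0 < \<delta>" "\<And>l. l \<in> B \<Longrightarrow> \<delta> \<le> z l"
    and sep: "\<And>k l. k \<in> B \<Longrightarrow> l \<in> B \<Longrightarrow> k \<noteq> l \<Longrightarrow> \<delta> \<le> \<bar>z k - z l\<bar>"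
  shows "(\<Sum>l\<in>B. 1 / z l ^ 2) \<le> 2 / \<delta> ^ 2"
proof -
  define j where "j l = nat \<lfloor>z l / \<delta>\<rfloor>" for l
  have j1: "1 \<le> j l" "real (j l) \<le> z l / \<delta>" "z l / \<delta> < real (j l) + 1" if "l \<in> B" for l
  proof -
    have "1 \<le> z l / \<delta>" using assms that by simp
    then show "1 \<le> j l" "real (j l) \<le> z l / \<delta>" "z l / \<delta> < real (j l) + 1"
      unfolding j_def by linarith+
  qed
  have inj: "inj_on j B"
  proof (rule inj_onI, rule ccontr)
    fix k l assume kl: "k \<in> B" "l \<in> B" "j k = j l" "k \<noteq> l"
    then have "\<bar>z k / \<delta> - z l / \<delta>\<bar> < 1" using j1[of k] j1[of l] by simp
    then have "\<bar>z k - z l\<bar> / \<delta> < 1" using assms(2) by (simp add: diff_divide_distrib[symmetric])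
    with sep[OF kl(1,2,4)] assms(2) show False by simp
  qed
  have "(\<Sum>l\<in>B. 1 / z l ^ 2) \<le> (\<Sum>l\<in>B. 1 / \<delta> ^ 2 * (1 / real (j l) ^ 2))"
  proof (rule sum_mono)
    fix l assume l: "l \<in> B"
    have "(\<delta> * real (j l)) ^ 2 \<le> z l ^ 2"
      using j1[OF l] assms(2) by (intro power_mono) (auto simp: field_simps)
    then have "1 / z l ^ 2 \<le> 1 / (\<delta> * real (j l)) ^ 2"
      using j1(1)[OF l] assms(2) assms(3)[OF l] by (intro divide_left_mono) (auto intro!: mult_pos_pos zero_less_power)
    then show "1 / z l ^ 2 \<le> 1 / \<delta> ^ 2 * (1 / real (j l) ^ 2)"
      by (simp add: power_mult_distrib)
  qed
  also have "\<dots> = 1 / \<delta> ^ 2 * (\<Sum>i\<in>j ` B. 1 / real i ^ 2)"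
    by (simp add: sum_distrib_left sum.reindex[OF inj])
  also have "\<dots> \<le> 1 / \<delta> ^ 2 * 2"
  proof (intro mult_left_mono sum_inverse_squares_le)
    show "0 \<notin> j ` B" using j1(1) by fastforce
  qed (use assms in auto)
  finally show ?thesis by simp
qed

lemma sum_inverse_squares_separated:
  fixes z :: "'a \<Rightarrow> real"
  assumes "finite B" "0 < \<delta>" "\<And>l. l \<in> B \<Longrightarrow> \<delta> \<le> \<bar>z l\<bar>"
    and sep: "\<And>k l. k \<in> B \<Longrightarrow> l \<in> B \<Longrightarrow> k \<noteq> l \<Longrightarrow> \<delta> \<le> \<bar>z k - z l\<bar>"
  shows "(\<Sum>l\<in>B. 1 / z l ^ 2) \<le> 4 / \<delta> ^ 2"
proof -
  let ?P = "{l\<in>B. z l > 0}" and ?N = "{l\<in>B. \<not> z l > 0}"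
  have "(\<Sum>l\<in>B. 1 / z l ^ 2) = (\<Sum>l\<in>?P \<union> ?N. 1 / z l ^ 2)" by (intro sum.cong) auto
  also have "\<dots> = (\<Sum>l\<in>?P. 1 / z l ^ 2) + (\<Sum>l\<in>?N. 1 / (- z l) ^ 2)"
    using assms by (subst sum.union_disjoint) auto
  also have "(\<Sum>l\<in>?P. 1 / z l ^ 2) \<le> 2 / \<delta> ^ 2"
  proof (rule sum_inverse_squares_separated_pos)
    fix l assume "l \<in> ?P" then show "\<delta> \<le> z l" using assms(3)[of l] by auto
  qed (use assms in auto)
  also have "(\<Sum>l\<in>?N. 1 / (- z l) ^ 2) \<le> 2 / \<delta> ^ 2"
  proof (rule sum_inverse_squares_separated_pos)
    fix l assume "l \<in> ?N" then show "\<delta> \<le> - z l" using assms(3)[of l] by auto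
  next
    fix k l assume "k \<in> ?N" "l \<in> ?N" "k \<noteq> l" then show "\<delta> \<le> \<bar>- z k - - z l\<bar>"
      using sep[of k l] by auto
  qed (use assms in auto)
  finally show ?thesis by simp
qed

lemma abs_near_le_diff: "\<bar>near t\<bar> \<le> \<bar>t - of_int p\<bar>"
  using round_diff_minimal[of t p] by (simp add: near_def)

lemma abs_near_minus: "\<bar>near (- t)\<bar> = \<bar>near t\<bar>"
proof -
  have "\<bar>near (- t)\<bar> \<le> \<bar>near t\<bar>" for t
    using abs_near_le_diff[of "-t" "- round t"] by (simp add: near_def)
  from this[of t] this[of "-t"] show ?thesis by simp
qed

text \<open>A mean square in the style of the large sieve. Averaging over q = Q + m + n with two
  free variables gives the off-diagonal kernel D(\<beta> k - \<beta> l)^2, which decays like the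
  inverse square of the distance to the integers; its sum over separated frequencies is
  O(1/\<delta>^2), however many frequencies there are. A single geometric sum, estimated in absolute
  value, would lose a logarithm.\<close>

lemma almost_orthogonality:
  fixes \<beta> :: "'a \<Rightarrow> real" and b :: "'a \<Rightarrow> complex" and Q :: real
  assumes fin: "finite B" and \<delta>: "0 < \<delta>"
    and sep: "\<And>k l p. k \<in> B \<Longrightarrow> l \<in> B \<Longrightarrow> k \<noteq> l \<Longrightarrow> \<delta> \<le> \<bar>\<beta> k - \<beta> l - of_int p\<bar>"
  shows "\<bar>(\<Sum>m<M. \<Sum>n<M. norm (\<Sum>k\<in>B. b k * cis (2 * pi * ((Q + real m + real n) * \<beta> k))) ^ 2)
            - real M ^ 2 * (\<Sum>k\<in>B. norm (b k) ^ 2)\<bar> \<le> 16 / \<delta> ^ 2 * (\<Sum>k\<in>B. norm (b k) ^ 2)"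
proof -
  define D where "D t = (\<Sum>m<M. cis (2 * pi * (real m * t)))" for t
  define g where "g k l = cis (2 * pi * (Q * (\<beta> k - \<beta> l))) * D (\<beta> k - \<beta> l) ^ 2" for k l
  define h where "h k l = (if k = l then 0 else 4 / near (\<beta> k - \<beta> l) ^ 2)" for k l
  let ?S = "\<Sum>k\<in>B. norm (b k) ^ 2"
  let ?T = "\<Sum>m<M. \<Sum>n<M. norm (\<Sum>k\<in>B. b k * cis (2 * pi * ((Q + real m + real n) * \<beta> k))) ^ 2"
  have geq: "g k l = (\<Sum>m<M. \<Sum>n<M. cis (2 * pi * ((Q + real m + real n) * \<beta> k)) * cnj (cis (2 * pi * ((Q + real m + real n) * \<beta> l))))" for k l
  proof -
    have "g k l = (\<Sum>m<M. \<Sum>n<M. cis (2 * pi * (Q * (\<beta> k - \<beta> l))) * (cis (2 * pi * (real m * (\<beta> k - \<beta> l))) * cis (2 * pi * (real n * (\<beta> k - \<beta> l)))))"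
      unfolding g_def D_def power2_eq_square sum_product by (simp only: sum_distrib_left)
    also have "\<dots> = (\<Sum>m<M. \<Sum>n<M. cis (2 * pi * ((Q + real m + real n) * \<beta> k)) * cnj (cis (2 * pi * ((Q + real m + real n) * \<beta> l))))"
      by (intro sum.cong refl) (simp add: cis_cnj cis_mult algebra_simps)
    finally show ?thesis .
  qed
  have "complex_of_real ?T = (\<Sum>m<M. \<Sum>n<M. \<Sum>k\<in>B. \<Sum>l\<in>B. (b k * cnj (b l)) *
      (cis (2 * pi * ((Q + real m + real n) * \<beta> k)) * cnj (cis (2 * pi * ((Q + real m + real n) * \<beta> l)))))"
    unfolding of_real_sum complex_norm_square cnj_sum sum_product
    by (intro sum.cong refl) (simp add: mult_ac)
  also have "\<dots> = (\<Sum>m<M. \<Sum>k\<in>B. \<Sum>n<M. \<Sum>l\<in>B. (b k * cnj (b l)) *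
      (cis (2 * pi * ((Q + real m + real n) * \<beta> k)) * cnj (cis (2 * pi * ((Q + real m + real n) * \<beta> l)))))"
    by (intro sum.cong refl sum.swap)
  also have "\<dots> = (\<Sum>k\<in>B. \<Sum>m<M. \<Sum>n<M. \<Sum>l\<in>B. (b k * cnj (b l)) *
      (cis (2 * pi * ((Q + real m + real n) * \<beta> k)) * cnj (cis (2 * pi * ((Q + real m + real n) * \<beta> l)))))"
    by (rule sum.swap)
  also have "\<dots> = (\<Sum>k\<in>B. \<Sum>m<M. \<Sum>l\<in>B. \<Sum>n<M. (b k * cnj (b l)) *
      (cis (2 * pi * ((Q + real m + real n) * \<beta> k)) * cnj (cis (2 * pi * ((Q + real m + real n) * \<beta> l)))))"
    by (intro sum.cong refl sum.swap)
  also have "\<dots> = (\<Sum>k\<in>B. \<Sum>l\<in>B. \<Sum>m<M. \<Sum>n<M. (b k * cnj (b l)) *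
      (cis (2 * pi * ((Q + real m + real n) * \<beta> k)) * cnj (cis (2 * pi * ((Q + real m + real n) * \<beta> l)))))"
    by (intro sum.cong refl sum.swap)
  also have "\<dots> = (\<Sum>k\<in>B. \<Sum>l\<in>B. b k * cnj (b l) * g k l)"
    unfolding geq sum_distrib_left ..
  also have "\<dots> = (\<Sum>k\<in>B. b k * cnj (b k) * g k k + (\<Sum>l\<in>B-{k}. b k * cnj (b l) * g k l))"
    using fin by (intro sum.cong refl sum.remove) auto
  also have "\<dots> = (\<Sum>k\<in>B. of_real (norm (b k) ^ 2 * real M ^ 2)) + (\<Sum>k\<in>B. \<Sum>l\<in>B-{k}. b k * cnj (b l) * g k l)"
    unfolding sum.distrib
    by (intro arg_cong2[where f = "(+)"] sum.cong refl) (simp add: g_def D_def flip: complex_norm_square)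
  also have "(\<Sum>k\<in>B. of_real (norm (b k) ^ 2 * real M ^ 2)) = complex_of_real (real M ^ 2 * ?S)"
    by (simp add: sum_distrib_left mult.commute)
  finally have "complex_of_real (?T - real M ^ 2 * ?S) = (\<Sum>k\<in>B. \<Sum>l\<in>B-{k}. b k * cnj (b l) * g k l)"
    by simp
  from arg_cong[OF this, of norm]
  have "\<bar>?T - real M ^ 2 * ?S\<bar> = norm (\<Sum>k\<in>B. \<Sum>l\<in>B-{k}. b k * cnj (b l) * g k l)"
    by (simp only: norm_of_real)
  \<comment> \<open>Schur's test: |b k| |b l| is at most half the sum of the squares, and the
    symmetry of \<open>h\<close> lets both halves be charged to row k. The final 16 is 2^2 from the
    geometric sums times 4 from the inverse squares.\<close>
  also have "\<dots> \<le> (\<Sum>k\<in>B. \<Sum>l\<in>B-{k}. (norm (b k) ^ 2 + norm (b l) ^ 2) / 2 * h k l)"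
  proof (intro order_trans[OF norm_sum] sum_mono)
    fix k l assume kl: "k \<in> B" "l \<in> B - {k}"
    have "\<delta> \<le> \<bar>near (\<beta> k - \<beta> l)\<bar>" unfolding near_def using kl by (intro sep) auto
    then have nz: "near (\<beta> k - \<beta> l) \<noteq> 0" using \<delta> by auto
    have "norm (g k l) = norm (D (\<beta> k - \<beta> l)) ^ 2"
      by (simp add: g_def norm_mult norm_power)
    also have "\<dots> \<le> (2 / \<bar>near (\<beta> k - \<beta> l)\<bar>) ^ 2"
      unfolding D_def by (intro power_mono norm_sum_cis_le nz) auto
    also have "\<dots> = h k l" using kl by (auto simp: h_def power_divide)
    finally have g: "norm (g k l) \<le> h k l" .
    have "norm (b k * cnj (b l) * g k l) = (norm (b k) * norm (b l)) * norm (g k l)"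
      by (simp add: norm_mult)
    also have "\<dots> \<le> (norm (b k) ^ 2 + norm (b l) ^ 2) / 2 * h k l"
      using sum_squares_bound[of "norm (b k)" "norm (b l)"] by (intro mult_mono g) auto
    finally show "norm (b k * cnj (b l) * g k l) \<le> (norm (b k) ^ 2 + norm (b l) ^ 2) / 2 * h k l" .
  qed
  also have "\<dots> = (\<Sum>k\<in>B. \<Sum>l\<in>B. (norm (b k) ^ 2 + norm (b l) ^ 2) / 2 * h k l)"
    using fin by (intro sum.cong refl sum.mono_neutral_left) (auto simp: h_def)
  also have "\<dots> = ((\<Sum>k\<in>B. \<Sum>l\<in>B. norm (b k) ^ 2 * h k l) + (\<Sum>k\<in>B. \<Sum>l\<in>B. norm (b l) ^ 2 * h k l)) / 2"
    by (simp add: sum_divide_distrib sum.distrib[symmetric] algebra_simps add_divide_distrib)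
  also have "(\<Sum>k\<in>B. \<Sum>l\<in>B. norm (b l) ^ 2 * h k l) = (\<Sum>k\<in>B. \<Sum>l\<in>B. norm (b k) ^ 2 * h k l)"
  proof -
    have "near (x - y) ^ 2 = near (y - x) ^ 2" for x y
      using abs_near_minus[of "x - y"] by (auto simp: abs_eq_iff power2_eq_iff)
    then have hs: "h k l = h l k" for k l by (simp add: h_def)
    show ?thesis by (subst sum.swap, intro sum.cong refl arg_cong2[where f = "(*)"] hs)
  qed
  also have "((\<Sum>k\<in>B. \<Sum>l\<in>B. norm (b k) ^ 2 * h k l) + (\<Sum>k\<in>B. \<Sum>l\<in>B. norm (b k) ^ 2 * h k l)) / 2
     = (\<Sum>k\<in>B. norm (b k) ^ 2 * (\<Sum>l\<in>B. h k l))"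
    unfolding sum_distrib_left by (rule field_sum_of_halves[unfolded add_divide_distrib[symmetric]])
  also have "\<dots> \<le> (\<Sum>k\<in>B. norm (b k) ^ 2 * (16 / \<delta> ^ 2))"
  proof (intro sum_mono mult_left_mono)
    fix k assume k: "k \<in> B"
    have "(\<Sum>l\<in>B. h k l) = (\<Sum>l\<in>B-{k}. h k l)"
      using fin by (intro sum.mono_neutral_right) (auto simp: h_def)
    also have "\<dots> = 4 * (\<Sum>l\<in>B-{k}. 1 / near (\<beta> k - \<beta> l) ^ 2)"
      unfolding sum_distrib_left by (intro sum.cong) (auto simp: h_def)
    also have "(\<Sum>l\<in>B-{k}. 1 / near (\<beta> k - \<beta> l) ^ 2) \<le> 4 / \<delta> ^ 2"
    proof (rule sum_inverse_squares_separated)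
      fix l assume "l \<in> B - {k}"
      then show "\<delta> \<le> \<bar>near (\<beta> k - \<beta> l)\<bar>" unfolding near_def using k by (intro sep) auto
    next
      fix l l' assume "l \<in> B - {k}" "l' \<in> B - {k}" "l \<noteq> l'"
      then have "\<delta> \<le> \<bar>\<beta> l' - \<beta> l - of_int (round (\<beta> k - \<beta> l) - round (\<beta> k - \<beta> l'))\<bar>"
        by (intro sep) auto
      then show "\<delta> \<le> \<bar>near (\<beta> k - \<beta> l) - near (\<beta> k - \<beta> l')\<bar>"
        by (simp add: near_def algebra_simps)
    qed (use fin \<delta> in auto)
    finally show "(\<Sum>l\<in>B. h k l) \<le> 16 / \<delta> ^ 2" by simp
  qed auto
  also have "\<dots> = 16 / \<delta> ^ 2 * ?S"
    unfolding sum_distrib_left by (intro sum.cong refl mult.commute)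
  finally show ?thesis .
qed

text \<open>Summation by parts: multiplication by 1 - e(t) takes differences of the coefficients. As
  \<open>a\<close> vanishes from |k| = N on, shifting the range leaves no boundary terms.\<close>

lemma sum_tent_shift:
  fixes a :: "int \<Rightarrow> real" and N :: int
  assumes "\<And>k. N \<le> \<bar>k\<bar> \<Longrightarrow> a k = 0" "0 \<le> N"
  shows "(1 - cis (2 * pi * t)) * (\<Sum>k\<in>{-N..N}. of_real (a k) * cis (2 * pi * (of_int k * t)))
       = (\<Sum>k\<in>{-N..N}. of_real (a k - a (k - 1)) * cis (2 * pi * (of_int k * t)))"
proof -
  have "cis (2 * pi * t) * (\<Sum>k\<in>{-N..N}. of_real (a k) * cis (2 * pi * (of_int k * t)))
      = (\<Sum>k\<in>{-N..N}. of_real (a k) * cis (2 * pi * (of_int (k + 1) * t)))"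
    unfolding sum_distrib_left by (intro sum.cong refl) (simp add: cis_mult algebra_simps)
  also have "\<dots> = (\<Sum>k\<in>{-N+1..N+1}. of_real (a (k - 1)) * cis (2 * pi * (of_int k * t)))"
    by (rule sum.reindex_bij_witness[of _ "\<lambda>k. k - 1" "\<lambda>k. k + 1"]) auto
  also have "\<dots> = (\<Sum>k\<in>{-N..N}. of_real (a (k - 1)) * cis (2 * pi * (of_int k * t)))"
    using assms by (intro sum.mono_neutral_cong) auto
  finally show ?thesis
    by (simp add: left_diff_distrib sum_subtractf)
qed

lemma sum_squares_ge_cube: "real N ^ 3 / 3 \<le> (\<Sum>i=1..N. real i ^ 2)"
proof (induction N)
  case (Suc N)
  have "real (Suc N) ^ 3 / 3 \<le> real N ^ 3 / 3 + real (Suc N) ^ 2"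
    by (simp add: power2_eq_square power3_eq_cube field_simps)
  with Suc show ?case by simp
qed simp

lemma sum_tent_squares_ge:
  "real N ^ 3 / 3 \<le> (\<Sum>k\<in>{-int N..int N}. (max 0 (real N - \<bar>real_of_int k\<bar>)) ^ 2)"
proof -
  have "(\<Sum>i=1..N. real i ^ 2) = (\<Sum>k\<in>{0..int N - 1}. (max 0 (real N - \<bar>real_of_int k\<bar>)) ^ 2)"
    by (rule sum.reindex_bij_witness[of _ "\<lambda>k. nat (int N - k)" "\<lambda>i. int N - int i"]) auto
  also have "\<dots> \<le> (\<Sum>k\<in>{-int N..int N}. (max 0 (real N - \<bar>real_of_int k\<bar>)) ^ 2)"
    by (intro sum_mono2) auto
  finally show ?thesis using sum_squares_ge_cube[of N] by simp
qed

text \<open>Expanding the product gives a character sum in q with frequencies k\<cdot>\<alpha>; the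
  shift by \<open>y\<close> only rotates the coefficients.\<close>

lemma prod_sum_cis:
  fixes g :: "'n::finite \<Rightarrow> int \<Rightarrow> real" and \<alpha> y :: "real^'n"
  assumes "finite J"
  shows "(\<Prod>j\<in>UNIV. \<Sum>k\<in>J. of_real (g j k) * cis (2 * pi * (of_int k * (q * \<alpha> $ j - y $ j))))
    = (\<Sum>k\<in>PiE UNIV (\<lambda>_. J). (of_real (\<Prod>j\<in>UNIV. g j (k j)) * cis (- 2 * pi * (\<Sum>j\<in>UNIV. of_int (k j) * y $ j)))
         * cis (2 * pi * (q * (\<Sum>j\<in>UNIV. of_int (k j) * \<alpha> $ j))))"
proof -
  have cp: "(\<Prod>j\<in>A. cis (u j)) = cis (\<Sum>j\<in>A. u j)" if "finite A" for A :: "'n set" and u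
    using that by (induction A) (auto simp: cis_mult)
  show ?thesis
    unfolding prod_sum_PiE[OF finite assms]
  proof (intro sum.cong refl)
    fix k assume "k \<in> PiE (UNIV :: 'n set) (\<lambda>_. J)"
    show "(\<Prod>j\<in>UNIV. of_real (g j (k j)) * cis (2 * pi * (of_int (k j) * (q * \<alpha> $ j - y $ j)))) =
      (of_real (\<Prod>j\<in>UNIV. g j (k j)) * cis (- 2 * pi * (\<Sum>j\<in>UNIV. of_int (k j) * y $ j)))
         * cis (2 * pi * (q * (\<Sum>j\<in>UNIV. of_int (k j) * \<alpha> $ j)))"
      by (simp add: prod.distrib cp cis_mult mult.assoc sum_distrib_left sum_negf[symmetric] sum.distrib[symmetric] algebra_simps sum_subtractf)
  qed
qed

text \<open>Were every point of the orbit far from \<open>y\<close>, multiplying a product of tent kernels by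
  \<open>\<Sum>\<^sub>i |1 - e(\<theta>\<^sub>i)|\<^sup>2\<close> would enlarge its mean square; almost orthogonality of the
  characters shows that it shrinks instead.\<close>

lemma effective_Kronecker:
  fixes \<alpha> y :: "real^'n::finite" and N M :: nat and Q \<delta> :: real
  assumes N: "1 \<le> N" and \<delta>: "0 < \<delta>" and M: "6 / \<delta> \<le> real M"
    and bad: "\<And>(c :: 'n \<Rightarrow> int) (p :: int). (\<exists>i. c i \<noteq> 0) \<Longrightarrow> (\<And>i. \<bar>c i\<bar> \<le> 2 * int N) \<Longrightarrow>
       \<delta> \<le> \<bar>(\<Sum>i\<in>UNIV. of_int (c i) * \<alpha> $ i) - of_int p\<bar>"
  shows "\<exists>m<2*M. \<exists>p :: 'n \<Rightarrow> int. \<forall>i. \<bar>(Q + real m) * \<alpha> $ i - y $ i - of_int (p i)\<bar> \<le> 6 * real CARD('n) / real N"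
proof (rule ccontr)
  assume far: "\<not> ?thesis"
  define d where "d = CARD('n)"
  \<comment> \<open>The argument ends in r^2 A \<le> 3 d D, where the squared norms of the tent and
    of its difference satisfy A \<ge> N^3/3 and D \<le> 3N. The factor 6 makes the left side at
    least 12 d^2 N, against 9 d N on the right.\<close>
  define r where "r = 6 * real d / real N"
  have d1: "1 \<le> d" unfolding d_def using zero_less_card_finite[where 'a='n] by linarith
  have r0: "0 \<le> r" by (simp add: r_def)
  have M0: "0 < real M" using \<delta> M by (meson less_le_trans zero_less_divide_iff zero_less_numeral)
  define a :: "int \<Rightarrow> real" where "a k = max 0 (real N - \<bar>real_of_int k\<bar>)" for k
  define J where "J = {-int N..int N}"
  define \<theta> where "\<theta> m i = (Q + real m) * \<alpha> $ i - y $ i" for m i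
  define S where "S g m = (\<Prod>j\<in>UNIV. \<Sum>k\<in>J. of_real (g j k) * cis (2 * pi * (of_int k * \<theta> m j)))"
    for g :: "'n \<Rightarrow> int \<Rightarrow> real" and m
  define T where "T g = (\<Sum>m<M. \<Sum>n<M. norm (S g (m + n)) ^ 2)" for g
  \<comment> \<open>The hypothesis 6/\<delta> \<le> M makes the error 16/\<delta>^2 at most M^2/2,
    so each mean square lies between one half and three halves of its diagonal part.\<close>
  have T: "\<bar>T g - real M ^ 2 * (\<Prod>j\<in>UNIV. \<Sum>k\<in>J. g j k ^ 2)\<bar> \<le> real M ^ 2 / 2 * (\<Prod>j\<in>UNIV. \<Sum>k\<in>J. g j k ^ 2)" for g
  proof -
    define B where "B = PiE (UNIV :: 'n set) (\<lambda>_. J)"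
    define b where "b k = of_real (\<Prod>j\<in>UNIV. g j (k j)) * cis (- 2 * pi * (\<Sum>j\<in>UNIV. of_int (k j) * y $ j))" for k :: "'n \<Rightarrow> int"
    define \<beta> where "\<beta> k = (\<Sum>j\<in>UNIV. of_int (k j) * \<alpha> $ j)" for k :: "'n \<Rightarrow> int"
    have S: "S g (m + n) = (\<Sum>k\<in>B. b k * cis (2 * pi * ((Q + real m + real n) * \<beta> k)))" for m n
      unfolding S_def \<theta>_def b_def \<beta>_def B_def
      by (subst prod_sum_cis) (auto simp: J_def add.assoc)
    have nb: "(\<Sum>k\<in>B. norm (b k) ^ 2) = (\<Prod>j\<in>UNIV. \<Sum>k\<in>J. g j k ^ 2)"
    proof -
      have "norm (b k) ^ 2 = (\<Prod>j\<in>UNIV. g j (k j) ^ 2)" for k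
      proof -
        have "norm (b k) = \<bar>\<Prod>j\<in>UNIV. g j (k j)\<bar>"
          unfolding b_def norm_mult norm_of_real norm_cis by simp
        then show ?thesis by (simp only: power2_abs prod_power_distrib)
      qed
      then show ?thesis unfolding B_def by (subst prod_sum_PiE) (auto simp: J_def)
    qed
    have "\<bar>T g - real M ^ 2 * (\<Sum>k\<in>B. norm (b k) ^ 2)\<bar> \<le> 16 / \<delta> ^ 2 * (\<Sum>k\<in>B. norm (b k) ^ 2)"
      unfolding T_def S
    proof (rule almost_orthogonality[OF _ \<delta>])
      show "finite B" unfolding B_def J_def by (intro finite_PiE) auto
      fix k l p assume kl: "k \<in> B" "l \<in> B" "k \<noteq> l"
      \<comment> \<open>Two frequency vectors with entries in [-N, N] differ by entries up to 2N,
        which is the range in \<open>bad\<close>.\<close>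
      have "\<delta> \<le> \<bar>(\<Sum>i\<in>UNIV. of_int (k i - l i) * \<alpha> $ i) - of_int p\<bar>"
      proof (rule bad)
        show "\<exists>i. k i - l i \<noteq> 0" using kl(3) by (metis eq_iff_diff_eq_0 ext)
        fix i
        have "k i \<in> J" "l i \<in> J" using kl by (auto simp: B_def)
        then show "\<bar>k i - l i\<bar> \<le> 2 * int N" by (auto simp: J_def)
      qed
      then show "\<delta> \<le> \<bar>\<beta> k - \<beta> l - of_int p\<bar>"
        by (simp add: \<beta>_def left_diff_distrib sum_subtractf)
    qed
    also have "\<dots> \<le> real M ^ 2 / 2 * (\<Sum>k\<in>B. norm (b k) ^ 2)"
    proof (intro mult_right_mono sum_nonneg)
      have "(6 / \<delta>) ^ 2 \<le> real M ^ 2" using M \<delta> by (intro power_mono) auto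
      then have "(36 / \<delta> ^ 2) / 2 \<le> real M ^ 2 / 2" by (intro divide_right_mono) (auto simp: power_divide)
      moreover have "16 / \<delta> ^ 2 \<le> (36 / \<delta> ^ 2) / 2" using \<delta> by (simp add: field_simps)
      ultimately show "16 / \<delta> ^ 2 \<le> real M ^ 2 / 2" by (rule order_trans[rotated])
    qed auto
    finally show ?thesis unfolding nb .
  qed
  define A where "A = (\<Sum>k\<in>J. a k ^ 2)"
  define D where "D = (\<Sum>k\<in>J. (a k - a (k - 1)) ^ 2)"
  define G where "G i j k = (if j = i then a k - a (k - 1) else a k)" for i j :: 'n and k
  have A: "real N ^ 3 / 3 \<le> A" unfolding A_def a_def J_def by (rule sum_tent_squares_ge)
  have A0: "0 < A" by (rule less_le_trans[OF _ A]) (use N in simp)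
  have D: "D \<le> 3 * real N"
  proof -
    have "D \<le> (\<Sum>k\<in>J. 1)"
      unfolding D_def
    proof (intro sum_mono)
      fix k
      have "\<bar>a k - a (k - 1)\<bar> \<le> 1" by (auto simp: a_def)
      then show "(a k - a (k - 1)) ^ 2 \<le> 1" by (simp add: abs_square_le_1)
    qed
    also have "\<dots> = 2 * real N + 1" by (simp add: J_def)
    finally show ?thesis using N by simp
  qed
  have SG: "S (G i) m = (1 - cis (2 * pi * \<theta> m i)) * S (\<lambda>_. a) m" for i m
  proof -
    have *: "(1 - cis (2 * pi * \<theta> m i)) * (\<Sum>k\<in>J. of_real (a k) * cis (2 * pi * (of_int k * \<theta> m i)))
       = (\<Sum>k\<in>J. of_real (a k - a (k - 1)) * cis (2 * pi * (of_int k * \<theta> m i)))"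
      unfolding J_def by (rule sum_tent_shift) (auto simp: a_def)
    have "S (G i) m = (\<Sum>k\<in>J. of_real (G i i k) * cis (2 * pi * (of_int k * \<theta> m i))) *
       (\<Prod>j\<in>UNIV-{i}. \<Sum>k\<in>J. of_real (G i j k) * cis (2 * pi * (of_int k * \<theta> m j)))"
      unfolding S_def by (rule prod.remove) auto
    also have "(\<Prod>j\<in>UNIV-{i}. \<Sum>k\<in>J. of_real (G i j k) * cis (2 * pi * (of_int k * \<theta> m j))) =
        (\<Prod>j\<in>UNIV-{i}. \<Sum>k\<in>J. of_real (a k) * cis (2 * pi * (of_int k * \<theta> m j)))"
      by (intro prod.cong sum.cong) (auto simp: G_def)
    also have "(\<Sum>k\<in>J. of_real (G i i k) * cis (2 * pi * (of_int k * \<theta> m i))) =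
       (1 - cis (2 * pi * \<theta> m i)) * (\<Sum>k\<in>J. of_real (a k) * cis (2 * pi * (of_int k * \<theta> m i)))"
      unfolding * by (simp add: G_def)
    finally show ?thesis
      unfolding S_def by (subst (2) prod.remove[where x = i]) (auto simp: mult.assoc)
  qed
  have PG: "(\<Prod>j\<in>UNIV. \<Sum>k\<in>J. G i j k ^ 2) = D * A ^ (d - 1)" for i
  proof -
    have "(\<Prod>j\<in>UNIV. \<Sum>k\<in>J. G i j k ^ 2) = (\<Sum>k\<in>J. G i i k ^ 2) * (\<Prod>j\<in>UNIV-{i}. \<Sum>k\<in>J. G i j k ^ 2)"
      by (rule prod.remove) auto
    also have "(\<Prod>j\<in>UNIV-{i}. \<Sum>k\<in>J. G i j k ^ 2) = (\<Prod>j\<in>UNIV-{i}. A)"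
      by (intro prod.cong refl) (auto simp: G_def A_def)
    finally show ?thesis by (simp add: G_def D_def d_def card_Diff_singleton)
  qed
  \<comment> \<open>The coordinate that is far from its target varies with m, so all the differences
    are summed; this costs the factor \<open>d\<close>.\<close>
  have step: "r ^ 2 * norm (S (\<lambda>_. a) m) ^ 2 \<le> (\<Sum>i\<in>UNIV. norm (S (G i) m) ^ 2)" if "m < 2 * M" for m
  proof -
    have "\<not> (\<forall>i. \<bar>(Q + real m) * \<alpha> $ i - y $ i - of_int (round (\<theta> m i))\<bar> \<le> 6 * real CARD('n) / real N)"
    proof
      assume "\<forall>i. \<bar>(Q + real m) * \<alpha> $ i - y $ i - of_int (round (\<theta> m i))\<bar> \<le> 6 * real CARD('n) / real N"
      then have "\<exists>m<2*M. \<exists>p :: 'n \<Rightarrow> int. \<forall>i. \<bar>(Q + real m) * \<alpha> $ i - y $ i - of_int (p i)\<bar> \<le> 6 * real CARD('n) / real N"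
        using that by (intro exI[of _ m] conjI exI[of _ "\<lambda>i. round (\<theta> m i)"])
      with far show False by contradiction
    qed
    then obtain i where i: "r < \<bar>near (\<theta> m i)\<bar>"
      unfolding near_def \<theta>_def r_def d_def not_all not_le by blast
    have "r ^ 2 \<le> norm (1 - cis (2 * pi * \<theta> m i)) ^ 2"
      using i near_le_norm_one_minus_cis[of "\<theta> m i"] r0 by (intro power_mono) auto
    then have "r ^ 2 * norm (S (\<lambda>_. a) m) ^ 2 \<le> norm (S (G i) m) ^ 2"
      unfolding SG norm_mult power_mult_distrib by (intro mult_right_mono) auto
    also have "\<dots> \<le> (\<Sum>i\<in>UNIV. norm (S (G i) m) ^ 2)"
      by (rule member_le_sum) auto
    finally show ?thesis .
  qed
  have "r ^ 2 * (real M ^ 2 / 2 * A ^ d) \<le> r ^ 2 * T (\<lambda>_. a)"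
  proof (intro mult_left_mono)
    have "\<bar>T (\<lambda>_. a) - real M ^ 2 * A ^ d\<bar> \<le> real M ^ 2 / 2 * A ^ d"
      using T[of "\<lambda>_. a"] by (simp add: A_def d_def)
    then have "real M ^ 2 * A ^ d - real M ^ 2 / 2 * A ^ d \<le> T (\<lambda>_. a)"
      by (simp only: abs_diff_le_iff)
    then show "real M ^ 2 / 2 * A ^ d \<le> T (\<lambda>_. a)" by (simp add: mult.commute)
  qed auto
  also have "\<dots> \<le> (\<Sum>m<M. \<Sum>n<M. \<Sum>i\<in>UNIV. norm (S (G i) (m + n)) ^ 2)"
    unfolding T_def sum_distrib_left by (intro sum_mono step) auto
  also have "\<dots> = (\<Sum>m<M. \<Sum>i\<in>UNIV. \<Sum>n<M. norm (S (G i) (m + n)) ^ 2)"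
    by (intro sum.cong refl sum.swap)
  also have "\<dots> = (\<Sum>i\<in>UNIV. T (G i))"
    unfolding T_def by (rule sum.swap)
  also have "\<dots> \<le> (\<Sum>i\<in>(UNIV::'n set). 3 / 2 * real M ^ 2 * (D * A ^ (d - 1)))"
  proof (intro sum_mono)
    fix i show "T (G i) \<le> 3 / 2 * real M ^ 2 * (D * A ^ (d - 1))"
    proof -
      have "T (G i) \<le> real M ^ 2 * (D * A ^ (d - 1)) + real M ^ 2 / 2 * (D * A ^ (d - 1))"
        using T[of "G i"] unfolding PG by (simp only: abs_diff_le_iff)
      then show ?thesis by (simp add: algebra_simps)
    qed
  qed
  also have "\<dots> = real d * (3 / 2 * real M ^ 2 * (D * A ^ (d - 1)))" by (simp add: d_def)
  finally have "r ^ 2 * (real M ^ 2 / 2 * A ^ d) \<le> real d * (3 / 2 * real M ^ 2 * (D * A ^ (d - 1)))" .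
  moreover have "A ^ d = A * A ^ (d - 1)" using d1 by (simp add: power_eq_if)
  ultimately have "(r ^ 2 * A) * (real M ^ 2 * A ^ (d - 1) / 2) \<le> (3 * real d * D) * (real M ^ 2 * A ^ (d - 1) / 2)"
    by (simp add: mult_ac)
  then have "r ^ 2 * A \<le> 3 * real d * D"
    using M0 A0 by (subst (asm) mult_le_cancel_right_pos) auto
  also have "\<dots> \<le> 3 * real d * (3 * real N)" using D by (intro mult_left_mono) auto
  finally have "r ^ 2 * A \<le> 9 * real d * real N" by simp
  moreover have "r ^ 2 * (real N ^ 3 / 3) \<le> r ^ 2 * A" using A by (intro mult_left_mono) auto
  moreover have "r ^ 2 * (real N ^ 3 / 3) = 12 * real d ^ 2 * real N"
    using N by (simp add: r_def power_divide power2_eq_square power3_eq_cube field_simps)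
  ultimately have "12 * real d ^ 2 * real N \<le> 9 * real d * real N" by linarith
  then have "12 * real d ^ 2 \<le> 9 * real d" using N by simp
  moreover have "real d \<le> real d ^ 2" using d1 by (simp add: power2_eq_square)
  ultimately show False using d1 by linarith
qed

subsection \<open>Upper bound\<close>

text \<open>A point that is not an accumulation point may itself belong to \<open>NA\<close>, so the
  gap need not be centred there. Were every box hit, the box of radius t around x + (t, ..., t)
  would supply a point of \<open>NA\<close> close to x and different from it.\<close>

lemma not_Dset_imp_gap:
  fixes \<alpha> :: "real^'n::finite"
  assumes "\<alpha> \<notin> Dset \<eta>"
  obtains (gap) \<epsilon> x where "0 < \<epsilon>" "\<And>v. v \<in> NA \<eta> \<alpha> \<Longrightarrow> \<exists>i. \<epsilon> \<le> \<bar>v $ i - x $ i\<bar>"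
proof (rule ccontr)
  assume nt: "\<not> thesis"
  have dense: "\<exists>v\<in>NA \<eta> \<alpha>. \<forall>i. \<bar>v $ i - x $ i\<bar> < \<epsilon>" if "0 < \<epsilon>" for x \<epsilon>
  proof (rule ccontr)
    assume "\<not> ?thesis"
    then have "\<exists>i. \<epsilon> \<le> \<bar>v $ i - x $ i\<bar>" if "v \<in> NA \<eta> \<alpha>" for v
      using that by (meson not_le)
    with \<open>0 < \<epsilon>\<close> have thesis by (rule gap)
    with nt show False by contradiction
  qed
  have "x islimpt NA \<eta> \<alpha>" for x
    unfolding islimpt_approachable
  proof (intro allI impI)
    fix e :: real assume e: "0 < e"
    define d where "d = real CARD('n)"
    have d: "1 \<le> d" unfolding d_def using zero_less_card_finite[where 'a='n] by linarith
    define t where "t = e / (4 * d)"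
    have t: "0 < t" using e d by (simp add: t_def)
    obtain v where v: "v \<in> NA \<eta> \<alpha>" "\<And>i. \<bar>v $ i - (x + (\<chi> i. t)) $ i\<bar> < t"
      using dense[OF t] by blast
    have i: "0 < v $ i - x $ i" "\<bar>(v - x) $ i\<bar> \<le> 2 * t" for i using v(2)[of i] by auto
    have "dist v x \<le> (\<Sum>i\<in>UNIV. \<bar>(v - x) $ i\<bar>)" unfolding dist_norm by (rule norm_le_l1_cart)
    also have "\<dots> \<le> (\<Sum>i\<in>(UNIV::'n set). 2 * t)" by (intro sum_mono i)
    also have "\<dots> = e / 2" using d by (simp add: t_def d_def)
    finally have "dist v x < e" using e by simp
    moreover have "v \<noteq> x" using i(1) by auto
    ultimately show "\<exists>v\<in>NA \<eta> \<alpha>. v \<noteq> x \<and> dist v x < e" using v(1) by blast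
  qed
  then have "\<alpha> \<in> Dset \<eta>" by (auto simp: Dset_def accA_def)
  with assms show False by blast
qed

text \<open>If no such \<open>c\<close> existed, Kronecker's theorem with \<delta> = 6/M would bring
  some q\<alpha> within K/N of x / Q^\<eta> modulo integer vectors. After multiplication by q^\<eta>
  there are two errors, one from this distance and one from replacing q by Q; both are small, so the
  point enters the gap around x.\<close>

lemma transference:
  fixes \<alpha> :: "real^'n::finite"
  assumes \<alpha>: "\<alpha> \<notin> Dset \<eta>" and \<eta>: "0 < \<eta>" "\<eta> \<le> 1"
  obtains C N0 where "0 < C" "\<And>N. N0 \<le> N \<Longrightarrow> \<exists>(c :: 'n \<Rightarrow> int) (p :: int). (\<exists>i. c i \<noteq> 0) \<and>
      (\<forall>i. \<bar>c i\<bar> \<le> 2 * int N) \<and> \<bar>(\<Sum>i\<in>UNIV. of_int (c i) * \<alpha> $ i) - of_int p\<bar> < C * real N powr (-1/\<eta>)"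
proof -
  obtain x \<epsilon> where \<epsilon>: "0 < \<epsilon>" and gap: "\<And>v. v \<in> NA \<eta> \<alpha> \<Longrightarrow> \<exists>i. \<epsilon> \<le> \<bar>v $ i - x $ i\<bar>"
    using not_Dset_imp_gap[OF \<alpha>] by blast
  define K where "K = 6 * real CARD('n)"
  have K: "0 < K" unfolding K_def using zero_less_card_finite[where 'a='n] by simp
  define X where "X = norm x + 1"
  have X: "0 < X" "\<And>i. \<bar>x $ i\<bar> \<le> X" using component_le_norm_cart[of x] by (auto simp: X_def add_nonneg_pos add_increasing2)
  \<comment> \<open>On the window q/Q \<le> 1 + 2/L, and \<eta> \<le> 1 gives |(q/Q)^\<eta> - 1|
    \<le> 2/L; this choice keeps the resulting error at most \<epsilon>/2.\<close>
  define L where "L = nat \<lceil>4 * X / \<epsilon>\<rceil> + 1"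
  have L: "4 * X / \<epsilon> \<le> real L" "1 \<le> L" unfolding L_def by linarith+
  \<comment> \<open>Since q \<le> (L+2) M \<le> (L+2) c3 N^(1/\<eta>), this value gives q^\<eta> K/N
    \<le> \<epsilon>/4, so the two errors add up to less than \<epsilon>.\<close>
  define c3 where "c3 = (\<epsilon> / (4 * K)) powr (1/\<eta>) / (real L + 2)"
  have c3: "0 < c3" using \<epsilon> K by (simp add: c3_def add_nonneg_pos)
  have "filterlim (\<lambda>N::nat. c3 * real N powr (1/\<eta>)) at_top sequentially"
    using \<eta> c3 by real_asymp
  then have "\<forall>\<^sub>F N in sequentially. 1 \<le> c3 * real N powr (1/\<eta>)"
    by (simp add: filterlim_at_top)
  then obtain N1 where N1: "\<And>N. N1 \<le> N \<Longrightarrow> 1 \<le> c3 * real N powr (1/\<eta>)"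
    by (auto simp: eventually_sequentially)
  show thesis
  proof (rule that[of "12 / c3" "max N1 1"])
    show "0 < 12 / c3" using c3 by simp
    fix N assume "max N1 1 \<le> N"
    then have N: "N1 \<le> N" "1 \<le> N" by auto
    define M where "M = nat \<lfloor>c3 * real N powr (1/\<eta>)\<rfloor>"
    have M12: "1 \<le> M" "real M \<le> c3 * real N powr (1/\<eta>)" "c3 * real N powr (1/\<eta>) < real M + 1"
      using N1[OF N(1)] unfolding M_def by linarith+
    then have M: "1 \<le> M" "real M \<le> c3 * real N powr (1/\<eta>)" "c3 * real N powr (1/\<eta>) \<le> 2 * real M"
      by auto
    define \<delta> where "\<delta> = 6 / real M"
    have "\<delta> \<le> 12 / c3 * real N powr (-1/\<eta>)"
    proof -
      have "\<delta> = 12 / (2 * real M)" by (simp add: \<delta>_def)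
      also have "\<dots> \<le> 12 / (c3 * real N powr (1/\<eta>))"
        using M c3 N by (intro divide_left_mono) auto
      finally show ?thesis by (simp add: powr_minus_divide)
    qed
    moreover have "\<exists>(c :: 'n \<Rightarrow> int) (p :: int). (\<exists>i. c i \<noteq> 0) \<and>
      (\<forall>i. \<bar>c i\<bar> \<le> 2 * int N) \<and> \<bar>(\<Sum>i\<in>UNIV. of_int (c i) * \<alpha> $ i) - of_int p\<bar> < \<delta>"
    proof (rule ccontr)
      assume contra: "\<not> ?thesis"
      define Q where "Q = real L * real M"
      have Q: "0 < Q" using L M by (simp add: Q_def)
      have "\<exists>m<2*M. \<exists>p :: 'n \<Rightarrow> int. \<forall>i. \<bar>(Q + real m) * \<alpha> $ i - (Q powr (-\<eta>) *\<^sub>R x) $ i - of_int (p i)\<bar> \<le> 6 * real CARD('n) / real N"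
      proof (rule effective_Kronecker[OF N(2), where \<delta> = \<delta>])
        show "0 < \<delta>" "6 / \<delta> \<le> real M" using M by (auto simp: \<delta>_def)
        fix c :: "'n \<Rightarrow> int" and p :: int
        assume "\<exists>i. c i \<noteq> 0" "\<And>i. \<bar>c i\<bar> \<le> 2 * int N"
        then show "\<delta> \<le> \<bar>(\<Sum>i\<in>UNIV. of_int (c i) * \<alpha> $ i) - of_int p\<bar>"
          using contra by (meson not_le)
      qed
      then obtain m and p :: "'n \<Rightarrow> int" where m: "m < 2 * M"
        and p: "\<And>i. \<bar>(Q + real m) * \<alpha> $ i - Q powr (-\<eta>) * x $ i - of_int (p i)\<bar> \<le> K / real N"
        by (auto simp: K_def)
      define q :: int where "q = int (L * M + m)"
      have q: "real_of_int q = Q + real m" by (simp add: q_def Q_def)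
      have q0: "0 < q" using L M by (simp add: q_def add_pos_nonneg)
      define v where "v = (\<bar>real_of_int q\<bar> powr \<eta>) *\<^sub>R (of_int q *\<^sub>R \<alpha> - (\<chi> i. of_int (p i)))"
      have "v \<in> NA \<eta> \<alpha>" 
        unfolding NA_def v_def using q0
        by (intro CollectI exI[of _ q] exI[of _ "\<chi> i. of_int (p i)"]) auto
      then obtain i where i: "\<epsilon> \<le> \<bar>v $ i - x $ i\<bar>" using gap by blast
      let ?q = "Q + real m"
      have vi: "v $ i = ?q powr \<eta> * (?q * \<alpha> $ i - of_int (p i))"
        using Q by (simp add: v_def q)
      have "v $ i - x $ i = ?q powr \<eta> * (?q * \<alpha> $ i - Q powr (-\<eta>) * x $ i - of_int (p i)) + (?q powr \<eta> * Q powr (-\<eta>) - 1) * x $ i"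
        unfolding vi by (simp add: algebra_simps)
      then have "\<bar>v $ i - x $ i\<bar> \<le> ?q powr \<eta> * \<bar>?q * \<alpha> $ i - Q powr (-\<eta>) * x $ i - of_int (p i)\<bar> + \<bar>?q powr \<eta> * Q powr (-\<eta>) - 1\<bar> * \<bar>x $ i\<bar>"
        by (simp only:) (rule order_trans[OF abs_triangle_ineq], simp add: abs_mult)
      also have "\<dots> \<le> \<epsilon> / 4 + \<epsilon> / 2"
      proof (rule add_mono)
        have "?q \<le> (real L + 2) * real M" using m by (simp add: Q_def algebra_simps)
        also have "\<dots> \<le> (real L + 2) * (c3 * real N powr (1/\<eta>))" by (intro mult_left_mono M) auto
        also have "\<dots> = (\<epsilon> / (4 * K)) powr (1/\<eta>) * real N powr (1/\<eta>)" by (simp add: c3_def)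
        finally have "?q powr \<eta> \<le> ((\<epsilon> / (4 * K)) powr (1/\<eta>) * real N powr (1/\<eta>)) powr \<eta>"
          using Q \<eta> by (intro powr_mono2) auto
        also have "\<dots> = \<epsilon> / (4 * K) * real N"
          using \<epsilon> K \<eta> N by (simp add: powr_mult powr_powr)
        finally have "?q powr \<eta> * \<bar>?q * \<alpha> $ i - Q powr (-\<eta>) * x $ i - of_int (p i)\<bar> \<le> (\<epsilon> / (4 * K) * real N) * (K / real N)"
          using p[of i] \<epsilon> K by (intro mult_mono) auto
        also have "\<dots> = \<epsilon> / 4" using K N by simp
        finally show "?q powr \<eta> * \<bar>?q * \<alpha> $ i - Q powr (-\<eta>) * x $ i - of_int (p i)\<bar> \<le> \<epsilon> / 4" .
        have e1: "?q powr \<eta> * Q powr (-\<eta>) = (1 + real m / Q) powr \<eta>"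
          using Q by (simp add: powr_minus_divide powr_divide[symmetric] add_divide_distrib)
        have e2: "1 \<le> (1 + real m / Q) powr \<eta>"
          using Q \<eta> by (intro ge_one_powr_ge_zero) auto
        have "(1 + real m / Q) powr \<eta> \<le> (1 + real m / Q) powr 1"
          using Q \<eta> by (intro powr_mono) auto
        also have "\<dots> = 1 + real m / Q" using Q by (simp add: add_nonneg_nonneg)
        also have "real m / Q \<le> 2 / real L"
          using m M L by (simp add: Q_def field_simps)
        finally have "\<bar>?q powr \<eta> * Q powr (-\<eta>) - 1\<bar> \<le> 2 / real L" unfolding e1 using e2 by simp
        then have "\<bar>?q powr \<eta> * Q powr (-\<eta>) - 1\<bar> * \<bar>x $ i\<bar> \<le> 2 / real L * X"
          using X L by (intro mult_mono) auto
        also have "\<dots> \<le> \<epsilon> / 2" using L \<epsilon> by (simp add: field_simps)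
        finally show "\<bar>?q powr \<eta> * Q powr (-\<eta>) - 1\<bar> * \<bar>x $ i\<bar> \<le> \<epsilon> / 2" .
      qed
      finally show False using i \<epsilon> by simp
    qed
    ultimately show "\<exists>(c :: 'n \<Rightarrow> int) (p :: int). (\<exists>i. c i \<noteq> 0) \<and>
      (\<forall>i. \<bar>c i\<bar> \<le> 2 * int N) \<and> \<bar>(\<Sum>i\<in>UNIV. of_int (c i) * \<alpha> $ i) - of_int p\<bar> < 12 / c3 * real N powr (-1/\<eta>)"
      by (meson less_le_trans)
  qed
qed

text \<open>One integer \<open>R\<close> bounds both the point and the width of the slabs, so that
  countably many such sets suffice. The dyadic size 2^m of \<open>c\<close> indexes the levels of
  the cover.\<close>

definition slab_limsup :: "real \<Rightarrow> nat \<Rightarrow> (real^'n::finite) set" where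
  "slab_limsup \<eta> R = {\<alpha>. (\<forall>i. \<bar>\<alpha> $ i\<bar> \<le> real R) \<and> (\<forall>m0. \<exists>m\<ge>m0. \<exists>(c :: 'n \<Rightarrow> int) (p :: int).
     (\<forall>i. \<bar>c i\<bar> \<le> 2 ^ (m+1)) \<and> (\<exists>i. 2 ^ m \<le> \<bar>c i\<bar>) \<and>
     \<bar>(\<Sum>i\<in>UNIV. of_int (c i) * \<alpha> $ i) - of_int p\<bar> \<le> real R * (2 ^ m) powr (-1/\<eta>))}"

lemma KsetD:
  fixes \<alpha> :: "real^'n::finite" and c :: "'n \<Rightarrow> real"
  assumes "\<alpha> \<in> Kset" "c0 \<in> \<rat>" "\<And>i. c i \<in> \<rat>" "c0 + (\<Sum>i\<in>UNIV. c i * \<alpha> $ i) = 0"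
  shows "c i = 0"
proof -
  have "c0 \<in> \<rat> \<and> (\<forall>i. c i \<in> \<rat>) \<and> c0 + (\<Sum>i\<in>UNIV. c i * \<alpha> $ i) = 0 \<longrightarrow> c0 = 0 \<and> (\<forall>i. c i = 0)"
    using assms(1) unfolding Kset_def mem_Collect_eq by (elim allE)
  then have "c0 = 0 \<and> (\<forall>i. c i = 0)" by (rule mp) (intro conjI allI assms)
  then show ?thesis by blast
qed

lemma Kset_near_pos:
  fixes \<alpha> :: "real^'n::finite" and c :: "'n \<Rightarrow> int"
  assumes "\<alpha> \<in> Kset" "c i \<noteq> 0"
  shows "0 < \<bar>near (\<Sum>i\<in>UNIV. of_int (c i) * \<alpha> $ i)\<bar>"
proof (rule ccontr)
  assume "\<not> ?thesis"
  then have "of_int (- round (\<Sum>i\<in>UNIV. of_int (c i) * \<alpha> $ i)) + (\<Sum>i\<in>UNIV. of_int (c i) * \<alpha> $ i) = 0"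
    by (simp add: near_def)
  then have "real_of_int (c i) = 0"
    by (intro KsetD[OF assms(1), where c = "\<lambda>i. of_int (c i)"]) (auto simp only: Rats_of_int)
  with assms(2) show False by simp
qed

text \<open>Only finitely many \<open>c\<close> have entries up to 2^m0, and for \<alpha> in
  \<open>Kset\<close> each nonzero one keeps c\<cdot>\<alpha> at a positive distance from the
  integers. An approximation below the least of these distances therefore uses a larger
  \<open>c\<close>.\<close>

lemma compl_Dset_subset_slab_limsup:
  assumes \<eta>: "0 < \<eta>" "\<eta> \<le> 1"
  shows "- Dset \<eta> \<inter> Kset \<subseteq> (\<Union>R. slab_limsup \<eta> R :: (real^'n::finite) set)"
proof
  fix \<alpha> :: "real^'n" assume "\<alpha> \<in> - Dset \<eta> \<inter> Kset"
  then have D: "\<alpha> \<notin> Dset \<eta>" and K: "\<alpha> \<in> Kset" by auto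
  define \<beta> where "\<beta> c = (\<Sum>i\<in>UNIV. of_int (c i) * \<alpha> $ i)" for c :: "'n \<Rightarrow> int"
  obtain C N0 where C: "0 < C" "\<And>N. N0 \<le> N \<Longrightarrow> \<exists>(c :: 'n \<Rightarrow> int) (p :: int). (\<exists>i. c i \<noteq> 0) \<and>
      (\<forall>i. \<bar>c i\<bar> \<le> 2 * int N) \<and> \<bar>\<beta> c - of_int p\<bar> < C * real N powr (-1/\<eta>)"
    unfolding \<beta>_def by (fact transference[OF D \<eta>])
  define R where "R = nat \<lceil>max (C * 2 powr (1/\<eta>)) (norm \<alpha>)\<rceil>"
  have R: "C * 2 powr (1/\<eta>) \<le> real R" "norm \<alpha> \<le> real R" unfolding R_def by linarith+
  have "\<exists>m\<ge>m0. \<exists>(c :: 'n \<Rightarrow> int) (p :: int). (\<forall>i. \<bar>c i\<bar> \<le> 2 ^ (m+1)) \<and> (\<exists>i. 2 ^ m \<le> \<bar>c i\<bar>) \<and>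
     \<bar>\<beta> c - of_int p\<bar> \<le> real R * (2 ^ m) powr (-1/\<eta>)" for m0
  proof -
    define F where "F = {c :: 'n \<Rightarrow> int. (\<forall>i. c i \<in> {-(2^m0)..2^m0}) \<and> (\<exists>i. c i \<noteq> 0)}"
    have "F \<subseteq> PiE UNIV (\<lambda>_. {-(2^m0)..2^m0})" by (auto simp: F_def)
    then have "finite F" by (rule finite_subset) (intro finite_PiE, auto)
    define \<mu> where "\<mu> = Min (insert 1 ((\<lambda>c. \<bar>near (\<beta> c)\<bar>) ` F))"
    have "0 < \<mu>" unfolding \<mu>_def using \<open>finite F\<close> Kset_near_pos[OF K]
      by (subst Min_gr_iff) (auto simp: F_def \<beta>_def)
    have \<mu>: "\<mu> \<le> \<bar>near (\<beta> c)\<bar>" if "c \<in> F" for c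
      unfolding \<mu>_def using \<open>finite F\<close> that by (intro Min_le) auto
    have "((\<lambda>N::nat. C * real N powr (-1/\<eta>)) \<longlongrightarrow> 0) sequentially"
      using \<eta> by real_asymp
    from order_tendstoD(2)[OF this \<open>0 < \<mu>\<close>] eventually_ge_at_top[of "max N0 1"]
    have "\<forall>\<^sub>F N in sequentially. C * real N powr (-1/\<eta>) < \<mu> \<and> max N0 1 \<le> N"
      by eventually_elim auto
    then obtain N where N: "C * real N powr (-1/\<eta>) < \<mu>" "N0 \<le> N" "1 \<le> N"
      by (auto simp: eventually_sequentially)
    obtain c :: "'n \<Rightarrow> int" and p :: int where c: "\<exists>i. c i \<noteq> 0" "\<And>i. \<bar>c i\<bar> \<le> 2 * int N"
      "\<bar>\<beta> c - of_int p\<bar> < C * real N powr (-1/\<eta>)" using C(2)[OF N(2)] by blast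
    have "c \<notin> F" using \<mu>[of c] abs_near_le_diff[of "\<beta> c" p] c(3) N(1) by linarith
    then obtain i0 where "c i0 \<notin> {-(2^m0)..2^m0}" using c(1) unfolding F_def by blast
    then have i0: "2 ^ m0 < \<bar>c i0\<bar>" by auto
    define n where "n = Max (range (\<lambda>i. nat \<bar>c i\<bar>))"
    have n: "nat \<bar>c i\<bar> \<le> n" for i unfolding n_def by (intro Max_ge) auto
    have "n \<in> range (\<lambda>i. nat \<bar>c i\<bar>)" unfolding n_def by (intro Max_in) auto
    then obtain i1 where i1: "n = nat \<bar>c i1\<bar>" by blast
    have "2 ^ m0 < n" 
    proof -
      have "int (2 ^ m0) < \<bar>c i0\<bar>" using i0 by simp
      then show ?thesis using n[of i0] by linarith
    qed
    then have "1 \<le> n" by simp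
    from ex_power_ivl1[of 2, OF _ this] obtain m where m: "2 ^ m \<le> n" "n < 2 ^ (m + 1)" by auto
    have "m0 \<le> m"
    proof -
      have "(2::nat) ^ m0 < 2 ^ (m + 1)" using \<open>2 ^ m0 < n\<close> m(2) by simp
      then show ?thesis by (subst (asm) power_strict_increasing_iff) auto
    qed
    moreover have "\<bar>c i\<bar> \<le> 2 ^ (m+1)" for i
    proof -
      have "int (nat \<bar>c i\<bar>) \<le> int (2 ^ (m+1))" using n[of i] m(2) by (simp only: of_nat_le_iff)
      then show ?thesis by simp
    qed
    moreover have i1': "2 ^ m \<le> \<bar>c i1\<bar>"
    proof -
      have "int (2 ^ m) \<le> int (nat \<bar>c i1\<bar>)" using m(1) unfolding i1 by (simp only: of_nat_le_iff)
      then show ?thesis by simp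
    qed
    moreover have "\<bar>\<beta> c - of_int p\<bar> \<le> real R * (2 ^ m) powr (-1/\<eta>)"
    proof -
      \<comment> \<open>The bound |c| \<le> 2N gives N \<ge> 2^m / 2. Since the error decreases in
        N, passing from N to 2^m costs the factor 2^(1/\<eta>) contained in
        \<open>R\<close>.\<close>
      have "2 ^ m \<le> 2 * int N" using i1' c(2)[of i1] by linarith
      then have "real_of_int (2 ^ m) \<le> real_of_int (2 * int N)" by (simp only: of_int_le_iff)
      then have "2 ^ m / 2 \<le> real N" by simp
      then have "real N powr (-1/\<eta>) \<le> (2 ^ m / 2) powr (-1/\<eta>)"
        using \<eta> by (intro powr_mono2') auto
      also have "\<dots> = 2 powr (1/\<eta>) * (2 ^ m) powr (-1/\<eta>)"
        by (simp add: powr_divide powr_minus_divide)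
      finally have "C * real N powr (-1/\<eta>) \<le> C * (2 powr (1/\<eta>) * (2 ^ m) powr (-1/\<eta>))"
        using C(1) by (intro mult_left_mono) auto
      also have "\<dots> = (C * 2 powr (1/\<eta>)) * (2 ^ m) powr (-1/\<eta>)" by simp
      also have "\<dots> \<le> real R * (2 ^ m) powr (-1/\<eta>)" by (intro mult_right_mono R) auto
      finally show ?thesis using c(3) by linarith
    qed
    ultimately show ?thesis by blast
  qed
  moreover have "\<bar>\<alpha> $ i\<bar> \<le> real R" for i
    using component_le_norm_cart[of \<alpha> i] R(2) by linarith
  ultimately have "\<alpha> \<in> slab_limsup \<eta> R" unfolding slab_limsup_def \<beta>_def mem_Collect_eq by (intro conjI allI)
  then show "\<alpha> \<in> (\<Union>R. slab_limsup \<eta> R)" by blast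
qed

text \<open>At level m the vector \<open>c\<close> has size 2^m, so the slabs have thickness of
  order h = 2^(-m(1 + 1/\<eta>)). About 2^(m(d+1)) pairs (c, p) matter in the box |\<alpha> i| \<le>
  R, and each slab takes about h^(-(d-1)) cells of size h: prescribing the cells of all coordinates
  but one with |c i| \<ge> 2^m confines the remaining one to O(h). The cost is of order 2^(m e), and
  the condition on \<open>s\<close> says e < 0.\<close>

lemma hausdorff_measure_slab_limsup:
  assumes \<eta>: "0 < \<eta>" and s: "real CARD('n::finite) - 1 + (real CARD('n) + 1) * \<eta> / (1 + \<eta>) < s"
  shows "hausdorff_measure s (slab_limsup \<eta> R :: (real^'n) set) = 0"
proof -
  define d where "d = CARD('n)"
  have d1: "1 \<le> d" unfolding d_def using zero_less_card_finite[where 'a='n] by linarith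
  define \<sigma> where "\<sigma> = 1 + 1/\<eta>"
  have \<sigma>: "0 < \<sigma>" "\<sigma> * (\<eta> / (1 + \<eta>)) = 1" using \<eta> by (auto simp: \<sigma>_def add_pos_pos divide_simps)
  define h where "h m = ((2::real) ^ m) powr (-\<sigma>)" for m :: nat
  have h0: "0 < h m" for m by (simp add: h_def)
  have h1: "h m \<le> 1" for m
    unfolding h_def using \<sigma> powr_mono[of "-\<sigma>" 0 "2 ^ m"] by simp
  have h2: "(2 ^ m) powr (-1/\<eta>) = 2 ^ m * h m" for m
    unfolding h_def \<sigma>_def by (simp add: powr_diff powr_minus_divide powr_add)
  \<comment> \<open>\<open>G\<close> and \<open>P\<close> bound the cell indices of [-R, R] and the
    integer p, where |p| \<le> d 2^(m+1) R + R 2^m; they keep the index sets finite.\<close>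
  define G where "G m = \<lceil>real R / h m\<rceil> + 1" for m
  define P :: "nat \<Rightarrow> int" where "P m = 2 ^ m * (2 * int d * int R + int R + 1)" for m
  define I where "I m = PiE (UNIV::'n set) (\<lambda>_. {-(2^(m+1))..(2::int)^(m+1)}) \<times> {- P m..P m} \<times>
     (SIGMA i : (UNIV::'n set). PiE (UNIV-{i}) (\<lambda>_. {- G m..G m}))" for m
  define U where "U m = (\<lambda>(c, p, i, g). {\<alpha> :: real^'n. (\<forall>i. \<bar>\<alpha> $ i\<bar> \<le> real R) \<and> 2 ^ m \<le> \<bar>c i\<bar> \<and>
     \<bar>(\<Sum>i\<in>UNIV. of_int (c i) * \<alpha> $ i) - of_int p\<bar> \<le> real R * (2 ^ m * h m) \<and>
     (\<forall>j. j \<noteq> i \<longrightarrow> \<lfloor>\<alpha> $ j / h m\<rfloor> = g j)})" for m :: nat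
  \<comment> \<open>Coordinate i varies by at most (2R + 2(d-1)) h and the others together by (d-1)
    h.\<close>
  define K where "K = 2 * real R + 3 * real d"
  have K0: "0 < K" using d1 by (simp add: K_def)
  define e where "e = real d + 1 - \<sigma> * (s - (real d - 1))"
  have e: "e < 0"
  proof -
    have "(real d + 1) * (\<eta> / (1 + \<eta>)) < s - (real d - 1)" using s by (simp add: d_def)
    then have "\<sigma> * ((real d + 1) * (\<eta> / (1 + \<eta>))) < \<sigma> * (s - (real d - 1))" using \<sigma> by (intro mult_strict_left_mono) auto
    moreover have "\<sigma> * ((real d + 1) * (\<eta> / (1 + \<eta>))) = real d + 1" using \<sigma>(2) by (simp only: mult.left_commute[of \<sigma>] mult_1_right)
    ultimately show ?thesis by (simp add: e_def)
  qed
  have s0: "0 < s"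
  proof -
    have "0 \<le> real d - 1 + (real d + 1) * \<eta> / (1 + \<eta>)" using d1 \<eta> by (intro add_nonneg_nonneg) auto
    then show ?thesis using s by (simp add: d_def)
  qed
  define K2 where "K2 = 5 ^ d * (2 * (2 * real d * real R + real R + 1) + 1) * (real d * (2 * real R + 5) ^ (d - 1)) * K powr s"
  show ?thesis
  proof (rule hausdorff_measure_limsup_eq_0[where I = I and U = U and r = "\<lambda>m. K * h m" and a = "\<lambda>m. K2 * (2 powr e) ^ m", OF s0])
    show "finite (I m)" for m unfolding I_def by (intro finite_cartesian_product finite_SigmaI finite_PiE) auto
    show "bounded (U m j)" for m j
    proof -
      have "norm x \<le> (\<Sum>i\<in>(UNIV::'n set). real R)" if "x \<in> U m j" for x
        using that by (intro order_trans[OF norm_le_l1_cart] sum_mono) (auto simp: U_def split: prod.splits)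
      then show ?thesis unfolding bounded_iff by blast
    qed
    show "0 \<le> K * h m" for m using K0 h0[of m] by simp
    show "(\<lambda>m. K * h m) \<longlonglongrightarrow> 0"
      unfolding h_def using \<sigma> by real_asymp
    show "diameter (U m j) \<le> K * h m" if jI: "j \<in> I m" for m j
    proof (rule diameter_le)
      show "U m j \<noteq> {} \<or> 0 \<le> K * h m" using K0 h0[of m] by simp
      fix x y assume xy: "x \<in> U m j" "y \<in> U m j"
      obtain c p i g where j: "j = (c, p, i, g)" by (metis prod.exhaust)
      have near: "\<bar>x $ k - y $ k\<bar> \<le> h m" if "k \<noteq> i" for k
      proof -
        have "\<lfloor>x $ k / h m\<rfloor> = \<lfloor>y $ k / h m\<rfloor>" using xy that by (auto simp: U_def j)
        then have "\<bar>x $ k / h m - y $ k / h m\<bar> < 1" by linarith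
        then have "\<bar>x $ k - y $ k\<bar> / h m < 1" using h0[of m] by (simp add: diff_divide_distrib[symmetric])
        then show ?thesis using h0[of m] by simp
      qed
      define S where "S z = (\<Sum>k\<in>UNIV. of_int (c k) * z $ k)" for z :: "real^'n"
      have S: "S x - S y = of_int (c i) * (x $ i - y $ i) + (\<Sum>k\<in>UNIV-{i}. of_int (c k) * (x $ k - y $ k))"
        unfolding S_def sum_subtractf[symmetric] right_diff_distrib[symmetric] by (rule sum.remove) auto
      show "norm (x - y) \<le> K * h m"
      proof -
        from jI have c: "\<bar>c k\<bar> \<le> 2 ^ (m + 1)" for k by (auto simp: I_def j PiE_def Pi_def abs_le_iff) (metis minus_le_iff)
        have "\<bar>S x - of_int p\<bar> \<le> real R * (2 ^ m * h m)" "\<bar>S y - of_int p\<bar> \<le> real R * (2 ^ m * h m)"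
          using xy by (auto simp: U_def j S_def)
        then have SS: "\<bar>S x - S y\<bar> \<le> 2 * real R * (2 ^ m * h m)" by (simp add: abs_le_iff)
        have "\<bar>\<Sum>k\<in>UNIV-{i}. of_int (c k) * (x $ k - y $ k)\<bar> \<le> (\<Sum>k\<in>UNIV-{i}. 2 ^ (m+1) * h m)"
        proof (intro order_trans[OF sum_abs] sum_mono)
          fix k assume "k \<in> UNIV - {i}"
          have "real_of_int \<bar>c k\<bar> \<le> real_of_int (2 ^ (m+1))" using c[of k] by (simp only: of_int_le_iff)
          then show "\<bar>of_int (c k) * (x $ k - y $ k)\<bar> \<le> 2 ^ (m+1) * h m"
            unfolding abs_mult using near[of k] \<open>k \<in> UNIV - {i}\<close> by (intro mult_mono) auto
        qed
        also have "\<dots> = (real d - 1) * (2 ^ (m+1) * h m)" using d1 by (simp add: d_def card_Diff_singleton)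
        finally have rest: "\<bar>\<Sum>k\<in>UNIV-{i}. of_int (c k) * (x $ k - y $ k)\<bar> \<le> (real d - 1) * (2 ^ (m+1) * h m)" .
        have "real_of_int (2 ^ m) \<le> real_of_int \<bar>c i\<bar>" using xy by (simp only: of_int_le_iff) (auto simp: U_def j)
        then have "2 ^ m * \<bar>x $ i - y $ i\<bar> \<le> \<bar>of_int (c i) * (x $ i - y $ i)\<bar>"
          unfolding abs_mult by (intro mult_right_mono) auto
        also have "of_int (c i) * (x $ i - y $ i) = (S x - S y) - (\<Sum>k\<in>UNIV-{i}. of_int (c k) * (x $ k - y $ k))"
          using S by simp
        also have "\<bar>\<dots>\<bar> \<le> 2 * real R * (2 ^ m * h m) + (real d - 1) * (2 ^ (m+1) * h m)"
          by (rule order_trans[OF abs_triangle_ineq4 add_mono[OF SS rest]])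
        also have "\<dots> = 2 ^ m * ((2 * real R + 2 * (real d - 1)) * h m)" by (simp add: algebra_simps)
        finally have xi: "\<bar>x $ i - y $ i\<bar> \<le> (2 * real R + 2 * (real d - 1)) * h m" by simp
        have "norm (x - y) \<le> (\<Sum>k\<in>UNIV. \<bar>x $ k - y $ k\<bar>)"
          using norm_le_l1_cart[of "x - y"] by simp
        also have "\<dots> = \<bar>x $ i - y $ i\<bar> + (\<Sum>k\<in>UNIV-{i}. \<bar>x $ k - y $ k\<bar>)" by (rule sum.remove) auto
        also have "(\<Sum>k\<in>UNIV-{i}. \<bar>x $ k - y $ k\<bar>) \<le> (\<Sum>k\<in>UNIV-{i}. h m)" using near by (intro sum_mono) auto
        also have "\<dots> = (real d - 1) * h m" using d1 by (simp add: d_def card_Diff_singleton)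
        finally have "norm (x - y) \<le> (2 * real R + 2 * (real d - 1)) * h m + (real d - 1) * h m" using xi by simp
        also have "\<dots> \<le> K * h m" using h0[of m] by (simp add: K_def algebra_simps)
        finally show ?thesis .
      qed
    qed
    show "summable (\<lambda>m. K2 * (2 powr e) ^ m)"
      using e by (intro summable_mult summable_geometric) (auto simp: powr_less_one)
    show "real (card (I m)) * (K * h m) powr s \<le> K2 * (2 powr e) ^ m" for m
    proof -
      have "0 \<le> real R / h m" using h0[of m] by simp
      then have G0: "0 \<le> G m" unfolding G_def by linarith
      have P0: "0 \<le> P m" unfolding P_def by simp
      have cardI: "card (I m) = nat (2 * 2 ^ (m+1) + 1) ^ d * (nat (2 * P m + 1) * (d * nat (2 * G m + 1) ^ (d - 1)))"
      proof -
        have sym: "card {- a..a} = nat (2 * a + 1)" for a :: int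
          by (simp only: card_atLeastAtMost_int)
        have a1: "card (PiE (UNIV::'n set) (\<lambda>_. {-(2^(m+1))..(2::int)^(m+1)})) = nat (2 * 2 ^ (m+1) + 1) ^ d"
          unfolding card_PiE[OF finite] sym d_def by (rule prod_constant)
        have "card (PiE (UNIV-{i}) (\<lambda>_. {- G m..G m})) = nat (2 * G m + 1) ^ (d - 1)" for i :: 'n
          unfolding card_PiE[OF finite] sym d_def by (simp only: prod_constant card_Diff_singleton UNIV_I)
        then have a3: "card (SIGMA i : (UNIV::'n set). PiE (UNIV-{i}) (\<lambda>_. {- G m..G m})) = d * nat (2 * G m + 1) ^ (d - 1)"
          by (subst card_SigmaI) (auto intro!: finite_PiE simp: d_def)
        show ?thesis unfolding I_def card_cartesian_product a1 a3 sym ..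
      qed
      have c1: "real (nat (2 * 2 ^ (m+1) + 1)) \<le> 5 * 2 ^ m"
        by (simp add: nat_add_distrib nat_mult_distrib nat_power_eq)
      have c2: "real (nat (2 * P m + 1)) \<le> 2 ^ m * (2 * (2 * real d * real R + real R + 1) + 1)"
      proof -
        have "real (nat (2 * P m + 1)) = 2 * (2 ^ m * (2 * real d * real R + real R + 1)) + 1"
          using P0 by (simp add: P_def)
        also have "\<dots> \<le> 2 * (2 ^ m * (2 * real d * real R + real R + 1)) + 2 ^ m" by simp
        finally show ?thesis by (simp add: algebra_simps)
      qed
      have c3: "real (nat (2 * G m + 1)) \<le> (2 * real R + 5) / h m"
      proof -
        have "real (nat (2 * G m + 1)) = 2 * of_int (G m) + 1" using G0 by simp
        also have "real_of_int (G m) \<le> real R / h m + 2" unfolding G_def by linarith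
        also have "2 * (real R / h m + 2) + 1 = 2 * real R / h m + 5" by simp
        also have "\<dots> \<le> 2 * real R / h m + 5 / h m" using h0[of m] h1[of m] by (simp add: field_simps)
        finally show ?thesis by (simp add: add_divide_distrib)
      qed
      have "real (card (I m)) = real (nat (2 * 2 ^ (m+1) + 1)) ^ d * (real (nat (2 * P m + 1)) * (real d * real (nat (2 * G m + 1)) ^ (d - 1)))"
        unfolding cardI by simp
      also have "\<dots> \<le> (5 * 2 ^ m) ^ d * ((2 ^ m * (2 * (2 * real d * real R + real R + 1) + 1)) * (real d * ((2 * real R + 5) / h m) ^ (d - 1)))"
        using h0[of m] by (intro mult_mono power_mono c1 c2 c3) auto
      finally have "real (card (I m)) * (K * h m) powr s \<le>
         (5 * 2 ^ m) ^ d * ((2 ^ m * (2 * (2 * real d * real R + real R + 1) + 1)) * (real d * ((2 * real R + 5) / h m) ^ (d - 1))) * (K * h m) powr s"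
        by (intro mult_right_mono) auto
      also have "\<dots> = K2 * ((2 ^ m) ^ d * 2 ^ m * (1 / h m) ^ (d - 1) * h m powr s)"
        unfolding K2_def using K0 h0[of m] by (simp add: power_mult_distrib power_divide powr_mult)
      also have "(2 ^ m) ^ d * 2 ^ m * (1 / h m) ^ (d - 1) * h m powr s = (2 powr e) ^ m"
      proof -
        have p2: "(2::real) ^ m = 2 powr real m" by (simp add: powr_realpow)
        have hm: "h m = 2 powr (- \<sigma> * real m)" unfolding h_def p2 by (simp add: powr_powr mult.commute)
        have hp: "(1 / h m) ^ (d - 1) = 2 powr (\<sigma> * real m * (real d - 1))"
        proof -
          have "1 / h m = 2 powr (\<sigma> * real m)" unfolding hm by (simp add: powr_minus_divide)
          then have "(1 / h m) ^ (d - 1) = 2 powr (\<sigma> * real m * real (d - 1))"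
            by (simp add: powr_power mult.commute)
          then show ?thesis using d1 by (simp add: of_nat_diff)
        qed
        have "(2 ^ m) ^ d * 2 ^ m * (1 / h m) ^ (d - 1) * h m powr s
           = 2 powr (real m * real d) * 2 powr real m * 2 powr (\<sigma> * real m * (real d - 1)) * 2 powr (- \<sigma> * real m * s)"
          unfolding hp unfolding hm p2 by (simp add: powr_power powr_powr mult.commute)
        also have "\<dots> = 2 powr (e * real m)"
          unfolding powr_add[symmetric] by (simp add: e_def algebra_simps)
        also have "\<dots> = (2 powr e) ^ m" by (simp add: powr_power mult.commute)
        finally show ?thesis .
      qed
      finally show ?thesis .
    qed
    show "\<exists>m\<ge>m0. \<exists>j\<in>I m. \<alpha> \<in> U m j" if \<alpha>: "\<alpha> \<in> slab_limsup \<eta> R" for \<alpha> m0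
    proof -
      obtain m c p i where m: "m0 \<le> m" and c: "\<And>i. \<bar>c i\<bar> \<le> 2 ^ (m+1)" and i: "2 ^ m \<le> \<bar>c i\<bar>"
        and p: "\<bar>(\<Sum>i\<in>UNIV. of_int (c i) * \<alpha> $ i) - of_int p\<bar> \<le> real R * (2 ^ m * h m)"
        using \<alpha> unfolding slab_limsup_def h2 by blast
      have \<alpha>R: "\<bar>\<alpha> $ i\<bar> \<le> real R" for i using \<alpha> by (simp add: slab_limsup_def)
      define g where "g = restrict (\<lambda>j. \<lfloor>\<alpha> $ j / h m\<rfloor>) (UNIV - {i})"
      have "(c, p, i, g) \<in> I m"
        unfolding I_def
      proof (intro SigmaI)
        show "c \<in> (\<Pi>\<^sub>E _\<in>UNIV. {- (2 ^ (m + 1))..2 ^ (m + 1)})" using c by (auto simp: abs_le_iff minus_le_iff)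
        have "\<bar>\<Sum>i\<in>UNIV. of_int (c i) * \<alpha> $ i\<bar> \<le> (\<Sum>i\<in>(UNIV::'n set). 2 ^ (m+1) * real R)"
        proof (intro order_trans[OF sum_abs] sum_mono)
          fix k
          have "real_of_int \<bar>c k\<bar> \<le> real_of_int (2 ^ (m+1))" using c[of k] by (simp only: of_int_le_iff)
          then show "\<bar>of_int (c k) * \<alpha> $ k\<bar> \<le> 2 ^ (m+1) * real R"
            unfolding abs_mult using \<alpha>R[of k] by (intro mult_mono) auto
        qed
        then have a: "\<bar>\<Sum>i\<in>UNIV. of_int (c i) * \<alpha> $ i\<bar> \<le> real d * (2 ^ (m+1) * real R)" by (simp add: d_def)
        have b: "real R * (2 ^ m * h m) \<le> real R * (2 ^ m * 1)" using h1[of m] by (intro mult_left_mono) auto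
        have "\<bar>real_of_int p\<bar> \<le> \<bar>(\<Sum>i\<in>UNIV. of_int (c i) * \<alpha> $ i) - of_int p\<bar> + \<bar>\<Sum>i\<in>UNIV. of_int (c i) * \<alpha> $ i\<bar>" by linarith
        also have "\<dots> \<le> real R * (2 ^ m * 1) + real d * (2 ^ (m+1) * real R)" using a b p by linarith
        also have "\<dots> \<le> real_of_int (P m)" by (simp add: P_def algebra_simps)
        finally have "\<bar>p\<bar> \<le> P m" by (simp only: of_int_abs[symmetric] of_int_le_iff)
        then show "p \<in> {- P m..P m}" by (auto simp: abs_le_iff)
        show "g \<in> (\<Pi>\<^sub>E _\<in>UNIV - {i}. {- G m..G m})"
        proof (rule PiE_I)
          fix k assume k: "k \<in> UNIV - {i}"
          have "\<bar>\<alpha> $ k / h m\<bar> \<le> real R / h m" using \<alpha>R[of k] h0[of m] by (simp add: abs_divide divide_right_mono)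
          then have "\<lfloor>\<alpha> $ k / h m\<rfloor> \<in> {- G m..G m}" unfolding G_def atLeastAtMost_iff by linarith
          then show "g k \<in> {- G m..G m}" using k by (simp add: g_def)
        qed (simp add: g_def)
      qed auto
      moreover have "\<alpha> \<in> U m (c, p, i, g)" using \<alpha>R i p by (auto simp: U_def g_def)
      ultimately show ?thesis using m by blast
    qed
  qed
qed

lemma hausdorff_dim_compl_Dset_le:
  assumes \<eta>: "0 < \<eta>" "\<eta> \<le> 1"
  shows "hausdorff_dim (- Dset \<eta> \<inter> Kset :: (real^'n::finite) set)
    \<le> ereal (real CARD('n) - 1 + (real CARD('n) + 1) * \<eta> / (1 + \<eta>))"
proof (rule hausdorff_dim_le)
  have "1 \<le> real CARD('n)" using zero_less_card_finite[where 'a='n] by linarith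
  then show "0 \<le> real CARD('n) - 1 + (real CARD('n) + 1) * \<eta> / (1 + \<eta>)"
    using \<eta> by (intro add_nonneg_nonneg) auto
  fix s assume "real CARD('n) - 1 + (real CARD('n) + 1) * \<eta> / (1 + \<eta>) < s"
  then have "hausdorff_measure s (\<Union>R. slab_limsup \<eta> R :: (real^'n) set) = 0"
    by (intro hausdorff_measure_UN_eq_0 hausdorff_measure_slab_limsup \<eta>)
  then show "hausdorff_measure s (- Dset \<eta> \<inter> Kset :: (real^'n) set) = 0"
    using compl_Dset_subset_slab_limsup[OF \<eta>] by (rule hausdorff_measure_mono_0)
qed

subsection \<open>Non-density criterion and reduced fractions\<close>

lemma finite_bounded_integer_vectors:
  "finite {p :: real^'n::finite. \<forall>i. p $ i \<in> \<int> \<and> \<bar>p $ i\<bar> \<le> real B}"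
proof (rule finite_subset)
  show "{p :: real^'n. \<forall>i. p $ i \<in> \<int> \<and> \<bar>p $ i\<bar> \<le> real B} \<subseteq>
     (\<lambda>f. \<chi> i. of_int (f i)) ` PiE (UNIV :: 'n set) (\<lambda>_. {-int B..int B})"
  proof
    fix p :: "real^'n" assume p: "p \<in> {p. \<forall>i. p $ i \<in> \<int> \<and> \<bar>p $ i\<bar> \<le> real B}"
    have e: "of_int \<lfloor>p $ i\<rfloor> = p $ i" for i using p by (auto elim: Ints_cases)
    have "\<lfloor>p $ i\<rfloor> \<in> {-int B..int B}" for i
    proof -
      have "\<bar>real_of_int \<lfloor>p $ i\<rfloor>\<bar> \<le> real B" unfolding e using p by simp
      then show ?thesis by (simp add: abs_le_iff)
    qed
    then have "(\<lambda>i. \<lfloor>p $ i\<rfloor>) \<in> PiE (UNIV :: 'n set) (\<lambda>_. {-int B..int B})" by auto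
    moreover have "p = (\<chi> i. of_int \<lfloor>p $ i\<rfloor>)" by (simp add: vec_eq_iff e)
    ultimately show "p \<in> (\<lambda>f. \<chi> i. of_int (f i)) ` PiE (UNIV :: 'n set) (\<lambda>_. {-int B..int B})"
      by (intro image_eqI[where x = "\<lambda>i. \<lfloor>p $ i\<rfloor>"])
  qed
  show "finite ((\<lambda>f. \<chi> i. real_of_int (f i)) ` PiE (UNIV :: 'n set) (\<lambda>_. {-int B..int B}))"
    by (intro finite_imageI finite_PiE) auto
qed

text \<open>The integer \<open>q p\<^sub>0 - b P\<close> of the proof has absolute value less than 1, hence vanishes; this
  keeps the points \<open>|q|\<^sup>\<eta>(q\<alpha> - p)\<close> away from the all-one vector.\<close>

lemma not_in_DsetI:
  fixes \<alpha> :: "real^'n::finite" and q0 :: nat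
  assumes \<eta>: "0 < \<eta>"
    and crit: "\<And>q::nat. q0 \<le> q \<Longrightarrow> \<exists>l (b::int) (p::int). 0 < b \<and> of_int b \<le> real q powr \<eta> / 4 \<and>
       \<bar>\<alpha> $ l - of_int p / of_int b\<bar> \<le> real q powr (-(1+\<eta>)) / 4"
  shows "\<alpha> \<notin> Dset \<eta>"
proof
  assume "\<alpha> \<in> Dset \<eta>"
  define x :: "real^'n" where "x = (\<chi> i. 1)"
  have "x islimpt NA \<eta> \<alpha>" using \<open>\<alpha> \<in> Dset \<eta>\<close> by (auto simp: Dset_def accA_def)
  then have inf: "infinite (NA \<eta> \<alpha> \<inter> ball x (1/2))" unfolding islimpt_eq_infinite_ball by simp
  \<comment> \<open>For |q| < q0 and a point in the ball, |p i| \<le> |q \<alpha> i| + 3/2. Hence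
    only finitely many points remain, against an accumulation at x.\<close>
  define B where "B = nat \<lceil>real q0 * norm \<alpha> + 2\<rceil>"
  have B: "real q0 * norm \<alpha> + 2 \<le> real B" unfolding B_def by linarith
  have "NA \<eta> \<alpha> \<inter> ball x (1/2) \<subseteq> (\<lambda>(q, p). (\<bar>real_of_int q\<bar> powr \<eta>) *\<^sub>R (of_int q *\<^sub>R \<alpha> - p)) `
     ({-int q0..int q0} \<times> {p. \<forall>i. p $ i \<in> \<int> \<and> \<bar>p $ i\<bar> \<le> real B})"
  proof
    fix v assume v: "v \<in> NA \<eta> \<alpha> \<inter> ball x (1/2)"
    then obtain q p where veq: "v = (\<bar>real_of_int q\<bar> powr \<eta>) *\<^sub>R (of_int q *\<^sub>R \<alpha> - p)"
      and q0: "q \<noteq> 0" and p: "\<And>i. p $ i \<in> \<int>" unfolding NA_def by blast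
    have vi: "\<bar>v $ i - 1\<bar> < 1/2" for i
      using v component_le_norm_cart[of "v - x" i] by (simp add: x_def dist_norm norm_minus_commute)
    define n where "n = nat \<bar>q\<bar>"
    have n: "real n = \<bar>real_of_int q\<bar>" "1 \<le> n" using q0 by (auto simp: n_def)
    have n\<eta>: "1 \<le> real n powr \<eta>" using n \<eta> by (intro ge_one_powr_ge_zero) auto
    have vi': "v $ i = real n powr \<eta> * (of_int q * \<alpha> $ i - p $ i)" for i by (simp add: veq n)
    have "n < q0"
    proof (rule ccontr)
      assume "\<not> n < q0"
      then obtain l b p0 where b: "0 < b" "of_int b \<le> real n powr \<eta> / 4"
         "\<bar>\<alpha> $ l - of_int p0 / of_int b\<bar> \<le> real n powr (-(1+\<eta>)) / 4" using crit[of n] by auto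
      obtain P where P: "p $ l = of_int P" using p[of l] by (auto elim: Ints_cases)
      define u where "u = of_int b * real n powr (-\<eta>)"
      have u: "0 < u" "u \<le> 1/4"
      proof -
        show "0 < u" using b n by (simp add: u_def)
        have "u \<le> real n powr \<eta> / 4 * real n powr (-\<eta>)" unfolding u_def using b by (intro mult_right_mono) auto
        also have "\<dots> = 1/4" using n by (simp add: powr_minus_divide)
        finally show "u \<le> 1/4" .
      qed
      define t where "t = of_int b * (of_int q * \<alpha> $ l - of_int P)"
      have t: "t = u * v $ l" using n by (simp add: t_def u_def vi' P powr_minus_divide)
      define z where "z = of_int q * (of_int b * \<alpha> $ l - of_int p0)"
      have z: "\<bar>z\<bar> \<le> u / 4"
      proof -
        have "of_int b * \<alpha> $ l - of_int p0 = of_int b * (\<alpha> $ l - of_int p0 / of_int b)" using b by (simp add: field_simps)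
        then have "\<bar>z\<bar> = real n * (of_int b * \<bar>\<alpha> $ l - of_int p0 / of_int b\<bar>)"
          using b by (simp add: z_def abs_mult n)
        also have "\<dots> \<le> real n * (of_int b * (real n powr (-(1+\<eta>)) / 4))"
          using b by (intro mult_left_mono) auto
        also have "real n powr (-(1+\<eta>)) = real n powr (-\<eta>) / real n"
          using n(2) by (simp add: powr_diff powr_minus_divide)
        also have "real n * (of_int b * (real n powr (-\<eta>) / real n / 4)) = u / 4" using n(2) by (simp add: u_def)
        finally show ?thesis .
      qed
      \<comment> \<open>Here t lies in (u/2, 3u/2) because v $ l is within 1/2 of 1, and |z| \<le>
        u/4 with u \<le> 1/4. So the integer t - z has absolute value below 1, while t = z is
        excluded by the two ranges.\<close>
      have "of_int (q * p0 - b * P) = t - z" by (simp add: t_def z_def algebra_simps)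
      moreover have tt: "u / 2 < t" "t < 3 / 2 * u"
      proof -
        have "1/2 < v $ l" "v $ l < 3/2" using vi[of l] by (simp_all only: abs_less_iff) linarith+
        then have "u * (1/2) < u * v $ l" "u * v $ l < u * (3/2)" using u by (intro mult_strict_left_mono; simp)+
        then show "u / 2 < t" "t < 3 / 2 * u" unfolding t by (simp_all only: mult.commute[of u] times_divide_eq_left times_divide_eq_right mult_1_left mult_1_right)
      qed
      ultimately have "\<bar>real_of_int (q * p0 - b * P)\<bar> < 1" using z u by linarith
      then have "q * p0 - b * P = 0" by linarith
      then have "t = z" using \<open>of_int (q * p0 - b * P) = t - z\<close> by simp
      then show False using z tt u by linarith
    qed
    then have "q \<in> {-int q0..int q0}" by (auto simp: n_def)
    moreover have "\<bar>p $ i\<bar> \<le> real B" for i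
    proof -
      have "\<bar>of_int q * \<alpha> $ i - p $ i\<bar> \<le> real n powr \<eta> * \<bar>of_int q * \<alpha> $ i - p $ i\<bar>"
        using mult_right_mono[OF n\<eta>, of "\<bar>of_int q * \<alpha> $ i - p $ i\<bar>"] by simp
      also have "\<dots> = \<bar>v $ i\<bar>" by (simp add: vi' abs_mult)
      finally have "\<bar>of_int q * \<alpha> $ i - p $ i\<bar> \<le> 3/2" using vi[of i] by linarith
      moreover have "\<bar>of_int q * \<alpha> $ i\<bar> \<le> real q0 * norm \<alpha>"
        unfolding abs_mult using \<open>n < q0\<close> n component_le_norm_cart[of \<alpha> i] by (intro mult_mono) auto
      ultimately show ?thesis using B by linarith
    qed
    ultimately show "v \<in> (\<lambda>(q, p). (\<bar>real_of_int q\<bar> powr \<eta>) *\<^sub>R (of_int q *\<^sub>R \<alpha> - p)) `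
     ({-int q0..int q0} \<times> {p. \<forall>i. p $ i \<in> \<int> \<and> \<bar>p $ i\<bar> \<le> real B})"
      unfolding veq using p by (intro image_eqI[where x = "(q, p)"]) auto
  qed
  moreover have "finite ((\<lambda>(q, p). (\<bar>real_of_int q\<bar> powr \<eta>) *\<^sub>R (of_int q *\<^sub>R \<alpha> - p)) `
     ({-int q0..int q0} \<times> {p. \<forall>i. p $ i \<in> \<int> \<and> \<bar>p $ i\<bar> \<le> real B}))"
    by (intro finite_imageI finite_cartesian_product finite_bounded_integer_vectors) auto
  ultimately show False using inf finite_subset by blast
qed

section \<open>Counting reduced fractions in short intervals\<close>

lemma length_le_sum_cover:
  fixes a b :: real and c \<rho> :: "'i \<Rightarrow> real"
  assumes "finite T" "{a..b} \<subseteq> (\<Union>t\<in>T. {c t - \<rho> t..c t + \<rho> t})" "\<And>t. t \<in> T \<Longrightarrow> 0 \<le> \<rho> t" "a \<le> b"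
  shows "b - a \<le> (\<Sum>t\<in>T. 2 * \<rho> t)"
proof -
  have "ennreal (b - a) = emeasure lborel {a..b}" using assms by simp
  also have "\<dots> \<le> emeasure lborel (\<Union>t\<in>T. {c t - \<rho> t..c t + \<rho> t})"
    using assms by (intro emeasure_mono) auto
  also have "\<dots> \<le> (\<Sum>t\<in>T. emeasure lborel {c t - \<rho> t..c t + \<rho> t})"
    using assms by (intro emeasure_subadditive_finite) auto
  also have "\<dots> = (\<Sum>t\<in>T. ennreal (2 * \<rho> t))"
    using assms by (intro sum.cong refl) (subst emeasure_lborel_Icc, auto)
  also have "\<dots> = ennreal (\<Sum>t\<in>T. 2 * \<rho> t)" using assms by (intro sum_ennreal) auto
  finally show ?thesis using assms by (subst (asm) ennreal_le_iff) (auto intro: sum_nonneg)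
qed

text \<open>The upper bound on the denominators separates the fractions by 1/X^2; the lower bound
  makes the denominators grow along the tree, which excludes rational relations.\<close>

definition reduced_fractions :: "nat \<Rightarrow> real set" where
  "reduced_fractions X = {of_int p / of_int b | p b :: int. coprime p b \<and> 0 < b \<and> int X < 8 * b \<and> b \<le> int X}"

text \<open>By Dirichlet, the balls of radius \<open>1/(qX)\<close> around the fractions with denominators \<open>q \<le> X\<close>
  cover the line, and those with \<open>q \<le> X/8\<close> only contribute a quarter of the length.\<close>

lemma many_reduced_fractions:
  assumes w: "0 < w"
  shows "\<forall>\<^sub>F X in sequentially. \<forall>r. \<exists>S \<subseteq> reduced_fractions X \<inter> {r - 3/4*w..r + 3/4*w}.
     finite S \<and> w * real X ^ 2 / 32 \<le> real (card S)"
proof -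
  have "((\<lambda>X::nat. 6 * (ln (real X) + 1) / real X) \<longlongrightarrow> 0) sequentially" by real_asymp
  from order_tendstoD(2)[OF this, of "w/4"] w
  have ev1: "\<forall>\<^sub>F X::nat in sequentially. 6 * (ln (real X) + 1) / real X < w / 4" by simp
  have "((\<lambda>X::nat. 8 / real X ^ 2) \<longlongrightarrow> 0) sequentially" by real_asymp
  from order_tendstoD(2)[OF this, of "w/4"] w
  \<comment> \<open>A fraction within 8/X^2 < w/4 of a point of [r - w/2, r + w/2] then lies in the
    wider interval of the statement.\<close>
  have ev2: "\<forall>\<^sub>F X::nat in sequentially. 8 / real X ^ 2 < w / 4" by simp
  from ev1 ev2 eventually_ge_at_top[of 8]
  show ?thesis
  proof eventually_elim
    case (elim X)
    show ?case
    proof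
      fix r :: real
      \<comment> \<open>The numerators p with |q \<theta> - p| \<le> 1 for some \<theta> of the
        interval lie here; there are at most q w + 3 of them.\<close>
      define Num where "Num q = {\<lceil>real q * (r - w/2) - 1\<rceil>..\<lfloor>real q * (r + w/2) + 1\<rfloor>}" for q :: nat
      define S where "S = reduced_fractions X \<inter> {r - 3/4*w..r + 3/4*w}"
      define T1 where "T1 = (SIGMA q : {1..X div 8}. Num q)"
      have "S \<subseteq> (\<lambda>(p, b). of_int p / of_int b) ` ({\<lfloor>- real X * (\<bar>r\<bar> + w)\<rfloor>..\<lceil>real X * (\<bar>r\<bar> + w)\<rceil>} \<times> {1..int X})"
      proof
        fix x assume x: "x \<in> S"
        then obtain p b where pb: "x = of_int p / of_int b" "0 < b" "b \<le> int X"
          unfolding S_def reduced_fractions_def by blast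
        have "\<bar>x\<bar> \<le> \<bar>r\<bar> + w" using x w by (auto simp: S_def abs_le_iff)
        then have "\<bar>real_of_int p\<bar> \<le> of_int b * (\<bar>r\<bar> + w)" using pb by (simp add: abs_divide field_simps)
        also have "\<dots> \<le> real X * (\<bar>r\<bar> + w)" using pb w by (intro mult_right_mono) auto
        finally have "\<bar>real_of_int p\<bar> \<le> real X * (\<bar>r\<bar> + w)" .
        then have "p \<in> {\<lfloor>- real X * (\<bar>r\<bar> + w)\<rfloor>..\<lceil>real X * (\<bar>r\<bar> + w)\<rceil>}"
          unfolding atLeastAtMost_iff mult_minus_left by linarith
        then show "x \<in> (\<lambda>(p, b). of_int p / of_int b) ` ({\<lfloor>- real X * (\<bar>r\<bar> + w)\<rfloor>..\<lceil>real X * (\<bar>r\<bar> + w)\<rceil>} \<times> {1..int X})"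
          using pb by (intro image_eqI[where x = "(p, b)"]) auto
      qed
      then have finS: "finite S" by (rule finite_subset) auto
      \<comment> \<open>The sum type keeps apart the fractions to be counted, each with radius
        8/X^2, and the pairs (q, p) with q \<le> X/8, where one fraction may occur
        repeatedly.\<close>
      define c where "c = case_sum (\<lambda>x. x) (\<lambda>(q::nat, p::int). of_int p / real q)"
      define \<rho> where "\<rho> = case_sum (\<lambda>x::real. 8 / real X ^ 2) (\<lambda>(q::nat, p::int). 1 / (real q * real X))"
      have finT: "finite (S <+> T1)" using finS by (auto simp: T1_def Num_def)
      have cov: "{r - w/2..r + w/2} \<subseteq> (\<Union>t\<in>S <+> T1. {c t - \<rho> t..c t + \<rho> t})"
      proof
        fix \<theta> assume \<theta>: "\<theta> \<in> {r - w/2..r + w/2}"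
        obtain p k :: int where pk: "coprime p k" "0 < k" "k \<le> int X" "\<bar>of_int k * \<theta> - of_int p\<bar> < 1 / real X"
          using Dirichlet_approx_coprime[of X \<theta>] elim by (metis gr0I not_numeral_le_zero)
        have near: "\<bar>\<theta> - of_int p / of_int k\<bar> \<le> 1 / (of_int k * real X)"
        proof -
          have "\<theta> - of_int p / of_int k = (of_int k * \<theta> - of_int p) / of_int k" using pk by (simp add: field_simps)
          then have "\<bar>\<theta> - of_int p / of_int k\<bar> = \<bar>of_int k * \<theta> - of_int p\<bar> / of_int k" using pk by (simp add: abs_divide)
          also have "\<dots> \<le> (1 / real X) / of_int k" using pk by (intro divide_right_mono) auto
          finally show ?thesis by (simp add: mult.commute)
        qed
        show "\<theta> \<in> (\<Union>t\<in>S <+> T1. {c t - \<rho> t..c t + \<rho> t})"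
        proof (cases "int X < 8 * k")
          case True
          have "1 / (of_int k * real X) \<le> 1 / (real X / 8 * real X)"
          proof (intro divide_left_mono mult_right_mono)
            have "real_of_int (int X) < real_of_int (8 * k)" using True by (simp only: of_int_less_iff)
            then show "real X / 8 \<le> of_int k" by simp
          qed (use elim pk in auto)
          then have n2: "\<bar>\<theta> - of_int p / of_int k\<bar> \<le> 8 / real X ^ 2" using near by (simp add: power2_eq_square)
          have "of_int p / of_int k \<in> reduced_fractions X"
            unfolding reduced_fractions_def using pk(1-3) True by blast
          then have "of_int p / of_int k \<in> S"
            unfolding S_def using n2 \<theta> elim by (auto simp: abs_le_iff)
          then show ?thesis using n2
            by (intro UN_I[of "Inl (of_int p / of_int k)"]) (auto simp: c_def \<rho>_def abs_le_iff)
        next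
          case False
          have k: "real (nat k) = of_int k" using pk by simp
          have "1 / real X \<le> 1" using elim by simp
          then have "\<bar>of_int k * \<theta> - of_int p\<bar> \<le> 1" using pk by linarith
          moreover have "of_int k * (r - w/2) \<le> of_int k * \<theta>" "of_int k * \<theta> \<le> of_int k * (r + w/2)"
            using \<theta> pk by (auto intro!: mult_left_mono)
          ultimately have "p \<in> Num (nat k)" unfolding Num_def k atLeastAtMost_iff by linarith
          moreover have "nat k \<in> {1..X div 8}" using False pk by auto
          ultimately have "(nat k, p) \<in> T1" by (simp add: T1_def)
          then show ?thesis using near
            by (intro UN_I[of "Inr (nat k, p)"]) (auto simp: c_def \<rho>_def k abs_le_iff)
        qed
      qed
      have "w = (r + w/2) - (r - w/2)" by simp
      also have "\<dots> \<le> (\<Sum>t\<in>S <+> T1. 2 * \<rho> t)"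
        using w by (intro length_le_sum_cover[OF finT cov]) (auto simp: \<rho>_def split: sum.splits)
      also have "\<dots> = (\<Sum>x\<in>S. 16 / real X ^ 2) + (\<Sum>(q, p)\<in>T1. 2 / (real q * real X))"
        using finS finT unfolding finite_Plus_iff
        by (subst sum.Plus) (auto simp: \<rho>_def intro!: sum.cong split: prod.splits)
      also have "(\<Sum>(q, p)\<in>T1. 2 / (real q * real X)) = (\<Sum>q\<in>{1..X div 8}. real (card (Num q)) * (2 / (real q * real X)))"
        unfolding T1_def by (subst sum.Sigma[symmetric]) (auto simp: Num_def)
      \<comment> \<open>The main term contributes at most w/4 and the harmonic sum is below w/4 for
        large X, so the counted fractions have to cover at least w/2 with intervals of length
        16/X^2.\<close>
      also have "\<dots> \<le> (\<Sum>q\<in>{1..X div 8}. (2 * w / real X + 6 / real X * (1 / real q)))"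
      proof (rule sum_mono)
        fix q assume q: "q \<in> {1..X div 8}"
        have "real (card (Num q)) \<le> real q * w + 3"
        proof -
          have "0 \<le> real q * w" using w by simp
          moreover have "real q * (r + w/2) + 1 - (real q * (r - w/2) - 1) = real q * w + 2" by (simp add: algebra_simps)
          ultimately show ?thesis unfolding Num_def card_atLeastAtMost_int by linarith
        qed
        then have "real (card (Num q)) * (2 / (real q * real X)) \<le> (real q * w + 3) * (2 / (real q * real X))"
          by (intro mult_right_mono) auto
        also have "\<dots> = 2 * w / real X + 6 / real X * (1 / real q)" using q elim by (simp add: field_simps)
        finally show "real (card (Num q)) * (2 / (real q * real X)) \<le> 2 * w / real X + 6 / real X * (1 / real q)" .
      qed
      also have "\<dots> = real (X div 8) * (2 * w / real X) + 6 / real X * harm (X div 8)"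
        by (simp add: sum.distrib sum_distrib_left harm_def inverse_eq_divide)
      also have "\<dots> \<le> w / 4 + w / 4"
      proof (rule add_mono)
        have "real (X div 8) \<le> real X / 8" by linarith
        then have "real (X div 8) * (2 * w / real X) \<le> real X / 8 * (2 * w / real X)" using w by (intro mult_right_mono) auto
        also have "\<dots> = w / 4" using elim by simp
        finally show "real (X div 8) * (2 * w / real X) \<le> w / 4" .
        have X8: "0 < X div 8" "X div 8 \<le> X" using elim by auto
        have "harm (X div 8) \<le> ln (real (X div 8)) + 1" 
          using decseqD[OF decseq_harm_diff_ln, of 0 "X div 8 - 1"] X8(1)
          by (simp add: harm_Suc harm_def)
        also have "ln (real (X div 8)) \<le> ln (real X)" using X8 by (subst ln_le_cancel_iff) auto
        finally have "6 / real X * harm (X div 8) \<le> 6 / real X * (ln (real X) + 1)" by (intro mult_left_mono) auto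
        also have "\<dots> = 6 * (ln (real X) + 1) / real X" by simp
        also have "\<dots> \<le> w / 4" using elim(1) by (rule less_imp_le)
        finally show "6 / real X * harm (X div 8) \<le> w / 4" .
      qed
      finally have "w \<le> real (card S) * (16 / real X ^ 2) + w / 2" by simp
      then have "w / 2 \<le> real (card S) * (16 / real X ^ 2)" by simp
      then have "w / 2 * real X ^ 2 \<le> real (card S) * (16 / real X ^ 2) * real X ^ 2" by (rule mult_right_mono) auto
      also have "\<dots> = real (card S) * 16" using elim by simp
      finally have "w * real X ^ 2 / 32 \<le> real (card S)" by simp
      then show "\<exists>S \<subseteq> reduced_fractions X \<inter> {r - 3/4*w..r + 3/4*w}. finite S \<and> w * real X ^ 2 / 32 \<le> real (card S)"
        using finS by (intro exI[of _ S]) (auto simp: S_def)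
    qed
  qed
qed

subsection \<open>Lower bound\<close>

lemma card_separated_le:
  fixes f :: "'a \<Rightarrow> real"
  assumes "finite A" "0 < \<delta>" "0 \<le> a" "\<And>x. x \<in> A \<Longrightarrow> \<bar>f x - c\<bar> \<le> a"
    and sep: "\<And>x y. x \<in> A \<Longrightarrow> y \<in> A \<Longrightarrow> x \<noteq> y \<Longrightarrow> \<delta> \<le> \<bar>f x - f y\<bar>"
  shows "real (card A) \<le> 1 + 2 * a / \<delta>"
proof -
  define j where "j x = \<lfloor>(f x - c + a) / \<delta>\<rfloor>" for x
  have "inj_on j A"
  proof (rule inj_onI, rule ccontr)
    fix x y assume xy: "x \<in> A" "y \<in> A" "j x = j y" "x \<noteq> y"
    then have "\<bar>(f x - c + a) / \<delta> - (f y - c + a) / \<delta>\<bar> < 1" unfolding j_def by linarith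
    moreover have "(f x - c + a) / \<delta> - (f y - c + a) / \<delta> = (f x - f y) / \<delta>"
      by (simp add: diff_divide_distrib[symmetric])
    ultimately have "\<bar>f x - f y\<bar> < \<delta>" using assms(2) by (simp add: abs_divide)
    with sep[OF xy(1,2,4)] show False by simp
  qed
  then have "card A = card (j ` A)" by (simp add: card_image)
  also have "\<dots> \<le> card {0..\<lfloor>2 * a / \<delta>\<rfloor>}"
  proof (intro card_mono subsetI)
    fix z assume "z \<in> j ` A"
    then obtain x where x: "x \<in> A" "z = j x" by blast
    have "0 \<le> f x - c + a" "f x - c + a \<le> 2 * a" using assms(4)[OF x(1)] by (simp_all add: abs_le_iff)
    then have "0 \<le> (f x - c + a) / \<delta>" "(f x - c + a) / \<delta> \<le> 2 * a / \<delta>"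
      using assms(2) by (auto intro!: divide_right_mono divide_nonneg_nonneg)
    then show "z \<in> {0..\<lfloor>2 * a / \<delta>\<rfloor>}" unfolding x j_def by (auto intro: floor_mono)
  qed auto
  finally have "real (card A) \<le> real (nat (\<lfloor>2 * a / \<delta>\<rfloor> + 1))" by simp
  moreover have "0 \<le> 2 * a / \<delta>" using assms by simp
  ultimately show ?thesis by linarith
qed

lemma reduced_fractions_separated:
  assumes "x \<in> reduced_fractions X" "y \<in> reduced_fractions X" "x \<noteq> y"
  shows "1 / real X ^ 2 \<le> \<bar>x - y\<bar>"
proof -
  obtain p b where x: "x = of_int p / of_int b" "0 < b" "b \<le> int X" using assms(1) by (auto simp: reduced_fractions_def)
  obtain p' b' where y: "y = of_int p' / of_int b'" "0 < b'" "b' \<le> int X" using assms(2) by (auto simp: reduced_fractions_def)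
  have eq: "x - y = of_int (p * b' - p' * b) / of_int (b * b')" 
    unfolding x(1) y(1) using x(2) y(2) by (simp add: diff_frac_eq)
  have "p * b' - p' * b \<noteq> 0"
  proof
    assume "p * b' - p' * b = 0"
    then have "x - y = 0" unfolding eq by (simp only: of_int_0 div_0)
    with assms(3) show False by simp
  qed
  then have "1 \<le> \<bar>p * b' - p' * b\<bar>" by linarith
  then have 1: "1 \<le> \<bar>real_of_int (p * b' - p' * b)\<bar>" by linarith
  have "of_int b * of_int b' \<le> real X * real X" using x y by (intro mult_mono) auto
  then have "1 / real X ^ 2 \<le> 1 / of_int (b * b')" using x y by (intro divide_left_mono) (auto simp: power2_eq_square)
  also have "\<dots> \<le> \<bar>real_of_int (p * b' - p' * b)\<bar> / of_int (b * b')"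
    using 1 x y by (intro divide_right_mono) auto
  also have "\<dots> = \<bar>x - y\<bar>" unfolding eq using x y by (simp add: abs_divide abs_mult)
  finally show ?thesis .
qed

text \<open>This is q^(-(1+\<eta>)) / 4 at q^\<eta> = 4n, the error that \<open>not_in_DsetI\<close>
  allows at the q where denominators up to n become admissible.\<close>

definition tolerance :: "real \<Rightarrow> nat \<Rightarrow> real" where
  "tolerance \<eta> n = (4 * real n) powr (-(1 + 1/\<eta>)) / 4"

text \<open>Level \<open>k + 2\<close> of the tree approximates the coordinate with the parity of \<open>k\<close>, starting from
  its approximation \<open>r\<close> at level \<open>k\<close>, by fractions with denominators at most \<open>X (k + 2)\<close>; the
  \<open>N k\<close> choices are \<open>child k r j\<close>. The error \<open>tolerance \<eta> (X (k + 1))\<close> tolerated at level \<open>k\<close> makes the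
  approximation usable until the other coordinate takes over.\<close>

locale alternating_tree =
  fixes \<eta> s :: real and X N :: "nat \<Rightarrow> nat" and child :: "nat \<Rightarrow> real \<Rightarrow> nat \<Rightarrow> real"
  assumes \<eta>: "0 < \<eta>" "\<eta> < 1/2"
    and s: "0 < s" "s < 1"
    and X1: "1 \<le> X k"
    and grow: "8 * (X k + 1) ^ 2 \<le> X (Suc k)"
    and grow_s: "43008 / real (X (Suc k)) ^ 2 \<le> tolerance \<eta> (X k) ^ 2 * tolerance \<eta> (X (Suc k)) powr s"
    and N: "1 \<le> N k" "tolerance \<eta> (X (Suc k)) * real (X (Suc (Suc k))) ^ 2 / 32 \<le> real (N k)"
    and child_near: "j < N k \<Longrightarrow> \<bar>child k r j - r\<bar> \<le> 3/4 * tolerance \<eta> (X (Suc k))"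
    and child_reduced: "j < N k \<Longrightarrow> child k r j \<in> reduced_fractions (X (Suc (Suc k)))"
    and child_inj: "inj_on (child k r) {..<N k}"
begin

abbreviation h :: "nat \<Rightarrow> real" where "h \<equiv> tolerance \<eta>"

definition w :: "nat \<Rightarrow> real" where "w k = h (X (Suc k))"

definition M :: "(nat \<Rightarrow> nat) measure" where
  "M = PiM UNIV (\<lambda>k. uniform_count_measure {..<N k})"

text \<open>Even and odd levels carry the two coordinates. Levels 0 and 1 hold the placeholder 0;
  fractions of the prescribed denominators begin at level 2.\<close>

fun R :: "(nat \<Rightarrow> nat) \<Rightarrow> nat \<Rightarrow> real" where
  "R \<omega> 0 = 0"
| "R \<omega> (Suc 0) = 0"
| "R \<omega> (Suc (Suc k)) = child k (R \<omega> k) (\<omega> k)"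

text \<open>Only the parity of k matters; admitting every k lets a statement about level k name its
  coordinate without a case distinction.\<close>

definition coord :: "nat \<Rightarrow> (nat \<Rightarrow> nat) \<Rightarrow> real" where
  "coord k \<omega> = lim (\<lambda>j. R \<omega> (2 * j + k mod 2))"

section \<open>Approximations along a branch of the tree\<close>

lemma space_M: "\<omega> \<in> space M \<longleftrightarrow> (\<forall>k. \<omega> k < N k)"
  by (auto simp: M_def space_PiM space_uniform_count_measure PiE_def Pi_def)

lemma prob_space_M: "prob_space M"
  unfolding M_def using N(1) by (intro prob_space_PiM prob_space_uniform_count_measure) (auto simp: lessThan_empty_iff Suc_le_eq)

lemma h_pos: "0 < n \<Longrightarrow> 0 < h n" by (simp add: tolerance_def)

text \<open>Because 1 + 1/\<eta> \<ge> 2, the tolerance stays well below the spacing 1/n^2 of the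
  fractions with denominators up to n; thus sufficiently close points share their fractions.\<close>

lemma h_le: "1 \<le> n \<Longrightarrow> h n \<le> 1 / (64 * real n ^ 2)"
proof -
  assume n: "1 \<le> n"
  have "2 \<le> 1 + 1/\<eta>" using \<eta> by (simp add: field_simps)
  then have "(4 * real n) powr (-(1 + 1/\<eta>)) \<le> (4 * real n) powr (-2)" using n by (intro powr_mono) auto
  also have "\<dots> = 1 / (4 * real n) ^ 2" using n by (simp add: powr_minus_divide powr_realpow)
  finally show ?thesis by (simp add: tolerance_def power_mult_distrib)
qed

lemma h_mono: "1 \<le> m \<Longrightarrow> 4 * m \<le> n \<Longrightarrow> h n \<le> h m / 4"
proof -
  assume mn: "1 \<le> m" "4 * m \<le> n"
  have "0 < 1 + 1/\<eta>" using \<eta> by (simp add: add_pos_pos)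
  then have "(4 * real n) powr (-(1 + 1/\<eta>)) \<le> (4 * (4 * real m)) powr (-(1 + 1/\<eta>))"
    using mn by (intro powr_mono2') auto
  also have "\<dots> = 4 powr (-(1 + 1/\<eta>)) * (4 * real m) powr (-(1 + 1/\<eta>))" using mn by (subst powr_mult) auto
  also have "4 powr (-(1 + 1/\<eta>)) \<le> 4 powr (-1)" using \<eta> by (intro powr_mono) auto
  finally show ?thesis by (simp add: tolerance_def mult_right_mono)
qed

lemma X_Suc: "4 * X k \<le> X (Suc k)" "X k < X (Suc k)"
proof -
  have "8 * (X k + 1) \<le> 8 * (X k + 1) ^ 2" by (simp add: power2_eq_square)
  then have "8 * (X k + 1) \<le> X (Suc k)" using grow[of k] by (rule order_trans)
  then show "4 * X k \<le> X (Suc k)" "X k < X (Suc k)" by auto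
qed

lemma X_ge: "k \<le> X k"
proof (induction k)
  case (Suc k)
  then show ?case using X_Suc(2)[of k] by linarith
qed simp

lemma w_pos: "0 < w k"
  unfolding w_def using X1[of "Suc k"] by (intro h_pos) linarith

lemma w_Suc: "w (Suc k) \<le> w k / 4"
  unfolding w_def by (intro h_mono X1 X_Suc)

lemma w_anti: "i \<le> j \<Longrightarrow> w j \<le> w i"
proof (induction rule: dec_induct)
  case (step n)
  then show ?case using w_Suc[of n] w_pos[of n] by linarith
qed simp

lemma w_le: "w k \<le> 1 / (64 * real (X (Suc k)) ^ 2)"
  unfolding w_def by (intro h_le X1)

lemma w_tendsto: "w \<longlonglongrightarrow> 0"
proof (rule tendsto_sandwich[OF _ _ tendsto_const])
  show "\<forall>\<^sub>F k in sequentially. 0 \<le> w k" using w_pos less_imp_le by (intro always_eventually) auto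
  show "\<forall>\<^sub>F k in sequentially. w k \<le> 1 / (64 * real (Suc k) ^ 2)"
  proof (intro always_eventually allI)
    fix k
    have "1 / (64 * real (X (Suc k)) ^ 2) \<le> 1 / (64 * real (Suc k) ^ 2)"
      using X_ge[of "Suc k"] X1[of "Suc k"] by (intro divide_left_mono mult_left_mono power_mono) auto
    then show "w k \<le> 1 / (64 * real (Suc k) ^ 2)" using w_le[of k] by linarith
  qed
  show "(\<lambda>k. 1 / (64 * real (Suc k) ^ 2)) \<longlonglongrightarrow> 0" by real_asymp
qed

context
  fixes \<omega> assumes \<omega>: "\<omega> \<in> space M"
begin

lemma R_step: "\<bar>R \<omega> (k + 2) - R \<omega> k\<bar> \<le> 3/4 * w k"
  using child_near[of "\<omega> k" k "R \<omega> k"] \<omega> by (simp add: space_M w_def)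

lemma R_reduced: "2 \<le> k \<Longrightarrow> R \<omega> k \<in> reduced_fractions (X k)"
  using child_reduced[of "\<omega> (k - 2)" "k - 2" "R \<omega> (k - 2)"] \<omega>
  by (cases "(\<omega>, k)" rule: R.cases) (auto simp: space_M)

text \<open>One step uses 3/4 of w k, and w (k + 2) \<le> w k / 4 pays for all later steps of the
  same coordinate.\<close>

lemma R_diff: "\<bar>R \<omega> (k + 2 * n) - R \<omega> k\<bar> \<le> w k"
proof (induction n arbitrary: k)
  case (Suc n)
  have "\<bar>R \<omega> (k + 2 + 2 * n) - R \<omega> (k + 2)\<bar> \<le> w (k + 2)" by (rule Suc.IH)
  moreover have "w (k + 2) \<le> w k / 4" using w_Suc[of k] w_Suc[of "Suc k"] w_pos[of "Suc k"] by simp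
  moreover have "k + 2 * Suc n = k + 2 + 2 * n" by simp
  ultimately show ?case using R_step[of k] by (simp only:)
qed (use w_pos[of k] in \<open>simp add: less_imp_le w_pos\<close>)

lemma R_tendsto: "(\<lambda>j. R \<omega> (2 * j + k mod 2)) \<longlonglongrightarrow> coord k \<omega>"
proof -
  have "Cauchy (\<lambda>j. R \<omega> (2 * j + k mod 2))"
  proof (rule metric_CauchyI)
    fix e :: real assume "0 < e"
    then obtain n where n: "w n < e / 2"
      using order_tendstoD(2)[OF w_tendsto, of "e/2"] by (auto simp: eventually_sequentially)
    have b: "\<bar>R \<omega> (2 * j + k mod 2) - R \<omega> (2 * n + k mod 2)\<bar> < e / 2" if "n \<le> j" for j
    proof -
      have "\<bar>R \<omega> ((2 * n + k mod 2) + 2 * (j - n)) - R \<omega> (2 * n + k mod 2)\<bar> \<le> w (2 * n + k mod 2)" by (rule R_diff)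
      moreover have "(2 * n + k mod 2) + 2 * (j - n) = 2 * j + k mod 2" using that by simp
      moreover have "w (2 * n + k mod 2) \<le> w n" by (intro w_anti) auto
      ultimately show ?thesis using n by simp
    qed
    show "\<exists>M. \<forall>m\<ge>M. \<forall>n\<ge>M. dist (R \<omega> (2 * m + k mod 2)) (R \<omega> (2 * n + k mod 2)) < e"
    proof (intro exI[of _ n] allI impI)
      fix i j assume "n \<le> i" "n \<le> j"
      then show "dist (R \<omega> (2 * i + k mod 2)) (R \<omega> (2 * j + k mod 2)) < e"
        using b[of i] b[of j] unfolding dist_real_def by linarith
    qed
  qed
  then show ?thesis unfolding coord_def by (simp add: Cauchy_convergent_iff convergent_LIMSEQ_iff)
qed

lemma coord_near: "\<bar>coord k \<omega> - R \<omega> k\<bar> \<le> w k"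
proof (rule Lim_bounded)
  have "k = 2 * (k div 2) + k mod 2" by simp
  show "(\<lambda>j. \<bar>R \<omega> (2 * j + k mod 2) - R \<omega> k\<bar>) \<longlonglongrightarrow> \<bar>coord k \<omega> - R \<omega> k\<bar>"
    by (intro tendsto_intros R_tendsto)
  show "\<forall>j\<ge>k div 2. \<bar>R \<omega> (2 * j + k mod 2) - R \<omega> k\<bar> \<le> w k"
  proof (intro allI impI)
    fix j assume "k div 2 \<le> j"
    then have "2 * j + k mod 2 = k + 2 * (j - k div 2)" using \<open>k = 2 * (k div 2) + k mod 2\<close> by linarith
    then show "\<bar>R \<omega> (2 * j + k mod 2) - R \<omega> k\<bar> \<le> w k" using R_diff by simp
  qed
qed

lemma coord_mod: "coord (k mod 2) \<omega> = coord k \<omega>"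
  by (simp add: coord_def)

lemma coord_approx:
  "\<exists>q0. \<forall>q::nat. q0 \<le> q \<longrightarrow> (\<exists>k (b::int) (p::int). 0 < b \<and> of_int b \<le> real q powr \<eta> / 4 \<and>
       \<bar>coord k \<omega> - of_int p / of_int b\<bar> \<le> real q powr (-(1+\<eta>)) / 4)"
proof -
  have "filterlim (\<lambda>q::nat. real q powr \<eta> / 4) at_top sequentially" using \<eta> by real_asymp
  then have "\<forall>\<^sub>F q in sequentially. real (X 2) \<le> real q powr \<eta> / 4" by (simp add: filterlim_at_top)
  with eventually_ge_at_top[of 1] have "\<forall>\<^sub>F q in sequentially. real (X 2) \<le> real q powr \<eta> / 4 \<and> 1 \<le> q"
    by eventually_elim auto
  then obtain q0 where q0: "\<And>q. q0 \<le> q \<Longrightarrow> real (X 2) \<le> real q powr \<eta> / 4 \<and> 1 \<le> q" by (auto simp: eventually_sequentially)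
  have "\<exists>k (b::int) (p::int). 0 < b \<and> of_int b \<le> real q powr \<eta> / 4 \<and>
       \<bar>coord k \<omega> - of_int p / of_int b\<bar> \<le> real q powr (-(1+\<eta>)) / 4" if q: "q0 \<le> q" for q
  proof -
    define Y where "Y = real q powr \<eta> / 4"
    define k where "k = (GREATEST k. real (X k) \<le> Y)"
    have bound: "k \<le> nat \<lceil>Y\<rceil>" if "real (X k) \<le> Y" for k
      using X_ge[of k] that by linarith
    have X2: "real (X 2) \<le> Y" using q0[OF q] by (simp add: Y_def)
    have k: "real (X k) \<le> Y" "2 \<le> k"
      unfolding k_def using GreatestI_nat[where P = "\<lambda>k. real (X k) \<le> Y", OF X2 bound]
        Greatest_le_nat[where P = "\<lambda>k. real (X k) \<le> Y", OF X2 bound] by blast+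
    have "\<not> real (X (Suc k)) \<le> Y"
    proof
      assume "real (X (Suc k)) \<le> Y"
      from Greatest_le_nat[where P = "\<lambda>k. real (X k) \<le> Y", OF this bound]
      have "Suc k \<le> k" unfolding k_def[symmetric] by blast
      then show False by simp
    qed
    then have k': "real q powr \<eta> \<le> 4 * real (X (Suc k))" by (simp add: Y_def)
    obtain p b where pb: "R \<omega> k = of_int p / of_int b" "0 < b" "b \<le> int (X k)"
      using R_reduced[OF k(2)] by (auto simp: reduced_fractions_def)
    have q1: "1 \<le> q" using q0[OF q] by simp
    have "w k \<le> real q powr (-(1+\<eta>)) / 4"
    proof -
      have "0 \<le> 1 + 1/\<eta>" using \<eta> by (simp add: add_nonneg_nonneg)
      then have "(4 * real (X (Suc k))) powr (-(1 + 1/\<eta>)) \<le> (real q powr \<eta>) powr (-(1 + 1/\<eta>))"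
        using k' q1 by (intro powr_mono2') auto
      also have "\<dots> = real q powr (-(1+\<eta>))"
      proof -
        have "\<eta> * (-(1 + 1/\<eta>)) = -(1 + \<eta>)" using \<eta> by (simp add: field_simps)
        then show ?thesis by (simp only: powr_powr)
      qed
      finally show ?thesis by (simp add: w_def tolerance_def)
    qed
    then have "\<bar>coord k \<omega> - of_int p / of_int b\<bar> \<le> real q powr (-(1+\<eta>)) / 4" using coord_near[of k] pb by simp
    moreover have "of_int b \<le> real q powr \<eta> / 4"
    proof -
      have "real_of_int b \<le> real (X k)" using pb by linarith
      then show ?thesis using k by (simp add: Y_def)
    qed
    ultimately show ?thesis using pb by blast
  qed
  then show ?thesis by blast
qed

text \<open>A relation would force consecutive approximations to satisfy it exactly, which bounds the
  denominator at level \<open>k + 1\<close> in terms of the one at level \<open>k\<close>.\<close>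

lemma coord_no_relation:
  fixes c0 :: int and c :: "nat \<Rightarrow> int"
  assumes rel: "of_int c0 + of_int (c 0) * coord 0 \<omega> + of_int (c 1) * coord 1 \<omega> = 0"
  shows "c 0 = 0 \<and> c 1 = 0"
proof -
  define H where "H = nat (\<bar>c 0\<bar> + \<bar>c 1\<bar>) + 1"
  have H: "\<bar>c (i mod 2)\<bar> \<le> int H" for i unfolding H_def by (cases "even i") (auto simp: odd_iff_mod_2_eq_one)
  have *: "c (Suc k mod 2) = 0" if k: "2 \<le> k" "H \<le> k" for k
  proof (rule ccontr)
    assume nz: "c (Suc k mod 2) \<noteq> 0"
    define d e where "d = c (k mod 2)" and "e = c (Suc k mod 2)"
    have rel': "of_int c0 + of_int d * coord k \<omega> + of_int e * coord (Suc k) \<omega> = 0"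
    proof (cases "even k")
      case True
      then have "k mod 2 = 0" "Suc k mod 2 = 1" by (auto simp: mod_Suc)
      then show ?thesis using rel coord_mod[of k] coord_mod[of "Suc k"] by (simp add: d_def e_def)
    next
      case False
      then have "k mod 2 = 1" "Suc k mod 2 = 0" by (auto simp: mod_Suc odd_iff_mod_2_eq_one)
      then show ?thesis using rel coord_mod[of k] coord_mod[of "Suc k"] by (simp add: d_def e_def)
    qed
    obtain p b where pb: "R \<omega> k = of_int p / of_int b" "0 < b" "b \<le> int (X k)"
      using R_reduced[OF k(1)] by (auto simp: reduced_fractions_def)
    have "R \<omega> (Suc k) \<in> reduced_fractions (X (Suc k))" using k by (intro R_reduced) auto
    then obtain p' b' where pb': "R \<omega> (Suc k) = of_int p' / of_int b'" "coprime p' b'" "0 < b'" "b' \<le> int (X (Suc k))" "int (X (Suc k)) < 8 * b'"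
      by (auto simp: reduced_fractions_def)
    \<comment> \<open>The relation with both coordinates replaced by their fractions and the
      denominators cleared. The error is of order X(k) / X(k+1)^2 and the denominators multiply it
      by at most X(k) X(k+1), so \<open>grow\<close> brings the integer z below 1.\<close>
    define z where "z = c0 * b * b' + d * p * b' + e * p' * b"
    have XH: "H \<le> X k" using k X_ge[of k] by linarith
    have big: "8 * (real (X k) + 1) ^ 2 \<le> real (X (Suc k))"
    proof -
      have "real (8 * (X k + 1) ^ 2) \<le> real (X (Suc k))" using grow[of k] by (simp only: of_nat_le_iff)
      then show ?thesis by (simp add: add.commute)
    qed
    have "\<bar>of_int z\<bar> < (1::real)"
    proof -
      let ?t = "of_int c0 + of_int d * R \<omega> k + of_int e * R \<omega> (Suc k)"
      have dH: "\<bar>real_of_int d\<bar> \<le> real H" "\<bar>real_of_int e\<bar> \<le> real H"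
        using H[of k] H[of "Suc k"] unfolding d_def e_def by linarith+
      have zt: "of_int z = ?t * (of_int b * of_int b')" unfolding pb pb' z_def using pb pb' by (simp add: field_simps)
      have "?t = - (of_int d * (coord k \<omega> - R \<omega> k) + of_int e * (coord (Suc k) \<omega> - R \<omega> (Suc k)))"
        using rel' by (simp add: algebra_simps)
      then have "\<bar>?t\<bar> \<le> \<bar>of_int d\<bar> * \<bar>coord k \<omega> - R \<omega> k\<bar> + \<bar>of_int e\<bar> * \<bar>coord (Suc k) \<omega> - R \<omega> (Suc k)\<bar>"
        unfolding abs_mult[symmetric] by linarith
      also have "\<dots> \<le> real H * w k + real H * w k"
        using coord_near[of k] coord_near[of "Suc k"] w_anti[of k "Suc k"] dH by (intro add_mono mult_mono) auto
      also have "\<dots> \<le> 2 * real (X k) * (1 / (64 * real (X (Suc k)) ^ 2))"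
        using XH w_le[of k] w_pos[of k] mult_mono[of "real H" "real (X k)" "w k" "1 / (64 * real (X (Suc k)) ^ 2)"] by simp
      finally have t: "\<bar>?t\<bar> \<le> 2 * real (X k) * (1 / (64 * real (X (Suc k)) ^ 2))" .
      have bb: "of_int b * of_int b' \<le> real (X k) * real (X (Suc k))" using pb pb' by (intro mult_mono) auto
      have "\<bar>real_of_int z\<bar> = \<bar>?t\<bar> * (of_int b * of_int b')" unfolding zt using pb pb' by (simp add: abs_mult)
      also have "\<dots> \<le> 2 * real (X k) * (1 / (64 * real (X (Suc k)) ^ 2)) * (real (X k) * real (X (Suc k)))"
        using t bb pb pb' by (intro mult_mono) auto
      also have "\<dots> = real (X k) ^ 2 / (32 * real (X (Suc k)))"
        using X1[of "Suc k"] by (simp add: power2_eq_square field_simps)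
      also have "\<dots> < 1"
      proof -
        have "real (X k) ^ 2 \<le> (real (X k) + 1) ^ 2" by (intro power_mono) auto
        then have "real (X k) ^ 2 < 32 * real (X (Suc k))" using big X1[of "Suc k"] by linarith
        then show ?thesis using X1[of "Suc k"] by simp
      qed
      finally show ?thesis .
    qed
    then have "z = 0" by linarith
    then have "e * b * p' = b' * (- (c0 * b + d * p))" by (simp add: z_def algebra_simps)
    then have "b' dvd e * b * p'" by simp
    \<comment> \<open>Coprimality removes p', so b' \<le> |e| b \<le> X(k)^2, against 8 b' > X(k+1)
      \<ge> 8 (X(k) + 1)^2.\<close>
    then have "b' dvd e * b" using pb'(2) by (simp add: coprime_dvd_mult_left_iff coprime_commute)
    moreover have "e * b \<noteq> 0" using nz pb by (simp add: e_def)
    ultimately have "b' \<le> \<bar>e * b\<bar>" using zdvd_imp_le[of b' "\<bar>e * b\<bar>"] by simp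
    also have "\<dots> = \<bar>e\<bar> * b" using pb by (simp add: abs_mult)
    also have "\<dots> \<le> int (X k) * int (X k)" using H[of "Suc k"] XH pb unfolding e_def by (intro mult_mono) auto
    finally have "real_of_int b' \<le> real_of_int (int (X k) * int (X k))" by (simp only: of_int_le_iff)
    moreover have "real_of_int (int (X (Suc k))) < real_of_int (8 * b')" using pb'(5) by (simp only: of_int_less_iff)
    ultimately have "real (X (Suc k)) < 8 * (real (X k) * real (X k))" by simp
    moreover have "real (X k) * real (X k) \<le> (real (X k) + 1) ^ 2" by (simp add: power2_eq_square algebra_simps)
    ultimately show False using big by linarith
  qed
  \<comment> \<open>Two consecutive levels treat the two parities.\<close>
  have "c (Suc (2 * H + 2) mod 2) = 0" "c (Suc (2 * H + 3) mod 2) = 0" by (intro *; simp)+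
  moreover have "Suc (2 * H + 2) mod 2 = 1" "Suc (2 * H + 3) mod 2 = 0" by presburger+
  ultimately show ?thesis by simp
qed

end

text \<open>Take k with w k \<le> \<rho> < w (k-1). Below level k the fractions of all points of
  \<open>V\<close> agree, since they differ by less than the spacing. It then suffices to count the
  choices for the levels k and k + 1, and \<open>C\<close> is the cylinder that restricts these
  two.\<close>

lemma mass_bound:
  assumes \<rho>: "0 < \<rho>" "\<rho> < w 2" and V: "V \<subseteq> space M"
    and diam: "\<And>\<omega> \<omega>' k. \<omega> \<in> V \<Longrightarrow> \<omega>' \<in> V \<Longrightarrow> \<bar>coord k \<omega> - coord k \<omega>'\<bar> \<le> \<rho>"
  shows "\<exists>C\<in>sets M. V \<subseteq> C \<and> measure M C \<le> 2 * \<rho> powr s"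
proof (cases "V = {}")
  case True
  then show ?thesis by (intro bexI[of _ "{}"]) auto
next
  case False
  then obtain \<omega>0 where \<omega>0: "\<omega>0 \<in> V" by blast
  have \<omega>0M: "\<omega>0 \<in> space M" using \<omega>0 V by blast
  obtain k0 where k0: "w k0 \<le> \<rho>"
    using order_tendstoD(2)[OF w_tendsto \<rho>(1)] by (auto simp: eventually_sequentially intro: less_imp_le)
  define k where "k = (LEAST k. w k \<le> \<rho>)"
  have k: "w k \<le> \<rho>" unfolding k_def by (rule LeastI[of _ k0]) (rule k0)
  \<comment> \<open>Thus i \<ge> 1, so that the parents at levels i and i + 1 are in the range of
    \<open>R_eq\<close>.\<close>
  have "2 < k" using k \<rho>(2) w_anti[of k 2] by (rule_tac ccontr) auto
  define i where "i = k - 2"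
  have i: "1 \<le> i" "k = Suc (Suc i)" using \<open>2 < k\<close> by (auto simp: i_def)
  have \<rho>w: "\<rho> < w (Suc i)"
    using not_less_Least[of "Suc i" "\<lambda>k. w k \<le> \<rho>"] i by (simp add: k_def[symmetric])
  have R_close: "\<bar>R \<omega> j - R \<omega>0 j\<bar> \<le> \<rho> + 2 * w j" if "\<omega> \<in> V" for \<omega> j
    using diam[OF that \<omega>0, of j] coord_near[of \<omega> j] coord_near[of \<omega>0 j] that V \<omega>0M by (auto simp: abs_le_iff subset_iff)
  have R_eq: "R \<omega> j = R \<omega>0 j" if "\<omega> \<in> V" "1 \<le> j" "j \<le> Suc i" for \<omega> j
  proof (cases "j = 1")
    case False
    then have j2: "2 \<le> j" using that by simp
    have "w (Suc i) \<le> w j" using that by (intro w_anti) auto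
    then have "\<bar>R \<omega> j - R \<omega>0 j\<bar> \<le> 3 * w j" using R_close[OF that(1), of j] \<rho>w by linarith
    also have "\<dots> \<le> 3 * (1 / (64 * real (X (Suc j)) ^ 2))" using w_le[of j] by simp
    also have "\<dots> < 1 / real (X (Suc j)) ^ 2" using X1[of "Suc j"] by (simp add: field_simps)
    also have "\<dots> \<le> 1 / real (X j) ^ 2"
      using X_Suc(2)[of j] X1[of j] by (intro divide_left_mono power_mono) auto
    finally have "\<bar>R \<omega> j - R \<omega>0 j\<bar> < 1 / real (X j) ^ 2" .
    moreover have "R \<omega> j \<in> reduced_fractions (X j)" "R \<omega>0 j \<in> reduced_fractions (X j)"
      using that V \<omega>0M j2 by (auto intro: R_reduced)
    ultimately show ?thesis using reduced_fractions_separated by fastforce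
  qed simp
  \<comment> \<open>The radius 3 \<rho> is \<rho> plus twice the tolerance, which is at most \<rho>
    from level k on.\<close>
  define A where "A n = {j. j < N n \<and> \<bar>child n (R \<omega>0 n) j - R \<omega>0 (Suc (Suc n))\<bar> \<le> 3 * \<rho>}" for n
  have A: "\<omega> n \<in> A n" if "\<omega> \<in> V" "n = i \<or> n = Suc i" for \<omega> n
  proof -
    have "R \<omega> n = R \<omega>0 n" using that i by (intro R_eq) auto
    moreover have "w (Suc (Suc n)) \<le> \<rho>" using w_anti[of k "Suc (Suc n)"] k i that by auto
    then have "\<bar>R \<omega> (Suc (Suc n)) - R \<omega>0 (Suc (Suc n))\<bar> \<le> 3 * \<rho>" using R_close[OF that(1), of "Suc (Suc n)"] by linarith
    ultimately show ?thesis using that V by (auto simp: A_def space_M subset_iff)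
  qed
  have cardA: "real (card (A n)) \<le> 1 + 6 * \<rho> * real (X (Suc (Suc n))) ^ 2" for n
  proof -
    have "real (card (A n)) \<le> 1 + 2 * (3 * \<rho>) / (1 / real (X (Suc (Suc n))) ^ 2)"
    proof (rule card_separated_le[where f = "child n (R \<omega>0 n)" and c = "R \<omega>0 (Suc (Suc n))"])
      fix x y assume xy: "x \<in> A n" "y \<in> A n" "x \<noteq> y"
      then have "child n (R \<omega>0 n) x \<noteq> child n (R \<omega>0 n) y"
        using child_inj[of n "R \<omega>0 n"] by (auto simp: A_def inj_on_def)
      then show "1 / real (X (Suc (Suc n))) ^ 2 \<le> \<bar>child n (R \<omega>0 n) x - child n (R \<omega>0 n) y\<bar>"
        using xy by (intro reduced_fractions_separated child_reduced) (auto simp: A_def)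
    qed (use \<rho> X1[of "Suc (Suc n)"] in \<open>auto simp: A_def\<close>)
    then show ?thesis by simp
  qed
  interpret product_prob_space "\<lambda>k. uniform_count_measure {..<N k}" UNIV
    unfolding product_prob_space_def product_prob_space_axioms_def product_sigma_finite_def
    using N(1) by (auto intro!: prob_space_uniform_count_measure prob_space_imp_sigma_finite simp: lessThan_empty_iff Suc_le_eq)
  define C where "C = prod_emb UNIV (\<lambda>k. uniform_count_measure {..<N k}) {i, Suc i} (PiE {i, Suc i} A)"
  have Asub: "A n \<subseteq> {..<N n}" for n by (auto simp: A_def)
  have "C \<in> sets M" unfolding C_def M_def
    using Asub by (intro sets_PiM_I) (auto simp: sets_uniform_count_measure)
  moreover have "V \<subseteq> C"
  proof
    fix \<omega> assume "\<omega> \<in> V"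
    then show "\<omega> \<in> C" using A[of \<omega>] V unfolding C_def prod_emb_def
      by (auto simp: space_M space_uniform_count_measure subset_iff)
  qed
  moreover have "measure M C \<le> 2 * \<rho> powr s"
  proof -
    define Y Y' W v u where "Y = real (X (Suc (Suc i)))" and "Y' = real (X (Suc (Suc (Suc i))))"
      and "W = w i" and "v = w (Suc i)" and "u = w (Suc (Suc i))"
    have Y: "1 \<le> Y" "1 \<le> Y'" using X1 by (auto simp: Y_def Y'_def)
    have W: "0 < v" "v \<le> W" "0 < u" "u \<le> \<rho>" "\<rho> < v" "W \<le> 1"
    proof -
      have "1 \<le> real (X (Suc i)) ^ 2" using X1[of "Suc i"] by (intro one_le_power) auto
      then have "1 / (64 * real (X (Suc i)) ^ 2) \<le> 1 / 1" using X1[of "Suc i"]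
        by (intro divide_left_mono order_trans[OF _ mult_mono[of 1 64 1 "real (X (Suc i)) ^ 2"]]) auto
      then have "1 / (64 * real (X (Suc i)) ^ 2) \<le> 1" by (simp only: div_by_1)
      then show "W \<le> 1" using w_le[of i] by (simp add: W_def)
    qed (use w_pos w_anti[of i "Suc i"] k i \<rho>w in \<open>auto simp: W_def v_def u_def\<close>)
    have vY: "v \<le> 1 / (64 * Y ^ 2)" using w_le[of "Suc i"] by (simp add: v_def Y_def)
    have "measure M C = measure (uniform_count_measure {..<N i}) (A i) * measure (uniform_count_measure {..<N (Suc i)}) (A (Suc i))"
      unfolding C_def M_def using Asub by (subst measure_PiM_emb) (auto simp: sets_uniform_count_measure)
    also have "\<dots> = (real (card (A i)) / real (N i)) * (real (card (A (Suc i))) / real (N (Suc i)))"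
      using Asub by (simp add: measure_uniform_count_measure)
    also have "\<dots> \<le> ((2 / Y ^ 2) * 32 / W) * ((1 / Y' ^ 2 + 6 * \<rho>) * 32 / v)"
    proof (intro mult_mono)
      have N1: "W * Y ^ 2 / 32 \<le> real (N i)" "v * Y' ^ 2 / 32 \<le> real (N (Suc i))"
        using N(2)[of i] N(2)[of "Suc i"] by (auto simp: W_def v_def Y_def Y'_def w_def)
      have "real (card (A i)) / real (N i) \<le> (1 + 6 * \<rho> * Y ^ 2) / (W * Y ^ 2 / 32)"
        using cardA[of i] N1 W Y \<rho> by (intro frac_le) (auto simp: Y_def[symmetric])
      \<comment> \<open>As \<rho> < v \<le> 1/(64 Y^2), the term 6 \<rho> Y^2 is below 1: at level k
        essentially one choice remains.\<close>
      also have "\<dots> \<le> 2 / (W * Y ^ 2 / 32)"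
      proof (intro divide_right_mono)
        have "\<rho> * Y ^ 2 \<le> 1 / (64 * Y ^ 2) * Y ^ 2" using W vY by (intro mult_right_mono) auto
        also have "\<dots> = 1 / 64" using Y by simp
        finally show "1 + 6 * \<rho> * Y ^ 2 \<le> 2" by simp
      qed (use W in auto)
      also have "\<dots> = (2 / Y ^ 2) * 32 / W" by simp
      finally show "real (card (A i)) / real (N i) \<le> (2 / Y ^ 2) * 32 / W" .
      have "real (card (A (Suc i))) / real (N (Suc i)) \<le> (1 + 6 * \<rho> * Y' ^ 2) / (v * Y' ^ 2 / 32)"
        using cardA[of "Suc i"] N1 W Y \<rho> by (intro frac_le) (auto simp: Y'_def[symmetric])
      also have "\<dots> = (1 / Y' ^ 2 + 6 * \<rho>) * 32 / v" using W Y by (simp add: field_simps)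
      finally show "real (card (A (Suc i))) / real (N (Suc i)) \<le> (1 / Y' ^ 2 + 6 * \<rho>) * 32 / v" .
    qed (use W in auto)
    also have "\<dots> = 2048 / Y' ^ 2 * (1 / Y ^ 2) / (W * v) + 12288 / Y ^ 2 * \<rho> / (W * v)"
      using W Y by (simp add: field_simps)
    \<comment> \<open>The first summand is governed by the lower end \<rho> \<ge> u, through
      \<open>grow_s\<close> for Y'; the second by the upper end \<rho> < v, through
      \<open>grow_s\<close> for Y, where s < 1 allows passing from v^(s-1) to \<rho>^(s-1). The
      constants 2048 = 2 * 32^2 and 12288 = 6 * 2048 are both below 43008.\<close>
    also have "\<dots> \<le> \<rho> powr s + \<rho> powr s"
    proof (rule add_mono)
      have "43008 / Y' ^ 2 \<le> v ^ 2 * u powr s"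
        using grow_s[of "Suc (Suc i)"] by (simp add: Y'_def v_def u_def w_def)
      then have "2048 / Y' ^ 2 \<le> v ^ 2 * u powr s" using Y by (smt (verit) divide_right_mono zero_le_power2)
      then have "2048 / Y' ^ 2 * (1 / Y ^ 2) / (W * v) \<le> (v ^ 2 * u powr s) * 1 / (v * v)"
        using W Y by (intro frac_le mult_mono) auto
      also have "\<dots> = u powr s" using W by (simp add: power2_eq_square)
      also have "\<dots> \<le> \<rho> powr s" using W s by (intro powr_mono2) auto
      finally show "2048 / Y' ^ 2 * (1 / Y ^ 2) / (W * v) \<le> \<rho> powr s" .
      have "43008 / Y ^ 2 \<le> W ^ 2 * v powr s"
        using grow_s[of "Suc i"] by (simp add: Y_def W_def v_def w_def)
      then have "12288 / Y ^ 2 \<le> W ^ 2 * v powr s" using Y by (smt (verit) divide_right_mono zero_le_power2)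
      then have "12288 / Y ^ 2 * \<rho> / (W * v) \<le> (W ^ 2 * v powr s) * \<rho> / (W * v)"
        using W \<rho> by (intro divide_right_mono mult_right_mono) auto
      also have "\<dots> = W * (v powr s * \<rho> / v)" using W by (simp add: power2_eq_square)
      also have "\<dots> \<le> 1 * (v powr s * \<rho> / v)" using W \<rho> by (intro mult_right_mono) auto
      also have "v powr s * \<rho> / v = v powr (s - 1) * \<rho>" using W by (simp add: powr_diff)
      also have "\<dots> \<le> \<rho> powr (s - 1) * \<rho>" using W s \<rho> by (intro mult_right_mono powr_mono2') auto
      also have "\<dots> = \<rho> powr s" using \<rho> by (simp add: powr_diff)
      finally show "12288 / Y ^ 2 * \<rho> / (W * v) \<le> \<rho> powr s" by simp
    qed
    finally show ?thesis by simp
  qed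
  ultimately show ?thesis by blast
qed

end

section \<open>Existence of the tree\<close>

lemma tolerance_pos: "0 < n \<Longrightarrow> 0 < tolerance \<eta> n" by (simp add: tolerance_def)

text \<open>The dimension 2/(1 + 1/\<eta>) enters here: the right side decays like n^(-s(1 +
  1/\<eta>)), which is slower than n^(-2).\<close>

lemma eventually_tolerance_powr:
  assumes \<eta>: "0 < \<eta>" and s: "s * (1 + 1/\<eta>) < 2" and c: "0 < c"
  shows "\<forall>\<^sub>F n in sequentially. 43008 / real n ^ 2 \<le> c * tolerance \<eta> n powr s"
proof -
  define \<sigma> where "\<sigma> = 1 + 1/\<eta>"
  define e where "e = s * \<sigma> - 2"
  have e: "e < 0" using s by (simp add: e_def \<sigma>_def)
  define K where "K = 43008 * 4 powr s * 4 powr (s * \<sigma>)"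
  have "((\<lambda>n::nat. K * real n powr e) \<longlongrightarrow> 0) sequentially" using e by real_asymp
  from order_tendstoD(2)[OF this c] eventually_gt_at_top[of 0]
  show ?thesis
  proof eventually_elim
    case (elim n)
    have "tolerance \<eta> n powr s = 4 powr (- s) * (4 powr (- (s * \<sigma>)) * real n powr (- (s * \<sigma>)))"
      using elim(2) unfolding tolerance_def \<sigma>_def[symmetric]
      by (simp add: powr_divide powr_mult powr_powr powr_minus_divide mult.commute)
    moreover have "43008 / real n ^ 2 = 4 powr (- s) * (4 powr (- (s * \<sigma>)) * real n powr (- (s * \<sigma>))) * (K * real n powr e)"
      using elim(2) unfolding K_def e_def by (simp add: powr_diff powr_minus_divide powr_realpow power2_eq_square)
    ultimately have "43008 / real n ^ 2 = tolerance \<eta> n powr s * (K * real n powr e)" by simp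
    also have "\<dots> \<le> tolerance \<eta> n powr s * c" using elim(1) by (intro mult_left_mono) auto
    finally show ?case by (simp add: mult.commute)
  qed
qed

text \<open>Once X(k) is fixed, every requirement on X(k+1) holds for all sufficiently large values,
  so the levels come from dependent choice.\<close>

lemma alternating_tree_exists:
  assumes \<eta>: "0 < \<eta>" "\<eta> < 1/2" and s: "0 < s" "s * (1 + 1/\<eta>) < 2"
  obtains X N child where "alternating_tree \<eta> s X N child"
proof -
  define Frac where "Frac x y r S \<longleftrightarrow> S \<subseteq> reduced_fractions y \<inter> {r - 3/4*tolerance \<eta> x..r + 3/4*tolerance \<eta> x} \<and>
     finite S \<and> tolerance \<eta> x * real y ^ 2 / 32 \<le> real (card S)" for x y :: nat and r S
  define Q where "Q x y \<longleftrightarrow> 8 * (x + 1) ^ 2 \<le> y \<and> 43008 / real y ^ 2 \<le> tolerance \<eta> x ^ 2 * tolerance \<eta> y powr s \<and>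
     (\<forall>r. \<exists>S. Frac x y r S)" for x y :: nat
  have "\<exists>X. \<forall>k. 1 \<le> X k \<and> Q (X k) (X (Suc k))"
  proof (rule dependent_nat_choice)
    show "\<exists>x::nat. 1 \<le> x" by auto
    fix x :: nat assume x: "1 \<le> x"
    have t: "0 < tolerance \<eta> x" using x by (intro tolerance_pos) simp
    then have "0 < tolerance \<eta> x ^ 2" by simp
    from eventually_tolerance_powr[OF \<eta>(1) s(2) this] many_reduced_fractions[OF t] eventually_ge_at_top[of "8 * (x + 1) ^ 2"]
    have "\<forall>\<^sub>F y in sequentially. 1 \<le> y \<and> Q x y"
    proof eventually_elim
      case (elim y)
      have "1 \<le> 8 * (x + 1) ^ 2" by simp
      then have "1 \<le> y" using elim(3) by linarith
      with elim show ?case unfolding Q_def Frac_def by blast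
    qed
    then show "\<exists>y\<ge>1. Q x y" by (auto simp: eventually_sequentially)
  qed
  then obtain X where X: "\<And>k. 1 \<le> X k" "\<And>k. Q (X k) (X (Suc k))" by blast
  \<comment> \<open>The guaranteed number of fractions, the same for every parent r; this is what
    allows a product measure on the choices.\<close>
  define N where "N k = nat \<lceil>tolerance \<eta> (X (Suc k)) * real (X (Suc (Suc k))) ^ 2 / 32\<rceil>" for k
  have Npos: "0 < tolerance \<eta> (X (Suc k)) * real (X (Suc (Suc k))) ^ 2 / 32" for k
    using X(1)[of "Suc k"] X(1)[of "Suc (Suc k)"] by (intro divide_pos_pos mult_pos_pos tolerance_pos zero_less_power) auto
  have N: "1 \<le> N k" "tolerance \<eta> (X (Suc k)) * real (X (Suc (Suc k))) ^ 2 / 32 \<le> real (N k)" for k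
    using Npos[of k] unfolding N_def by linarith+
  define Ch where "Ch k r f \<longleftrightarrow> inj_on f {..<N k} \<and> f ` {..<N k} \<subseteq> reduced_fractions (X (Suc (Suc k))) \<inter>
     {r - 3/4*tolerance \<eta> (X (Suc k))..r + 3/4*tolerance \<eta> (X (Suc k))}" for k r and f :: "nat \<Rightarrow> real"
  have ex: "\<exists>f. Ch k r f" for k r
  proof -
    obtain S where S: "Frac (X (Suc k)) (X (Suc (Suc k))) r S" using X(2)[of "Suc k"] unfolding Q_def by blast
    then obtain f where f: "bij_betw f {0..<card S} S" unfolding Frac_def using ex_bij_betw_nat_finite by blast
    have "N k \<le> card S" using S unfolding Frac_def N_def by linarith
    then have sub: "{..<N k} \<subseteq> {0..<card S}" by auto
    have "inj_on f {..<N k}" using f sub by (meson bij_betw_def inj_on_subset)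
    moreover have "f ` {..<N k} \<subseteq> S" using f sub unfolding bij_betw_def by blast
    ultimately have "Ch k r f" using S unfolding Ch_def Frac_def by blast
    then show ?thesis by blast
  qed
  define child where "child k r = (SOME f. Ch k r f)" for k r
  have child: "Ch k r (child k r)" for k r unfolding child_def using ex by (rule someI_ex)
  have "alternating_tree \<eta> s X N child"
  proof
    show "0 < \<eta>" "\<eta> < 1/2" "0 < s" by fact+
    have "2 \<le> 1 + 1/\<eta>" using \<eta> by (simp add: field_simps)
    then have "s * 2 \<le> s * (1 + 1/\<eta>)" using s by (intro mult_left_mono) auto
    then show "s < 1" using s by linarith
    fix k
    show "1 \<le> X k" by (rule X)
    show "8 * (X k + 1) ^ 2 \<le> X (Suc k)" "43008 / real (X (Suc k)) ^ 2 \<le> tolerance \<eta> (X k) ^ 2 * tolerance \<eta> (X (Suc k)) powr s"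
      using X(2)[of k] unfolding Q_def by blast+
    show "1 \<le> N k" "tolerance \<eta> (X (Suc k)) * real (X (Suc (Suc k))) ^ 2 / 32 \<le> real (N k)" by (rule N)+
    fix r show "inj_on (child k r) {..<N k}" using child[of k r] unfolding Ch_def by blast
    fix j assume "j < N k"
    then have "child k r j \<in> reduced_fractions (X (Suc (Suc k))) \<inter>
     {r - 3/4*tolerance \<eta> (X (Suc k))..r + 3/4*tolerance \<eta> (X (Suc k))}"
      using child[of k r] unfolding Ch_def by blast
    then show "child k r j \<in> reduced_fractions (X (Suc (Suc k)))" "\<bar>child k r j - r\<bar> \<le> 3/4 * tolerance \<eta> (X (Suc k))"
      unfolding abs_diff_le_iff by auto
  qed
  then show thesis by (rule that)
qed

section \<open>Rational independence and its extension by further coordinates\<close>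

definition independent_on :: "'n set \<Rightarrow> real^'n::finite \<Rightarrow> bool" where
  "independent_on J \<alpha> \<longleftrightarrow> (\<forall>(c0::int) (c :: 'n \<Rightarrow> int). (\<forall>i. i \<notin> J \<longrightarrow> c i = 0) \<longrightarrow>
     of_int c0 + (\<Sum>i\<in>UNIV. of_int (c i) * \<alpha> $ i) = 0 \<longrightarrow> (\<forall>i. c i = 0))"

lemma independent_onD:
  fixes c :: "'n::finite \<Rightarrow> int" and c0 :: int
  assumes "independent_on J \<alpha>" "\<And>i. i \<notin> J \<Longrightarrow> c i = 0" "of_int c0 + (\<Sum>i\<in>UNIV. of_int (c i) * \<alpha> $ i) = 0"
  shows "c i = 0"
proof -
  have "(\<forall>i. i \<notin> J \<longrightarrow> c i = 0) \<longrightarrow> of_int c0 + (\<Sum>i\<in>UNIV. of_int (c i) * \<alpha> $ i) = 0 \<longrightarrow> (\<forall>i. c i = 0)"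
    using assms(1) unfolding independent_on_def by (elim allE)
  then have "\<forall>i. c i = 0" using assms(2,3) by (elim mp[THEN mp]) auto
  then show ?thesis ..
qed

lemma common_denominator:
  fixes A :: "real set"
  assumes "finite A" "A \<subseteq> \<rat>"
  shows "\<exists>D::int. 0 < D \<and> (\<forall>x\<in>A. of_int D * x \<in> \<int>)"
  using assms
proof (induction rule: finite_induct)
  case (insert x A)
  then obtain D where D: "0 < D" "\<forall>x\<in>A. of_int D * x \<in> \<int>" by auto
  obtain a b :: int where ab: "x = of_int a / of_int b" "0 < b" using insert.prems by (auto elim!: Rats_cases')
  have "of_int (D * b) * x = of_int (D * a)" using ab by simp
  then have "of_int (D * b) * x \<in> \<int>" by (simp only: Ints_of_int)
  moreover have "of_int (D * b) * y \<in> \<int>" if "y \<in> A" for y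
  proof -
    have "of_int (D * b) * y = of_int b * (of_int D * y)" by simp
    moreover have "of_int D * y \<in> \<int>" using D that by blast
    ultimately show ?thesis by (metis Ints_mult Ints_of_int)
  qed
  moreover have "0 < D * b" using D ab by simp
  ultimately show ?case by (intro exI[of _ "D * b"]) auto
qed (auto intro: exI[of _ 1])

lemma KsetI:
  fixes \<alpha> :: "real^'n::finite"
  assumes "independent_on UNIV \<alpha>"
  shows "\<alpha> \<in> Kset"
  unfolding Kset_def mem_Collect_eq
proof (intro allI impI)
  fix c0 :: real and c :: "'n \<Rightarrow> real"
  assume rel: "c0 \<in> \<rat> \<and> (\<forall>i. c i \<in> \<rat>) \<and> c0 + (\<Sum>i\<in>UNIV. c i * \<alpha> $ i) = 0"
  then have "insert c0 (range c) \<subseteq> \<rat>" by auto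
  then obtain D :: int where D: "0 < D" "\<forall>x\<in>insert c0 (range c). of_int D * x \<in> \<int>"
    using common_denominator[of "insert c0 (range c)"] by auto
  define d where "d i = \<lfloor>of_int D * c i\<rfloor>" for i
  have d: "of_int (d i) = of_int D * c i" for i
  proof -
    have "of_int D * c i \<in> \<int>" using D(2) by blast
    then show ?thesis unfolding d_def by (auto elim: Ints_cases)
  qed
  have d0: "of_int \<lfloor>of_int D * c0\<rfloor> = of_int D * c0"
  proof -
    have "of_int D * c0 \<in> \<int>" using D(2) by blast
    then show ?thesis by (auto elim: Ints_cases)
  qed
  have "of_int \<lfloor>of_int D * c0\<rfloor> + (\<Sum>i\<in>UNIV. of_int (d i) * \<alpha> $ i) = of_int D * (c0 + (\<Sum>i\<in>UNIV. c i * \<alpha> $ i))"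
    unfolding d0 d by (simp add: distrib_left sum_distrib_left mult.assoc)
  also have "\<dots> = 0" using rel by simp
  finally have "d i = 0" for i by (rule independent_onD[OF assms, rotated]) simp
  then have "c i = 0" for i using d[of i] D(1) by simp
  moreover from this have "c0 = 0" using rel by simp
  ultimately show "c0 = 0 \<and> (\<forall>i. c i = 0)" by blast
qed

text \<open>A relation that involves the new coordinate determines its value t, and one that does
  not contradicts independence on \<open>J\<close>. With integer coefficients the relations form a
  countable type.\<close>

lemma countable_dependent_extensions:
  fixes \<alpha> :: "real^'n::finite"
  assumes ind: "independent_on J \<alpha>" and l: "l \<notin> J"
  shows "countable {t. \<not> independent_on (insert l J) (\<chi> i. if i = l then t else \<alpha> $ i)}"
proof (rule countable_subset)
  let ?f = "\<lambda>(c0::int, c::'n \<Rightarrow> int). - (of_int c0 + (\<Sum>i\<in>UNIV-{l}. of_int (c i) * \<alpha> $ i)) / of_int (c l)"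
  show "countable (range ?f)" by (rule countable_image) (rule countableI_type)
  show "{t. \<not> independent_on (insert l J) (\<chi> i. if i = l then t else \<alpha> $ i)} \<subseteq> range ?f"
  proof
    fix t assume "t \<in> {t. \<not> independent_on (insert l J) (\<chi> i. if i = l then t else \<alpha> $ i)}"
    then obtain c0 c where c: "\<And>i. i \<notin> insert l J \<Longrightarrow> c i = 0" and nz: "\<not> (\<forall>i. c i = 0)"
      and rel: "of_int c0 + (\<Sum>i\<in>UNIV. of_int (c i) * (\<chi> i. if i = l then t else \<alpha> $ i) $ i) = 0"
      unfolding independent_on_def mem_Collect_eq not_all not_imp by blast
    have "(\<Sum>i\<in>UNIV. of_int (c i) * (\<chi> i. if i = l then t else \<alpha> $ i) $ i) =
        of_int (c l) * t + (\<Sum>i\<in>UNIV-{l}. of_int (c i) * \<alpha> $ i)"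
      by (subst sum.remove[of _ l]) (auto intro!: sum.cong)
    with rel have rel': "of_int c0 + (of_int (c l) * t + (\<Sum>i\<in>UNIV-{l}. of_int (c i) * \<alpha> $ i)) = 0" by (simp only:)
    have "c l \<noteq> 0"
    proof
      assume cl: "c l = 0"
      have "(\<Sum>i\<in>UNIV. of_int (c i) * \<alpha> $ i) = (\<Sum>i\<in>UNIV-{l}. of_int (c i) * \<alpha> $ i)"
        by (subst sum.remove[of _ l]) (auto simp: cl)
      then have r0: "of_int c0 + (\<Sum>i\<in>UNIV. of_int (c i) * \<alpha> $ i) = 0" using rel' cl by simp
      have "c i = 0" for i by (rule independent_onD[OF ind _ r0], metis c cl insert_iff)
      then show False using nz by blast
    qed
    then have "t = ?f (c0, c)" using rel' by (simp add: field_simps)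
    then show "t \<in> range ?f" by blast
  qed
qed

text \<open>A countable exceptional set does not exhaust the reals, so the coordinates can be added
  one at a time.\<close>

lemma independent_extension:
  fixes i j :: "'n::finite" and x y :: real
  assumes base: "independent_on {i, j} (\<chi> m. if m = i then x else y)" and "i \<noteq> j"
    and "finite J" "J \<inter> {i, j} = {}"
  shows "\<exists>\<alpha> :: real^'n. \<alpha> $ i = x \<and> \<alpha> $ j = y \<and> independent_on ({i, j} \<union> J) \<alpha>"
  using assms(3,4)
proof (induction rule: finite_induct)
  case empty
  then show ?case using base \<open>i \<noteq> j\<close> by (intro exI[of _ "\<chi> m. if m = i then x else y"]) auto
next
  case (insert l J)
  then obtain \<alpha> :: "real^'n" where \<alpha>: "\<alpha> $ i = x" "\<alpha> $ j = y" "independent_on ({i, j} \<union> J) \<alpha>" by auto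
  have l: "l \<notin> {i, j} \<union> J" using insert by auto
  have "{t. \<not> independent_on (insert l ({i, j} \<union> J)) (\<chi> m. if m = l then t else \<alpha> $ m)} \<noteq> UNIV"
    using countable_dependent_extensions[OF \<alpha>(3) l] uncountable_UNIV_real by metis
  then obtain t where "independent_on (insert l ({i, j} \<union> J)) (\<chi> m. if m = l then t else \<alpha> $ m)" by blast
  then show ?case using \<alpha> l by (intro exI[of _ "\<chi> m. if m = l then t else \<alpha> $ m"]) auto
qed

section \<open>Non-density of the points of the tree and the lower bounds\<close>

context alternating_tree
begin

lemma not_in_Dset:
  fixes \<alpha> :: "real^'n::finite"
  assumes \<omega>: "\<omega> \<in> space M" and "\<alpha> $ i = coord 0 \<omega>" "\<alpha> $ j = coord 1 \<omega>"
  shows "\<alpha> \<notin> Dset \<eta>"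
proof -
  obtain q0 where q0: "\<And>q::nat. q0 \<le> q \<Longrightarrow> \<exists>k (b::int) (p::int). 0 < b \<and> of_int b \<le> real q powr \<eta> / 4 \<and>
       \<bar>coord k \<omega> - of_int p / of_int b\<bar> \<le> real q powr (-(1+\<eta>)) / 4"
    using coord_approx[OF \<omega>] by blast
  have c: "\<exists>l. \<alpha> $ l = coord k \<omega>" for k
  proof -
    have "k mod 2 = 0 \<or> k mod 2 = 1" by presburger
    then show ?thesis using assms coord_mod[OF \<omega>, of k] by (metis One_nat_def)
  qed
  show ?thesis
  proof (rule not_in_DsetI[OF \<eta>(1), of q0])
    fix q :: nat assume "q0 \<le> q"
    then obtain k and b p :: int where kbp: "0 < b" "of_int b \<le> real q powr \<eta> / 4"
       "\<bar>coord k \<omega> - of_int p / of_int b\<bar> \<le> real q powr (-(1+\<eta>)) / 4" using q0 by blast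
    obtain l where "\<alpha> $ l = coord k \<omega>" using c by blast
    then show "\<exists>l (b::int) (p::int). 0 < b \<and> of_int b \<le> real q powr \<eta> / 4 \<and>
       \<bar>\<alpha> $ l - of_int p / of_int b\<bar> \<le> real q powr (-(1+\<eta>)) / 4"
      using kbp by (intro exI[of _ l] exI[of _ b] exI[of _ p]) simp
  qed
qed

lemma independent_coords:
  fixes i j :: "'n::finite"
  assumes \<omega>: "\<omega> \<in> space M" and ij: "i \<noteq> j"
  shows "independent_on {i, j} (\<chi> m. if m = i then coord 0 \<omega> else coord 1 \<omega>)"
  unfolding independent_on_def
proof (intro allI impI)
  fix c0 :: int and c :: "'n \<Rightarrow> int" and m
  assume supp: "\<forall>m. m \<notin> {i, j} \<longrightarrow> c m = 0"
    and rel: "of_int c0 + (\<Sum>m\<in>UNIV. of_int (c m) * (\<chi> m. if m = i then coord 0 \<omega> else coord 1 \<omega>) $ m) = 0"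
  have "(\<Sum>m\<in>UNIV. of_int (c m) * (\<chi> m. if m = i then coord 0 \<omega> else coord 1 \<omega>) $ m) =
      (\<Sum>m\<in>{i, j}. of_int (c m) * (if m = i then coord 0 \<omega> else coord 1 \<omega>))"
    using supp by (intro sum.mono_neutral_cong_right) auto
  also have "\<dots> = of_int (c i) * coord 0 \<omega> + of_int (c j) * coord 1 \<omega>" using ij by simp
  finally have "of_int c0 + of_int (if (0::nat) = 0 then c i else c j) * coord 0 \<omega>
     + of_int (if (1::nat) = 0 then c i else c j) * coord 1 \<omega> = 0"
    using rel by simp
  from coord_no_relation[OF \<omega>, where c = "\<lambda>n. if n = 0 then c i else c j", OF this]
  have "c i = 0" "c j = 0" by auto
  then show "c m = 0" using supp by (cases "m \<in> {i, j}") auto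
qed

lemma space_M_nonempty: "(\<lambda>_. 0) \<in> space M"
  unfolding space_M using N(1) by (auto simp: Suc_le_eq)

end

lemma hausdorff_dim_ge_card_2:
  assumes \<eta>: "0 < \<eta>" "\<eta> < 1/2" and card: "CARD('n::finite) = 2"
  shows "ereal (2 / (1 + 1/\<eta>)) \<le> hausdorff_dim (- Dset \<eta> \<inter> Kset :: (real^'n) set)"
proof (rule hausdorff_dim_ge)
  fix s :: real assume s: "0 < s" "s < 2 / (1 + 1/\<eta>)"
  obtain i j :: 'n where ij: "UNIV = {i, j}" "i \<noteq> j" using card by (meson card_2_iff)
  have "0 < 1 + 1/\<eta>" using \<eta> by (simp add: add_pos_pos)
  then have "s * (1 + 1/\<eta>) < 2" using s by (simp add: pos_less_divide_eq)
  from alternating_tree_exists[OF \<eta> s(1) this]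
  obtain X N child where "alternating_tree \<eta> s X N child" .
  then interpret alternating_tree \<eta> s X N child .
  define f :: "(nat \<Rightarrow> nat) \<Rightarrow> real^'n" where "f \<omega> = (\<chi> m. if m = i then coord 0 \<omega> else coord 1 \<omega>)" for \<omega>
  have fi: "f \<omega> $ i = coord 0 \<omega>" "f \<omega> $ j = coord 1 \<omega>" for \<omega> using ij by (auto simp: f_def)
  show "hausdorff_measure s (- Dset \<eta> \<inter> Kset :: (real^'n) set) \<noteq> 0"
  proof (rule mass_distribution_principle[where M = M and f = f and radius = "w 2" and c = 2])
    show "prob_space M" by (rule prob_space_M)
    show "AE \<omega> in M. f \<omega> \<in> - Dset \<eta> \<inter> Kset"
    proof (rule AE_I2)
      fix \<omega> assume \<omega>: "\<omega> \<in> space M"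
      have "f \<omega> \<notin> Dset \<eta>" by (rule not_in_Dset[OF \<omega> fi])
      moreover have "f \<omega> \<in> Kset"
        using independent_coords[OF \<omega> ij(2)] unfolding f_def ij(1)[symmetric] by (rule KsetI)
      ultimately show "f \<omega> \<in> - Dset \<eta> \<inter> Kset" by blast
    qed
    show "0 < w 2" by (rule w_pos)
    fix U :: "(real^'n) set" and \<rho> :: real
    assume \<rho>: "0 < \<rho>" "\<rho> < w 2" and U: "\<And>x y. x \<in> U \<Longrightarrow> y \<in> U \<Longrightarrow> dist x y \<le> \<rho>"
    show "\<exists>C\<in>sets M. {\<omega> \<in> space M. f \<omega> \<in> U} \<subseteq> C \<and> measure M C \<le> 2 * \<rho> powr s"
    proof (rule mass_bound[OF \<rho>])
      fix \<omega> \<omega>' k assume o: "\<omega> \<in> {\<omega> \<in> space M. f \<omega> \<in> U}" "\<omega>' \<in> {\<omega> \<in> space M. f \<omega> \<in> U}"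
      have d: "\<bar>f \<omega> $ m - f \<omega>' $ m\<bar> \<le> \<rho>" for m
        using U[of "f \<omega>" "f \<omega>'"] o component_le_norm_cart[of "f \<omega> - f \<omega>'" m] by (simp add: dist_norm)
      have "coord (k mod 2) \<omega> = coord k \<omega>" "coord (k mod 2) \<omega>' = coord k \<omega>'" using o by (auto intro: coord_mod)
      moreover have "k mod 2 = 0 \<or> k mod 2 = 1" by presburger
      ultimately show "\<bar>coord k \<omega> - coord k \<omega>'\<bar> \<le> \<rho>" using d[of i] d[of j] unfolding fi by metis
    qed auto
  qed (use s in auto)
qed

text \<open>The set contains all but countably many points of a line parallel to the axis
  \<open>l\<close>, and Lebesgue measure on a unit segment of it gives mass at most 2 \<rho> \<le> 2
  \<rho>^s to sets of diameter \<rho> < 1.\<close>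

lemma hausdorff_dim_ge_card_3:
  assumes \<eta>: "0 < \<eta>" "\<eta> < 1/2" and card: "3 \<le> CARD('n::finite)"
  shows "ereal 1 \<le> hausdorff_dim (- Dset \<eta> \<inter> Kset :: (real^'n) set)"
proof (rule hausdorff_dim_ge)
  fix s :: real assume s1: "0 < s" "s < 1"
  obtain A :: "'n set" where A: "card A = 3" using obtain_subset_with_card_n[OF card] by blast
  then obtain i j l :: 'n where ij: "i \<noteq> j" "l \<noteq> i" "l \<noteq> j" by (auto simp: card_3_iff)
  have pos: "0 < 1 + 1/\<eta>" using \<eta> by (simp add: add_pos_pos)
  \<comment> \<open>Any positive exponent below 2/(1 + 1/\<eta>) would do: only one branch of the
    tree is used, here the one that always takes child 0.\<close>
  then have "0 < 1 / (1 + 1/\<eta>)" "1 / (1 + 1/\<eta>) * (1 + 1/\<eta>) < 2" by auto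
  from alternating_tree_exists[OF \<eta> this]
  obtain X N child where "alternating_tree \<eta> (1 / (1 + 1/\<eta>)) X N child" .
  then interpret alternating_tree \<eta> "1 / (1 + 1/\<eta>)" X N child .
  let ?\<omega> = "\<lambda>_::nat. 0::nat"
  obtain \<alpha> :: "real^'n" where \<alpha>: "\<alpha> $ i = coord 0 ?\<omega>" "\<alpha> $ j = coord 1 ?\<omega>"
     "independent_on ({i, j} \<union> (UNIV - {i, j, l})) \<alpha>"
    using independent_extension[OF independent_coords[OF space_M_nonempty ij(1)] ij(1), of "UNIV - {i, j, l}"] by auto
  define f :: "real \<Rightarrow> real^'n" where "f t = (\<chi> m. if m = l then t else \<alpha> $ m)" for t
  have l: "l \<notin> {i, j} \<union> (UNIV - {i, j, l})" using ij by auto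
  have UN: "insert l ({i, j} \<union> (UNIV - {i, j, l})) = UNIV" by auto
  have cnt: "countable {t. \<not> independent_on UNIV (f t)}"
    using countable_dependent_extensions[OF \<alpha>(3) l] unfolding UN f_def .
  have fD: "f t \<notin> Dset \<eta>" for t
    by (rule not_in_Dset[OF space_M_nonempty, of _ i j]) (use \<alpha> ij in \<open>auto simp: f_def\<close>)
  show "hausdorff_measure s (- Dset \<eta> \<inter> Kset :: (real^'n) set) \<noteq> 0"
  proof (rule mass_distribution_principle[where M = "uniform_measure lborel {0..1}" and f = f and radius = 1 and c = 2])
    show "prob_space (uniform_measure lborel {0..1::real})" by (intro prob_space_uniform_measure) auto
    have "AE t in lborel. t \<notin> {t. \<not> independent_on UNIV (f t)}"
      using countable_imp_null_set_lborel[OF cnt] by (rule AE_not_in)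
    then have "AE t in lborel. t \<in> {0..1} \<longrightarrow> f t \<in> - Dset \<eta> \<inter> Kset"
      by eventually_elim (use fD KsetI in auto)
    then show "AE t in uniform_measure lborel {0..1}. f t \<in> - Dset \<eta> \<inter> Kset"
      by (intro AE_uniform_measureI) auto
    fix U :: "(real^'n) set" and \<rho> :: real
    assume \<rho>: "0 < \<rho>" "\<rho> < 1" and U: "\<And>x y. x \<in> U \<Longrightarrow> y \<in> U \<Longrightarrow> dist x y \<le> \<rho>"
    show "\<exists>C\<in>sets (uniform_measure lborel {0..1}). {t \<in> space (uniform_measure lborel {0..1}). f t \<in> U} \<subseteq> C \<and>
        measure (uniform_measure lborel {0..1}) C \<le> 2 * \<rho> powr s"
    proof (cases "\<exists>t0. f t0 \<in> U")
      case True
      then obtain t0 where t0: "f t0 \<in> U" ..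
      have "{t \<in> space (uniform_measure lborel {0..1}). f t \<in> U} \<subseteq> {t0 - \<rho>..t0 + \<rho>}"
      proof safe
        fix t assume "f t \<in> U"
        then have "norm (f t - f t0) \<le> \<rho>" using U[OF _ t0, of "f t"] by (simp add: dist_norm)
        then have "\<bar>(f t - f t0) $ l\<bar> \<le> \<rho>"
          using component_le_norm_cart[of "f t - f t0" l] by (rule order_trans[rotated])
        then show "t \<in> {t0 - \<rho>..t0 + \<rho>}" by (simp add: f_def abs_le_iff)
      qed
      moreover have "measure (uniform_measure lborel {0..1}) {t0 - \<rho>..t0 + \<rho>} \<le> 2 * \<rho> powr s"
      proof -
        have "measure (uniform_measure lborel {0..1}) {t0 - \<rho>..t0 + \<rho>} = measure lborel ({0..1} \<inter> {t0 - \<rho>..t0 + \<rho>})"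
          by (subst measure_uniform_measure) auto
        also have "\<dots> \<le> measure lborel {t0 - \<rho>..t0 + \<rho>}"
          by (intro measure_mono_fmeasurable) (use \<rho> in \<open>auto simp: fmeasurable_def\<close>)
        also have "\<dots> = 2 * \<rho>" using \<rho> by simp
        also have "\<dots> \<le> 2 * \<rho> powr s" using \<rho> s1 powr_mono'[of s 1 \<rho>] by simp
        finally show ?thesis .
      qed
      ultimately show ?thesis by (intro bexI[of _ "{t0 - \<rho>..t0 + \<rho>}"]) auto
    next
      case False
      then show ?thesis by (intro bexI[of _ "{}"]) auto
    qed
  qed (use s1 in auto)
qed

subsection \<open>Dimension one\<close>

text \<open>Multiples of a single \<open>q\<^sub>1\<close> with \<open>t = q\<^sub>1\<^sup>\<eta> |q\<^sub>1a - p\<^sub>1|\<close> small give the values \<open>m\<^bsup>1+\<eta>\<^esup> t\<close>,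
  whose consecutive ratios tend to 1.\<close>

lemma dense_values_irrational:
  fixes a x \<epsilon> :: real
  assumes a: "a \<notin> \<rat>" and \<eta>: "0 < \<eta>" "\<eta> < 1" and x: "x \<noteq> 0" and \<epsilon>: "0 < \<epsilon>"
  shows "\<exists>(q::int) (p::int). q \<noteq> 0 \<and> \<bar>\<bar>real_of_int q\<bar> powr \<eta> * (of_int q * a - of_int p) - x\<bar> < \<epsilon>"
proof -
  \<comment> \<open>The final error is at most 3 |x| / u, so u \<ge> U \<ge> 4 |x| / \<epsilon>
    suffices.\<close>
  define U where "U = max 1 (4 * \<bar>x\<bar> / \<epsilon>)"
  have U: "1 \<le> U" "4 * \<bar>x\<bar> / \<epsilon> \<le> U" by (auto simp: U_def)
  \<comment> \<open>The bound t < B is equivalent to u > U for the u below. Dirichlet's theorem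
    gives t \<le> N^(\<eta>-1), which falls below B for large N since \<eta> < 1.\<close>
  define B where "B = \<bar>x\<bar> * U powr (-(1+\<eta>))"
  have B: "0 < B" using x U by (simp add: B_def)
  have "((\<lambda>N::nat. real N powr (\<eta> - 1)) \<longlongrightarrow> 0) sequentially" using \<eta> by real_asymp
  from order_tendstoD(2)[OF this B] eventually_gt_at_top[of 0]
  have "\<forall>\<^sub>F N::nat in sequentially. real N powr (\<eta> - 1) < B \<and> 0 < N" by eventually_elim auto
  then obtain N :: nat where N: "real N powr (\<eta> - 1) < B" "0 < N" by (auto simp: eventually_sequentially)
  obtain p1 q1 :: int where q1: "0 < q1" "q1 \<le> int N" "\<bar>of_int q1 * a - of_int p1\<bar> < 1 / real N"
    using Dirichlet_approx[OF N(2)] by blast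
  define y where "y = of_int q1 * a - of_int p1"
  have y: "y \<noteq> 0"
  proof
    assume "y = 0"
    then have "a = of_int p1 / of_int q1" using q1 by (simp add: y_def field_simps)
    also have "\<dots> \<in> \<rat>" by simp
    finally show False using a by contradiction
  qed
  define t where "t = real_of_int q1 powr \<eta> * \<bar>y\<bar>"
  have t0: "0 < t" using q1 y by (simp add: t_def)
  have "t \<le> real N powr \<eta> * (1 / real N)"
    unfolding t_def using q1 \<eta> by (intro mult_mono powr_mono2) (auto simp: y_def)
  also have "\<dots> = real N powr (\<eta> - 1)" using N by (simp add: powr_diff)
  finally have tB: "t < B" using N by simp
  \<comment> \<open>The real multiplier that would hit |x| exactly. Rounding it up changes the value
    by a factor at most (1 + 1/u)^2 \<le> 1 + 3/u, as 1 + \<eta> \<le> 2.\<close>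
  define u where "u = (\<bar>x\<bar> / t) powr (1 / (1 + \<eta>))"
  have xt: "\<bar>x\<bar> = t * u powr (1 + \<eta>)" using t0 x \<eta> by (simp add: u_def powr_powr)
  have uU: "U \<le> u"
  proof -
    have "U powr (1+\<eta>) \<le> \<bar>x\<bar> / t"
    proof -
      have "t * U powr (1+\<eta>) \<le> B * U powr (1+\<eta>)" using tB by (intro mult_right_mono) auto
      also have "\<dots> = \<bar>x\<bar> * (U powr (-(1+\<eta>)) * U powr (1+\<eta>))" by (simp only: B_def mult.assoc)
      also have "U powr (-(1+\<eta>)) * U powr (1+\<eta>) = 1" using U unfolding powr_add[symmetric] by simp
      also have "\<bar>x\<bar> * 1 = \<bar>x\<bar>" by simp
      finally show ?thesis using t0 by (simp add: field_simps)
    qed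
    then have "(U powr (1+\<eta>)) powr (1 / (1+\<eta>)) \<le> u" unfolding u_def using \<eta> by (intro powr_mono2) auto
    then show ?thesis using \<eta> U by (simp add: powr_powr)
  qed
  have u1: "1 \<le> u" using U uU by simp
  define m where "m = \<lceil>u\<rceil>"
  have m: "u \<le> of_int m" "of_int m \<le> u + 1" "1 \<le> m" using u1 unfolding m_def by linarith+
  define sg :: int where "sg = (if 0 < y * x then 1 else -1)"
  have sg: "of_int sg * y = \<bar>y\<bar> * sgn x" "\<bar>sg\<bar> = 1" "sg \<noteq> 0"
    using x y by (auto simp: sg_def zero_less_mult_iff sgn_if abs_if)
  define q where "q = sg * m * q1"
  define p where "p = sg * m * p1"
  have q0: "q \<noteq> 0" using sg m q1 by (auto simp: q_def)
  have absq: "\<bar>real_of_int q\<bar> = of_int m * of_int q1"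
  proof -
    have "\<bar>q\<bar> = m * q1" unfolding q_def abs_mult sg(2) using m q1 by simp
    then have "real_of_int \<bar>q\<bar> = of_int (m * q1)" by (simp only:)
    then show ?thesis by simp
  qed
  have "of_int q * a - of_int p = of_int m * (of_int sg * y)" by (simp add: q_def p_def y_def algebra_simps)
  then have "\<bar>real_of_int q\<bar> powr \<eta> * (of_int q * a - of_int p) = (of_int m powr \<eta> * of_int m) * t * sgn x"
    unfolding absq sg(1) t_def using m q1 by (simp add: powr_mult)
  also have "of_int m powr \<eta> * of_int m = of_int m powr (1 + \<eta>)" using m by (simp add: powr_add)
  finally have v: "\<bar>real_of_int q\<bar> powr \<eta> * (of_int q * a - of_int p) = of_int m powr (1 + \<eta>) * t * sgn x" .
  have xs: "x = \<bar>x\<bar> * sgn x" by (simp add: abs_mult_sgn)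
  have ratio: "of_int m powr (1 + \<eta>) * t = \<bar>x\<bar> * (of_int m / u) powr (1 + \<eta>)"
    unfolding xt using u1 m by (simp add: powr_divide)
  have r1: "1 \<le> (of_int m / u) powr (1 + \<eta>)" using m u1 \<eta> by (intro ge_one_powr_ge_zero) auto
  have "(of_int m / u) powr (1 + \<eta>) \<le> (of_int m / u) powr 2" using m u1 \<eta> by (intro powr_mono) auto
  also have "\<dots> = (of_int m / u) ^ 2" using m u1 by (simp add: powr_realpow)
  also have "\<dots> \<le> (1 + 1 / u) ^ 2" using m u1 by (intro power_mono) (auto simp: field_simps)
  also have "\<dots> = 1 + 2 / u + 1 / u * (1 / u)" using u1 by (simp add: power2_eq_square field_simps)
  also have "\<dots> \<le> 1 + 2 / u + 1 / u * 1" using u1 by (intro add_left_mono mult_left_mono) auto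
  also have "\<dots> = 1 + 3 / u" by simp
  finally have r2: "(of_int m / u) powr (1 + \<eta>) \<le> 1 + 3 / u" .
  have "\<bar>\<bar>real_of_int q\<bar> powr \<eta> * (of_int q * a - of_int p) - x\<bar> = \<bar>(\<bar>x\<bar> * ((of_int m / u) powr (1 + \<eta>) - 1)) * sgn x\<bar>"
    unfolding v ratio by (subst (3) xs) (simp add: algebra_simps)
  also have "\<dots> = \<bar>x\<bar> * ((of_int m / u) powr (1 + \<eta>) - 1)" using x r1 by (simp add: abs_mult abs_sgn_eq)
  also have "\<dots> \<le> \<bar>x\<bar> * (3 / u)" using r2 by (intro mult_left_mono) auto
  also have "\<dots> < \<epsilon>"
  proof -
    have "4 * \<bar>x\<bar> / \<epsilon> \<le> u" using U uU by linarith
    then have "4 * \<bar>x\<bar> \<le> u * \<epsilon>" using \<epsilon> by (simp add: field_simps)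
    then have "3 * \<bar>x\<bar> < u * \<epsilon>" using x by simp
    then show ?thesis using u1 by (simp add: field_simps)
  qed
  finally show ?thesis using q0 by blast
qed

lemma compl_Kset_card_1:
  assumes "CARD('n::finite) = 1"
  shows "- (Kset :: (real^'n) set) = {\<alpha>. \<forall>i. \<alpha> $ i \<in> \<rat>}"
proof -
  obtain i0 :: 'n where i0: "UNIV = {i0}" using assms by (meson card_1_singletonE)
  have all: "i = i0" for i :: 'n using i0 by blast
  have "\<alpha> \<in> Kset \<longleftrightarrow> \<alpha> $ i0 \<notin> \<rat>" for \<alpha> :: "real^'n"
  proof
    assume K: "\<alpha> \<in> Kset"
    show "\<alpha> $ i0 \<notin> \<rat>"
    proof
      assume "\<alpha> $ i0 \<in> \<rat>"
      then have "(\<lambda>_. 1 :: real) i0 = 0"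
        by (intro KsetD[OF K, of "- (\<alpha> $ i0)" "\<lambda>_. 1"]) (auto simp: i0)
      then show False by simp
    qed
  next
    assume irr: "\<alpha> $ i0 \<notin> \<rat>"
    show "\<alpha> \<in> Kset"
      unfolding Kset_def mem_Collect_eq
    proof (intro allI impI)
      fix c0 :: real and c :: "'n \<Rightarrow> real"
      assume "c0 \<in> \<rat> \<and> (\<forall>i. c i \<in> \<rat>) \<and> c0 + (\<Sum>i\<in>UNIV. c i * \<alpha> $ i) = 0"
      then have rel: "c0 \<in> \<rat>" "c i0 \<in> \<rat>" "c0 + c i0 * \<alpha> $ i0 = 0" by (auto simp: i0)
      have "c i0 = 0"
      proof (rule ccontr)
        assume "c i0 \<noteq> 0"
        then have "\<alpha> $ i0 = - c0 / c i0" using rel(3) by (simp add: field_simps)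
        also have "\<dots> \<in> \<rat>" using rel by (intro Rats_divide) auto
        finally show False using irr by contradiction
      qed
      then show "c0 = 0 \<and> (\<forall>i. c i = 0)" using rel all by (metis add.right_neutral mult_zero_left)
    qed
  qed
  then show ?thesis using all by (auto, metis)
qed

lemma compl_Dset_card_1:
  assumes "CARD('n::finite) = 1" and \<eta>: "0 < \<eta>" "\<eta> < 1"
  shows "- (Dset \<eta> :: (real^'n) set) = {\<alpha>. \<forall>i. \<alpha> $ i \<in> \<rat>}"
proof -
  obtain i0 :: 'n where i0: "UNIV = {i0}" using assms by (meson card_1_singletonE)
  have all: "i = i0" for i :: 'n using i0 by blast
  have "\<alpha> \<in> Dset \<eta>" if irr: "\<alpha> $ i0 \<notin> \<rat>" for \<alpha> :: "real^'n"
  proof (rule ccontr)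
    assume "\<alpha> \<notin> Dset \<eta>"
    then obtain \<epsilon> and x :: "real^'n" where \<epsilon>: "0 < \<epsilon>" and gap: "\<And>v. v \<in> NA \<eta> \<alpha> \<Longrightarrow> \<exists>i. \<epsilon> \<le> \<bar>v $ i - x $ i\<bar>"
      using not_Dset_imp_gap by blast
    \<comment> \<open>\<open>dense_values_irrational\<close> takes a nonzero target; 0 is replaced
      by a point at distance \<epsilon>/2.\<close>
    define x1 where "x1 = (if x $ i0 = 0 then \<epsilon> / 2 else x $ i0)"
    have x1: "x1 \<noteq> 0" "\<bar>x1 - x $ i0\<bar> \<le> \<epsilon> / 2" using \<epsilon> by (auto simp: x1_def)
    obtain q p :: int where qp: "q \<noteq> 0" "\<bar>\<bar>real_of_int q\<bar> powr \<eta> * (of_int q * \<alpha> $ i0 - of_int p) - x1\<bar> < \<epsilon> / 2"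
      using dense_values_irrational[OF irr \<eta> x1(1), of "\<epsilon>/2"] \<epsilon> by auto
    define v :: "real^'n" where "v = (\<bar>real_of_int q\<bar> powr \<eta>) *\<^sub>R (of_int q *\<^sub>R \<alpha> - (\<chi> i. of_int p))"
    have "v \<in> NA \<eta> \<alpha>" unfolding NA_def v_def using qp(1)
      by (intro CollectI exI[of _ q] exI[of _ "\<chi> i. of_int p"]) auto
    then obtain i where "\<epsilon> \<le> \<bar>v $ i - x $ i\<bar>" using gap by blast
    then have "\<epsilon> \<le> \<bar>v $ i0 - x $ i0\<bar>" using all[of i] by simp
    moreover have "v $ i0 = \<bar>real_of_int q\<bar> powr \<eta> * (of_int q * \<alpha> $ i0 - of_int p)" by (simp add: v_def)
    ultimately show False using qp(2) x1(2) by linarith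
  qed
  moreover have "\<alpha> \<notin> Dset \<eta>" if rat: "\<alpha> $ i0 \<in> \<rat>" for \<alpha> :: "real^'n"
  proof -
    \<comment> \<open>A rational coordinate is its own approximation with error 0, so
      \<open>not_in_DsetI\<close> applies as soon as q^\<eta>/4 exceeds the denominator.\<close>
    obtain p b :: int where pb: "\<alpha> $ i0 = of_int p / of_int b" "0 < b" using rat by (auto elim!: Rats_cases')
    have "filterlim (\<lambda>q::nat. real q powr \<eta> / 4) at_top sequentially" using \<eta> by real_asymp
    then have "\<forall>\<^sub>F q in sequentially. of_int b \<le> real q powr \<eta> / 4" by (simp add: filterlim_at_top)
    then obtain q0 where q0: "\<And>q. q0 \<le> q \<Longrightarrow> of_int b \<le> real q powr \<eta> / 4" by (auto simp: eventually_sequentially)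
    show ?thesis
    proof (rule not_in_DsetI[OF \<eta>(1), of q0])
      fix q :: nat assume "q0 \<le> q"
      then show "\<exists>l (b::int) (p::int). 0 < b \<and> of_int b \<le> real q powr \<eta> / 4 \<and>
         \<bar>\<alpha> $ l - of_int p / of_int b\<bar> \<le> real q powr (-(1+\<eta>)) / 4"
        using pb q0 by (intro exI[of _ i0] exI[of _ b] exI[of _ p]) simp
    qed
  qed
  ultimately show ?thesis using all by (auto, metis+)
qed

subsection \<open>The dimension bounds\<close>

theorem theorem2:
  fixes \<eta> :: real
  assumes "0 < \<eta>" and "\<eta> < 1 / real CARD('n::finite)"
  shows "(CARD('n) = 1 \<longrightarrow>
            - (Dset \<eta> :: (real ^ 'n) set) = - Kset \<and>
            - (Kset :: (real ^ 'n) set) = {\<alpha>. \<forall>i. \<alpha> $ i \<in> \<rat>})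
       \<and> (CARD('n) \<ge> 2 \<longrightarrow>
            ereal (real CARD('n) / (1 + 1 / \<eta>))
              \<le> hausdorff_dim (- (Dset \<eta> :: (real ^ 'n) set) - (- Kset))
          \<and> hausdorff_dim (- (Dset \<eta> :: (real ^ 'n) set) - (- Kset))
              \<le> ereal (real CARD('n) - 2 + 2 * (real CARD('n) + 1) * ((1 + \<eta>) * real CARD('n) - 1)
                        / ((1 + \<eta>) * real CARD('n) ^ 2)))"
proof (intro conjI impI)
  assume c1: "CARD('n) = 1"
  show K: "- (Kset :: (real ^ 'n) set) = {\<alpha>. \<forall>i. \<alpha> $ i \<in> \<rat>}" by (rule compl_Kset_card_1[OF c1])
  show "- (Dset \<eta> :: (real ^ 'n) set) = - Kset"
    unfolding K using assms c1 by (intro compl_Dset_card_1) auto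
next
  define d where "d = real CARD('n)"
  assume c2: "CARD('n) \<ge> 2"
  then have d2: "2 \<le> d" by (simp add: d_def)
  have \<eta>d: "\<eta> * d < 1" using assms(2) d2 by (simp add: d_def pos_less_divide_eq)
  have \<eta>2: "\<eta> < 1/2"
  proof -
    have "\<eta> * 2 \<le> \<eta> * d" using assms(1) d2 by (intro mult_left_mono) auto
    then show ?thesis using \<eta>d by simp
  qed
  have set_eq: "- (Dset \<eta> :: (real ^ 'n) set) - (- Kset) = - Dset \<eta> \<inter> Kset" by blast
  show "ereal (real CARD('n) / (1 + 1 / \<eta>)) \<le> hausdorff_dim (- (Dset \<eta> :: (real ^ 'n) set) - (- Kset))"
  proof (cases "CARD('n) = 2")
    case True
    then show ?thesis unfolding set_eq using hausdorff_dim_ge_card_2[OF assms(1) \<eta>2 True] by simp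
  next
    case False
    then have "3 \<le> CARD('n)" using c2 by simp
    have "d / (1 + 1 / \<eta>) \<le> 1"
    proof -
      have "d \<le> 1 / \<eta>" using \<eta>d assms(1) by (simp add: field_simps)
      then show ?thesis using assms(1) d2 by (subst divide_le_eq_1_pos) (auto simp: add_pos_pos)
    qed
    then have "ereal (d / (1 + 1 / \<eta>)) \<le> ereal 1" by simp
    also have "\<dots> \<le> hausdorff_dim (- Dset \<eta> \<inter> Kset :: (real ^ 'n) set)"
      by (rule hausdorff_dim_ge_card_3[OF assms(1) \<eta>2 \<open>3 \<le> CARD('n)\<close>])
    finally show ?thesis unfolding set_eq d_def .
  qed
  have "hausdorff_dim (- Dset \<eta> \<inter> Kset :: (real ^ 'n) set) \<le> ereal (d - 1 + (d + 1) * \<eta> / (1 + \<eta>))"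
    unfolding d_def using assms(1) \<eta>2 by (intro hausdorff_dim_compl_Dset_le) auto
  also have "d - 1 + (d + 1) * \<eta> / (1 + \<eta>) \<le> d - 2 + 2 * (d + 1) * ((1 + \<eta>) * d - 1) / ((1 + \<eta>) * d ^ 2)"
  proof -
    have nz: "1 + \<eta> \<noteq> 0" "d \<noteq> 0" using assms(1) d2 by auto
    have "d - 2 + 2 * (d + 1) * ((1 + \<eta>) * d - 1) / ((1 + \<eta>) * d ^ 2) - (d - 1 + (d + 1) * \<eta> / (1 + \<eta>))
      = (d ^ 2 - 2) * (1 - \<eta> * d) / ((1 + \<eta>) * d ^ 2)"
      using nz by (simp add: divide_simps) (simp add: algebra_simps power2_eq_square)
    also have "\<dots> \<ge> 0"
    proof (intro divide_nonneg_nonneg mult_nonneg_nonneg)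
      have "2 ^ 2 \<le> d ^ 2" using d2 by (intro power_mono) auto
      then show "0 \<le> d ^ 2 - 2" by simp
    qed (use \<eta>d assms(1) in auto)
    finally show ?thesis by simp
  qed
  finally show "hausdorff_dim (- (Dset \<eta> :: (real ^ 'n) set) - (- Kset))
      \<le> ereal (real CARD('n) - 2 + 2 * (real CARD('n) + 1) * ((1 + \<eta>) * real CARD('n) - 1) / ((1 + \<eta>) * real CARD('n) ^ 2))"
    unfolding set_eq d_def by simp
qed

end
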